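(* Let $N\ge 5$ and $\alpha,l\in\mathbb{R}$, put $N'=N+\alpha$ and $\tau=l-\alpha$, and assume $2N>N'>4$ and $\tau>-4$. Let $p_s=\frac{N'+4+2\tau}{N'-4}$, and let $B\subset\mathbb{R}^N$ be a ball centered at $0$. Then the embedding $$D^{2,\alpha}_{0,\mathrm{rad}}(B)\hookrightarrow L^q_l(B)$$ is continuous for every $q\in[1,p_s+1]$ and compact for every $q\in[1,p_s+1)$.
   Context: $D^{2,\alpha}_0(B)$ is the completion of $C_c^\infty(B\setminus\{0\})$ with respect to the norm $\|\phi\|_{2,\alpha}=\left(\int_B|x|^\alpha|\Delta\phi|^2\,dx\right)^{1/2}$, and $D^{2,\alpha}_{0,\mathrm{rad}}(B)=\{\phi\in D^{2,\alpha}_0(B):\phi(x)=\phi(|x|)\}$. For $q\ge1$, $L^q_l(B)$ is the space of functions $\phi$ with $|x|^{l/q}|\phi|\in L^q(B)$, with norm $\|\phi\|_{L^q_l(B)}=\left(\int_B|x|^l|\phi|^q\,dx\right)^{1/q}$. *)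

theory Defs
  imports "HOL-Analysis.Analysis"
begin

definition partial_deriv :: "'n::finite \<Rightarrow> (real^'n \<Rightarrow> real) \<Rightarrow> real^'n \<Rightarrow> real" where
  "partial_deriv i f x = frechet_derivative f (at x) (axis i 1)"

text \<open>A function on the whole space is \<open>C\<^sup>\<infinity>\<close> iff all its iterated partial derivatives (the empty
  list gives the function itself) are everywhere differentiable: they are then continuous, too.\<close>

definition smooth :: "(real^'n::finite \<Rightarrow> real) \<Rightarrow> bool" where
  "smooth f \<longleftrightarrow> (\<forall>is. (fold partial_deriv is f) differentiable_on UNIV)"

definition laplacian :: "(real^'n::finite \<Rightarrow> real) \<Rightarrow> real^'n \<Rightarrow> real" where
  "laplacian f x = (\<Sum>i\<in>UNIV. partial_deriv i (partial_deriv i f) x)"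

text \<open>\<open>C\<^sub>c\<^sup>\<infinity>(\<Omega>)\<close>; its members are extended by zero to the whole space.\<close>

definition test_functions :: "(real^'n::finite) set \<Rightarrow> (real^'n \<Rightarrow> real) set" where
  "test_functions \<Omega> =
     {f. smooth f \<and> compact (closure {x. f x \<noteq> 0}) \<and> closure {x. f x \<noteq> 0} \<subseteq> \<Omega>}"

definition test_norm :: "real \<Rightarrow> (real^'n::finite) set \<Rightarrow> (real^'n \<Rightarrow> real) \<Rightarrow> real" where
  "test_norm \<alpha> B f = sqrt (LINT x:B|lebesgue. norm x powr \<alpha> * (laplacian f x)\<^sup>2)"

definition L1_loc_tendsto ::
  "(real^'n::finite) set \<Rightarrow> (nat \<Rightarrow> real^'n \<Rightarrow> real) \<Rightarrow> (real^'n \<Rightarrow> real) \<Rightarrow> bool" where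
  "L1_loc_tendsto \<Omega> u f \<longleftrightarrow>
     (\<forall>K. compact K \<and> K \<subseteq> \<Omega> \<longrightarrow>
        set_integrable lebesgue K f \<and>
        (\<lambda>n. LINT x:K|lebesgue. \<bar>u n x - f x\<bar>) \<longlonglongrightarrow> 0)"

text \<open>The completion is realised as a space of functions on \<open>B\<close> (representatives of a.e. classes):
  a Cauchy sequence of test functions is identified with its limit in \<open>L\<^sup>1\<^sub>l\<^sub>o\<^sub>c(B - {0})\<close>.
  If \<open>4 < N + \<alpha> < 2 N\<close>, the weighted Rellich inequality bounds the norm of
  \<open>|x|\<^bsup>(\<alpha>-4)/2\<^esup> f\<close> in \<open>L\<^sup>2\<close> by a multiple of the norm of \<open>f\<close>, so that every Cauchy sequence has
  such a limit.  Conversely, a Cauchy sequence with limit \<open>0\<close> has norms tending to \<open>0\<close>, because the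
  limit of the Laplacians is the weak Laplacian of the limit.  So this is the whole completion, and
  the norm of a limit does not depend on the approximating sequence.\<close>

definition D2_approx ::
  "real \<Rightarrow> (real^'n::finite) set \<Rightarrow> (nat \<Rightarrow> real^'n \<Rightarrow> real) \<Rightarrow> (real^'n \<Rightarrow> real) \<Rightarrow> bool" where
  "D2_approx \<alpha> B u f \<longleftrightarrow>
     (\<forall>n. u n \<in> test_functions (B - {0})) \<and>
     (\<forall>\<epsilon>>0. \<exists>n0. \<forall>m\<ge>n0. \<forall>n\<ge>n0. test_norm \<alpha> B (\<lambda>x. u m x - u n x) < \<epsilon>) \<and>
     f \<in> borel_measurable (lebesgue_on B) \<and>
     L1_loc_tendsto (B - {0}) u f"

definition D2 :: "real \<Rightarrow> (real^'n::finite) set \<Rightarrow> (real^'n \<Rightarrow> real) set" where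
  "D2 \<alpha> B = {f. \<exists>u. D2_approx \<alpha> B u f}"

definition D2_norm :: "real \<Rightarrow> (real^'n::finite) set \<Rightarrow> (real^'n \<Rightarrow> real) \<Rightarrow> real" where
  "D2_norm \<alpha> B f = (THE c. \<exists>u. D2_approx \<alpha> B u f \<and> (\<lambda>n. test_norm \<alpha> B (u n)) \<longlonglongrightarrow> c)"

definition D2_rad :: "real \<Rightarrow> (real^'n::finite) set \<Rightarrow> (real^'n \<Rightarrow> real) set" where
  "D2_rad \<alpha> B = {f \<in> D2 \<alpha> B. \<exists>g. AE x in lebesgue_on B. f x = g (norm x)}"

definition Lq_weighted :: "real \<Rightarrow> real \<Rightarrow> (real^'n::finite) set \<Rightarrow> (real^'n \<Rightarrow> real) set" where
  "Lq_weighted q l B =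
     {f. f \<in> borel_measurable (lebesgue_on B) \<and>
         integrable (lebesgue_on B) (\<lambda>x. (norm x powr (l / q) * \<bar>f x\<bar>) powr q)}"

definition Lq_weighted_norm :: "real \<Rightarrow> real \<Rightarrow> (real^'n::finite) set \<Rightarrow> (real^'n \<Rightarrow> real) \<Rightarrow> real" where
  "Lq_weighted_norm q l B f =
     (LINT x|lebesgue_on B. norm x powr l * \<bar>f x\<bar> powr q) powr (1 / q)"

text \<open>Embeddings (by the inclusion map) of function spaces, each given by its carrier and its norm.\<close>

definition continuous_embedding ::
  "('a \<Rightarrow> real) set \<Rightarrow> (('a \<Rightarrow> real) \<Rightarrow> real) \<Rightarrow> ('a \<Rightarrow> real) set \<Rightarrow> (('a \<Rightarrow> real) \<Rightarrow> real) \<Rightarrow> bool" where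
  "continuous_embedding X nX Y nY \<longleftrightarrow> X \<subseteq> Y \<and> (\<exists>C. \<forall>f\<in>X. nY f \<le> C * nX f)"

definition compact_embedding ::
  "('a \<Rightarrow> real) set \<Rightarrow> (('a \<Rightarrow> real) \<Rightarrow> real) \<Rightarrow> ('a \<Rightarrow> real) set \<Rightarrow> (('a \<Rightarrow> real) \<Rightarrow> real) \<Rightarrow> bool" where
  "compact_embedding X nX Y nY \<longleftrightarrow>
     continuous_embedding X nX Y nY \<and>
     (\<forall>u M. (\<forall>n::nat. u n \<in> X \<and> nX (u n) \<le> M) \<longrightarrow>
        (\<exists>f\<in>Y. \<exists>r. strict_mono r \<and> (\<lambda>k. nY (\<lambda>x. u (r k) x - f x)) \<longlonglongrightarrow> 0))"

end

theory Submission
  imports Defs "HOL-Complex_Analysis.Great_Picard"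
begin

text \<open>
  A radial element \<open>f\<close> of the completion is a limit of test functions \<open>u\<close> that need not be radial.  Radial
  symmetry is essential: if \<open>p\<^sub>s + 1\<close> exceeds the Sobolev exponent \<open>2N/(N-4)\<close>, functions that concentrate at a point away
  from the origin violate the claim.  Classically one would replace \<open>u\<close> by its spherical mean.  Here
  that mean is expressed through the Laplacian: by Newton's theorem the mean of \<open>|x - y|\<^bsup>2-N\<^esup>\<close> over
  \<open>|x| = r\<close> is \<open>max r |y|\<^bsup>2-N\<^esup>\<close>, so the spherical mean of \<open>u\<close> at radius \<open>r\<close> is a constant multiple of
  \<open>\<integral> max r |y|\<^bsup>2-N\<^esup> \<Delta>u(y) dy\<close>.  This formula is taken as the definition of \<^emph>\<open>radial potential\<close>, and
  Green's identity shows that \<open>u\<close> and the potential of \<open>\<Delta>u\<close> have the same integral against every continuous radial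
  function that is supported in an annulus around the origin (\<open>integral_radial_potential_laplacian\<close>).  Since the limit \<open>f\<close> is radial, this identifies \<open>f\<close> almost everywhere with
  \<open>F(|x|)\<close>, where \<open>F\<close> is the pointwise limit of the potentials (\<open>D2_rad_profile\<close>).

  All analytic information is contained in three estimates of the potential by \<open>c\<close>, the weighted norm of \<open>\<Delta>u\<close>.
  Cauchy-Schwarz gives \<open>|F(r)| \<le> C c r\<^bsup>-(N'-4)/2\<^esup>\<close> and the equicontinuity
  \<open>|F(r) - F(s)| \<le> C c |r\<^bsup>2-N\<^esup> - s\<^bsup>2-N\<^esup>|\<close>, and a Schur test gives the radial Rellich inequality
  \<open>\<integral> |x|\<^bsup>\<alpha>-4\<^esup> F(|x|)\<^sup>2 dx \<le> C c\<^sup>2\<close>.  They require \<open>4 < N' < 2N\<close>.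

  For \<open>q < p\<^sub>s + 1\<close> the pointwise estimate alone shows that \<open>|x|\<^bsup>l\<^esup> |F|\<^bsup>q\<^esup>\<close> is integrable.
  For \<open>q = p\<^sub>s + 1\<close> it just fails; there it is applied to the factor \<open>|F|\<^bsup>q-2\<^esup>\<close>, which leaves the integral of
  the Rellich inequality.  Compactness below the critical exponent follows by the Arzela-Ascoli argument on \<open>(0, R)\<close> and dominated
  convergence.

  The norm of \<open>f\<close> is the limit of the norms of the test functions.  That it depends on \<open>f\<close> only is again a consequence of
  Green's identity (\<open>D2_approx_unique\<close>).
\<close>

section \<open>Integration of radial functions\<close>

abbreviation sphere_area :: "'a::euclidean_space itself \<Rightarrow> real" where
  "sphere_area _ \<equiv> real DIM('a) * unit_ball_vol (real DIM('a))"

text \<open>Both sides give the interval \<open>{..r}\<close> the volume of the closed ball of radius \<open>r\<close>, and these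
  intervals generate the Borel sets.  This is all of polar coordinates that the proof needs.\<close>

lemma distr_norm_lborel:
  "distr lborel borel (norm :: 'a::euclidean_space \<Rightarrow> real) =
     density lborel (\<lambda>r. ennreal (sphere_area TYPE('a) * r ^ (DIM('a) - 1)) * indicator {0..} r)"
  (is "?M = ?D")
proof (rule measure_eqI_generator_eq_countable[where E="range atMost" and \<Omega>=UNIV
      and A="range (\<lambda>n. {..real n})"])
  show "Int_stable (range (atMost :: real \<Rightarrow> _))"
    by (auto simp: Int_stable_def)
  show "sets ?M = sigma_sets UNIV (range atMost)" "sets ?D = sigma_sets UNIV (range atMost)"
    by (auto simp: borel_eq_atMost)
  have M: "emeasure ?M {..r} = emeasure lborel (cball (0::'a) r)" for r
    by (subst emeasure_distr) (auto simp: vimage_def cball_def)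
  have D: "emeasure ?D {..r} = emeasure lborel (cball (0::'a) r)" for r
  proof (cases "r \<ge> 0")
    case True
    let ?c = "sphere_area TYPE('a)"
    have "emeasure ?D {..r} =
        (\<integral>\<^sup>+t. ennreal (?c * t ^ (DIM('a) - 1)) * indicator {0..r} t \<partial>lborel)"
      by (auto simp: emeasure_density intro!: nn_integral_cong split: split_indicator)
    also have "\<dots> = ennreal (unit_ball_vol (real DIM('a)) * r ^ DIM('a) -
        unit_ball_vol (real DIM('a)) * 0 ^ DIM('a))"
      using True by (intro nn_integral_FTC_Icc) (auto intro!: derivative_eq_intros)
    also have "\<dots> = emeasure lborel (cball (0::'a) r)"
      using True by (simp add: emeasure_cball zero_power)
    finally show ?thesis .
  next
    case False
    have "emeasure ?D {..r} = 0"
      using False by (subst emeasure_density)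
        (auto simp: nn_integral_0_iff_AE split: split_indicator intro!: AE_I2)
    moreover have "cball (0::'a) r = {}" using False by auto
    ultimately show ?thesis by simp
  qed
  show "\<And>X. X \<in> range atMost \<Longrightarrow> emeasure ?M X = emeasure ?D X"
    using M D by auto
  show "(\<Union>(range (\<lambda>n. {..real n}))) = UNIV"
    by (auto intro: real_arch_simple)
  show "\<And>a. a \<in> range (\<lambda>n. {..real n}) \<Longrightarrow> emeasure ?M a \<noteq> \<infinity>"
    using M emeasure_cball[of _ "0::'a"] by auto
qed auto

lemma nn_integral_radial:
  assumes [measurable]: "g \<in> borel_measurable borel"
  shows "(\<integral>\<^sup>+x. g (norm (x::'a::euclidean_space)) \<partial>lborel) =
    (\<integral>\<^sup>+r. ennreal (sphere_area TYPE('a) * r ^ (DIM('a) - 1)) * indicator {0..} r * g r \<partial>lborel)"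
proof -
  have "(\<integral>\<^sup>+x. g (norm (x::'a)) \<partial>lborel) = (\<integral>\<^sup>+r. g r \<partial>distr lborel borel (norm :: 'a \<Rightarrow> real))"
    by (simp add: nn_integral_distr)
  also have "\<dots> = (\<integral>\<^sup>+r. ennreal (sphere_area TYPE('a) * r ^ (DIM('a) - 1)) * indicator {0..} r * g r \<partial>lborel)"
    by (simp add: distr_norm_lborel nn_integral_density)
  finally show ?thesis .
qed

lemma integral_radial:
  fixes g :: "real \<Rightarrow> real"
  assumes [measurable]: "g \<in> borel_measurable borel"
  shows "(LINT x|lborel. g (norm (x::'a::euclidean_space))) =
    (LINT r|lborel. sphere_area TYPE('a) * r ^ (DIM('a) - 1) * indicator {0..} r * g r)"
proof -
  have "(LINT x|lborel. g (norm (x::'a))) = (LINT r|distr lborel borel (norm :: 'a \<Rightarrow> real). g r)"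
    by (simp add: integral_distr)
  also have "\<dots> = (LINT r|density lborel (\<lambda>r. ennreal (sphere_area TYPE('a) * r ^ (DIM('a) - 1) * indicator {0..} r)). g r)"
    unfolding distr_norm_lborel
    by (intro arg_cong2[where f="lebesgue_integral"] arg_cong2[where f=density])
       (auto simp: fun_eq_iff split: split_indicator)
  also have "\<dots> = (LINT r|lborel. sphere_area TYPE('a) * r ^ (DIM('a) - 1) * indicator {0..} r * g r)"
    by (subst integral_density) (auto split: split_indicator)
  finally show ?thesis .
qed

text \<open>The image of Lebesgue measure under the norm is absolutely continuous, so null sets of radii
  pull back to null sets.\<close>

lemma AE_norm:
  assumes "AE r in lborel. P r" and "Measurable.pred borel P"
  shows "AE x in lborel. P (norm (x::'a::euclidean_space))"
proof -
  have "AE r in distr lborel borel (norm :: 'a \<Rightarrow> real). P r"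
    unfolding distr_norm_lborel using assms(1) by (subst AE_density) auto
  then show ?thesis
    using assms(2) by (subst (asm) AE_distr_iff) auto
qed

lemma nn_integral_powr_to_0:
  fixes s r :: real
  assumes "s > -1" "r > 0"
  shows "(\<integral>\<^sup>+t. ennreal (t powr s) * indicator {0..r} t \<partial>lborel) = ennreal (r powr (s+1) / (s+1))"
  by (rule nn_integral_has_integral_lebesgue'[OF _ has_integral_powr_from_0]) (use assms in auto)

lemma nn_integral_powr_to_inf:
  fixes s r :: real
  assumes "s < -1" "r > 0"
  shows "(\<integral>\<^sup>+t. ennreal (t powr s) * indicator {r..} t \<partial>lborel) = ennreal (- (r powr (s+1)) / (s+1))"
  by (rule nn_integral_has_integral_lebesgue'[OF _ has_integral_powr_to_inf]) (use assms in auto)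

text \<open>The exponents make the integrand integrable at \<open>0\<close> (first assumption) and at infinity (second
  one); the power of \<open>r\<close> is dictated by scaling.  The three estimates for the radial potential below
  all come from this one bound, with different exponents.\<close>

lemma nn_integral_max_powr:
  fixes s m :: real
  assumes s: "s > - real DIM('a::euclidean_space)" and m: "m + s < - real DIM('a)"
  shows "\<exists>C>0. \<forall>r>0. (\<integral>\<^sup>+x. ennreal (max r (norm (x::'a)) powr m * norm x powr s) \<partial>lborel) \<le>
           ennreal (C * r powr (real DIM('a) + m + s))"
proof -
  let ?n = "real DIM('a)"
  define c where "c = sphere_area TYPE('a)"
  have c: "c > 0" by (simp add: c_def)
  define C where "C = c * (1 / (s + ?n) - 1 / (m + s + ?n))"
  have "1 / (s + ?n) > 0" "1 / (m + s + ?n) < 0"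
    using s m by (auto simp: divide_simps)
  then have C: "C > 0" using c unfolding C_def by (intro mult_pos_pos) linarith+
  have "(\<integral>\<^sup>+x. ennreal (max r (norm (x::'a)) powr m * norm x powr s) \<partial>lborel) \<le>
           ennreal (C * r powr (?n + m + s))" if r: "r > 0" for r
  proof -
    have pw: "t ^ (DIM('a) - Suc 0) = t powr (?n - 1)" if "t > 0" for t :: real
      using that DIM_positive[where 'a='a] by (subst powr_realpow[symmetric]) (auto simp: of_nat_diff Suc_leI)
    have "(\<integral>\<^sup>+x. ennreal (max r (norm (x::'a)) powr m * norm x powr s) \<partial>lborel) =
       (\<integral>\<^sup>+t. ennreal (c * t ^ (DIM('a) - 1)) * indicator {0..} t * ennreal (max r t powr m * t powr s) \<partial>lborel)"
      unfolding c_def by (rule nn_integral_radial) auto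
    also have "\<dots> \<le> (\<integral>\<^sup>+t. ennreal (c * r powr m) * (ennreal (t powr (s + ?n - 1)) * indicator {0..r} t) +
       ennreal c * (ennreal (t powr (m + s + ?n - 1)) * indicator {r..} t) \<partial>lborel)"
    proof (rule nn_integral_mono)
      fix t :: real
      consider "t < 0" | "t = 0" | "0 < t" "t \<le> r" | "r < t" by linarith
      then show "ennreal (c * t ^ (DIM('a) - 1)) * indicator {0..} t * ennreal (max r t powr m * t powr s) \<le>
        ennreal (c * r powr m) * (ennreal (t powr (s + ?n - 1)) * indicator {0..r} t) +
        ennreal c * (ennreal (t powr (m + s + ?n - 1)) * indicator {r..} t)"
      proof cases
        case 3
        then have "ennreal (c * t ^ (DIM('a) - 1)) * indicator {0..} t * ennreal (max r t powr m * t powr s)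
          = ennreal (c * r powr m) * (ennreal (t powr (s + ?n - 1)) * indicator {0..r} t)"
          using c by (simp add: pw max_def ennreal_mult[symmetric] powr_add powr_diff mult_ac)
        then show ?thesis by simp
      next
        case 4
        then have "ennreal (c * t ^ (DIM('a) - 1)) * indicator {0..} t * ennreal (max r t powr m * t powr s)
          = ennreal c * (ennreal (t powr (m + s + ?n - 1)) * indicator {r..} t)"
          using c r by (simp add: pw max_def ennreal_mult[symmetric] powr_add powr_diff mult_ac)
        then show ?thesis by simp
      qed auto
    qed
    also have "\<dots> = ennreal (c * r powr m) * ennreal (r powr (s + ?n - 1 + 1) / (s + ?n - 1 + 1)) +
       ennreal c * ennreal (- (r powr (m + s + ?n - 1 + 1)) / (m + s + ?n - 1 + 1))"
      using s m r nn_integral_powr_to_0[of "s + ?n - 1" r] nn_integral_powr_to_inf[of "m + s + ?n - 1" r]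
      by (subst nn_integral_add) (auto simp: nn_integral_cmult)
    also have "\<dots> = ennreal (C * r powr (?n + m + s))"
      using c s m r unfolding C_def
      by (subst (1 2) ennreal_mult[symmetric], auto simp: divide_simps)
        (subst ennreal_plus[symmetric], auto simp: divide_simps powr_add algebra_simps)
    finally show ?thesis .
  qed
  with C show ?thesis by blast
qed

section \<open>Test functions and Green's identity\<close>

lemma integrable_continuous_compact_support:
  fixes f :: "'a::euclidean_space \<Rightarrow> real"
  assumes "continuous_on UNIV f" "compact K" "\<And>x. x \<notin> K \<Longrightarrow> f x = 0"
  shows "integrable lborel f"
proof -
  have "integrable lborel (\<lambda>x. indicator K x *\<^sub>R f x)"
    using assms by (intro borel_integrable_compact) (auto intro: continuous_on_subset)
  also have "(\<lambda>x. indicator K x *\<^sub>R f x) = f"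
    using assms(3) by (auto simp: fun_eq_iff indicator_def)
  finally show ?thesis .
qed

lemma integral_lborel_translate:
  fixes f :: "'a::euclidean_space \<Rightarrow> real"
  assumes [measurable]: "f \<in> borel_measurable borel"
  shows "(LINT x|lborel. f (x + c)) = (LINT x|lborel. f x)"
proof -
  have "(LINT x|lborel. f x) = (LINT x|distr lborel borel ((+) c). f x)"
    by (simp add: lborel_distr_plus)
  also have "\<dots> = (LINT x|lborel. f (x + c))"
    by (subst integral_distr) (auto simp: add.commute)
  finally show ?thesis by simp
qed

text \<open>The difference quotients have integral \<open>0\<close> by translation invariance.  They are dominated by a
  multiple of the indicator of a large ball, because of the mean value theorem.\<close>

lemma integral_directional_derivative_eq_0:
  fixes f f' :: "'a::euclidean_space \<Rightarrow> real"
  assumes der: "\<And>x. ((\<lambda>t. f (x + t *\<^sub>R e)) has_real_derivative f' x) (at 0)"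
    and cont: "continuous_on UNIV f" "continuous_on UNIV f'"
    and supp: "\<And>x. norm x > M \<Longrightarrow> f x = 0"
  shows "(LINT x|lborel. f' x) = 0"
proof -
  have [measurable]: "f \<in> borel_measurable borel" "f' \<in> borel_measurable borel"
    using cont by (auto intro: borel_measurable_continuous_onI)
  define K where "K = cball (0::'a) (\<bar>M\<bar> + 2 * norm e)"
  have "bounded (f' ` K)"
    using cont(2) by (intro compact_imp_bounded compact_continuous_image) 
      (auto simp: K_def intro: continuous_on_subset)
  then obtain A where A: "\<And>x. x \<in> K \<Longrightarrow> \<bar>f' x\<bar> \<le> A" "A > 0"
    unfolding bounded_pos by auto
  define h where "h = (\<lambda>n::nat. 1 / real (Suc n))"
  define s where "s = (\<lambda>n x. (f (x + h n *\<^sub>R e) - f x) / h n)"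
  have h: "0 < h n" "h n \<le> 1" for n by (auto simp: h_def)
  have h0: "h \<longlonglongrightarrow> 0" unfolding h_def by (rule LIMSEQ_Suc[OF lim_1_over_n])
  have der': "((\<lambda>t. f (x + t *\<^sub>R e)) has_real_derivative f' (x + t *\<^sub>R e)) (at t)" for x t
    using der[of "x + t *\<^sub>R e"] DERIV_shift[of "\<lambda>t. f (x + t *\<^sub>R e)" _ 0 t]
    by (simp add: algebra_simps)
  have int_f: "integrable lborel f"
    using cont supp by (intro integrable_continuous_compact_support[of _ "cball 0 \<bar>M\<bar>"]) auto
  have "(\<lambda>n. LINT x|lborel. s n x) \<longlonglongrightarrow> (LINT x|lborel. f' x)"
  proof (rule integral_dominated_convergence[where w="\<lambda>x. A * indicator K x"])
    have "emeasure lborel K < \<infinity>"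
      unfolding K_def by (intro emeasure_bounded_finite) simp
    then show "integrable lborel (\<lambda>x. A * indicator K x)"
      by (intro integrable_mult_right integrable_real_indicator) (auto simp: K_def)
    show "AE x in lborel. (\<lambda>n. s n x) \<longlonglongrightarrow> f' x"
    proof (rule AE_I2)
      fix x
      have "((\<lambda>t. (f (x + t *\<^sub>R e) - f x) / t) \<longlongrightarrow> f' x) (at 0)"
        using der[of x] by (simp add: DERIV_def)
      moreover have "filterlim h (at 0) sequentially"
        using h0 h(1) by (intro filterlim_atI) (auto intro!: always_eventually simp: less_imp_neq[symmetric])
      ultimately show "(\<lambda>n. s n x) \<longlonglongrightarrow> f' x"
        unfolding s_def by (rule filterlim_compose)
    qed
    show "AE x in lborel. norm (s n x) \<le> A * indicator K x" for n
    proof (rule AE_I2)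
      fix x
      show "norm (s n x) \<le> A * indicator K x"
      proof (cases "norm x \<le> \<bar>M\<bar> + norm e")
        case True
        obtain t where t: "0 < t" "t < h n"
          "f (x + h n *\<^sub>R e) - f (x + 0 *\<^sub>R e) = (h n - 0) * f' (x + t *\<^sub>R e)"
          using MVT2[OF h(1)[of n], of "\<lambda>t. f (x + t *\<^sub>R e)" "\<lambda>t. f' (x + t *\<^sub>R e)"] der' by blast
        have "norm (t *\<^sub>R e) \<le> 1 * norm e"
          using t(1,2) h(2)[of n] unfolding norm_scaleR by (intro mult_right_mono) auto
        then have "x + t *\<^sub>R e \<in> K" using True norm_triangle_ineq[of x "t *\<^sub>R e"] by (auto simp: K_def)
        moreover have "x \<in> K" using True norm_ge_zero[of e] unfolding K_def mem_cball_0 by linarith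
        ultimately show ?thesis using A t h(1)[of n] by (auto simp: s_def)
      next
        case False
        have "norm (h n *\<^sub>R e) \<le> 1 * norm e"
          using h[of n] unfolding norm_scaleR by (intro mult_right_mono) auto
        then have "norm (x + h n *\<^sub>R e) > M" 
          using False norm_diff_ineq[of x "h n *\<^sub>R e"] by linarith
        moreover have "norm x > M" using False norm_ge_zero[of e] by linarith
        ultimately show ?thesis using A by (auto simp: s_def supp indicator_def)
      qed
    qed
  qed (auto simp: s_def)
  moreover have "(LINT x|lborel. s n x) = 0" for n
  proof -
    have "integrable lborel (\<lambda>x. f (h n *\<^sub>R e + x))"
      using int_f integrable_distr[of "(+) (h n *\<^sub>R e)" lborel borel f]
      by (simp add: lborel_distr_plus)
    then show ?thesis
      using int_f integral_lborel_translate[of f "h n *\<^sub>R e"] unfolding s_def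
      by (simp add: add.commute)
  qed
  ultimately show ?thesis by (simp add: LIMSEQ_const_iff)
qed

text \<open>Only one-dimensional restrictions enter, so that Green's identity applies to functions like
  \<open>\<phi>(|x|)\<close> without differentiability in several variables.\<close>

definition has_partial :: "'n::finite \<Rightarrow> (real^'n \<Rightarrow> real) \<Rightarrow> real \<Rightarrow> real^'n \<Rightarrow> bool" where
  "has_partial i f d x \<longleftrightarrow> ((\<lambda>t. f (x + t *\<^sub>R axis i 1)) has_real_derivative d) (at 0)"

lemma integral_has_partial_eq_0:
  assumes "\<And>x. has_partial i f (f' x) x" "continuous_on UNIV f" "continuous_on UNIV f'"
    and "\<And>x. norm x > M \<Longrightarrow> f x = 0"
  shows "(LINT x|lborel. f' x) = 0"
  by (rule integral_directional_derivative_eq_0[OF assms(1)[unfolded has_partial_def] assms(2-4)])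

lemma has_partial_mult:
  assumes "has_partial i f d x" "has_partial i g d' x"
  shows "has_partial i (\<lambda>x. f x * g x) (d * g x + d' * f x) x"
  using assms unfolding has_partial_def by (auto intro!: derivative_eq_intros)

lemma has_partial_add:
  assumes "has_partial i f d x" "has_partial i g d' x"
  shows "has_partial i (\<lambda>x. f x + g x) (d + d') x"
  using assms unfolding has_partial_def by (auto intro!: derivative_eq_intros)

lemma has_partial_diff:
  assumes "has_partial i f d x" "has_partial i g d' x"
  shows "has_partial i (\<lambda>x. f x - g x) (d - d') x"
  using assms unfolding has_partial_def by (auto intro!: derivative_eq_intros)

lemma has_partial_compose:
  assumes "has_partial i f d x" "(g has_real_derivative e) (at (f x))"
  shows "has_partial i (\<lambda>x. g (f x)) (e * d) x"
proof -
  have "((\<lambda>t. f (x + t *\<^sub>R axis i 1)) has_real_derivative d) (at 0)"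
    "(g has_real_derivative e) (at (f (x + 0 *\<^sub>R axis i 1)))"
    using assms by (simp_all add: has_partial_def)
  from DERIV_chain2[OF this(2,1)] show ?thesis by (simp add: has_partial_def)
qed

lemma has_partial_differentiable:
  assumes "f differentiable at x"
  shows "has_partial i f (partial_deriv i f x) x"
proof -
  have f: "(f has_derivative frechet_derivative f (at x)) (at x)"
    using assms frechet_derivative_works by blast
  then have lin: "linear (frechet_derivative f (at x))" by (rule has_derivative_linear)
  have "((\<lambda>t. x + t *\<^sub>R axis i 1) has_derivative (\<lambda>t. t *\<^sub>R axis i 1)) (at (0::real))"
    by (auto intro!: derivative_eq_intros)
  from has_derivative_compose[OF this, of f "frechet_derivative f (at x)"] f
  have "((\<lambda>t. f (x + t *\<^sub>R axis i 1)) has_derivative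
      (\<lambda>t. frechet_derivative f (at x) (t *\<^sub>R axis i 1))) (at 0)"
    by simp
  then show ?thesis
    unfolding has_partial_def partial_deriv_def has_field_derivative_def
    by (simp add: linear_cmul[OF lin] mult_commute_abs)
qed

lemma has_partial_vanish:
  assumes "open S" "x \<in> S" "\<And>y. y \<in> S \<Longrightarrow> f y = 0"
  shows "has_partial i f 0 x"
proof -
  let ?T = "(\<lambda>t::real. x + t *\<^sub>R axis i 1) -` S"
  have "open ?T" by (intro open_vimage assms continuous_intros)
  from has_field_derivative_transform_within_open[OF DERIV_const this] show ?thesis
    unfolding has_partial_def using assms by auto
qed

lemma has_partial_unique: "has_partial i f d x \<Longrightarrow> has_partial i f d' x \<Longrightarrow> d = d'"
  unfolding has_partial_def by (rule DERIV_unique)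

lemma smooth_differentiable: "smooth f \<Longrightarrow> f differentiable at x"
  unfolding smooth_def differentiable_on_def by (metis UNIV_I fold_simps(1) id_apply)

lemma smooth_continuous: "smooth f \<Longrightarrow> continuous_on UNIV f"
  by (meson differentiable_imp_continuous_within continuous_at_imp_continuous_on smooth_differentiable)

lemma smooth_partial_deriv: "smooth f \<Longrightarrow> smooth (partial_deriv i f)"
  unfolding smooth_def by (metis fold_simps(2))

lemma has_partial_smooth: "smooth f \<Longrightarrow> has_partial i f (partial_deriv i f x) x"
  by (intro has_partial_differentiable smooth_differentiable)

lemma partial_deriv_lincomb:
  assumes "smooth f" "smooth g"
  shows "partial_deriv i (\<lambda>x. a * f x + b * g x) = (\<lambda>x. a * partial_deriv i f x + b * partial_deriv i g x)"
proof
  fix x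
  have "(\<lambda>x. a * f x + b * g x) differentiable at x"
    using assms by (intro derivative_intros smooth_differentiable)
  then have "has_partial i (\<lambda>x. a * f x + b * g x) (partial_deriv i (\<lambda>x. a * f x + b * g x) x) x"
    by (rule has_partial_differentiable)
  moreover have "has_partial i (\<lambda>x. a * f x + b * g x) (a * partial_deriv i f x + b * partial_deriv i g x) x"
    using has_partial_smooth[OF assms(1), of i x] has_partial_smooth[OF assms(2), of i x]
    unfolding has_partial_def by (intro derivative_intros DERIV_cmult)
  ultimately show "partial_deriv i (\<lambda>x. a * f x + b * g x) x = a * partial_deriv i f x + b * partial_deriv i g x"
    by (rule has_partial_unique)
qed

lemma smooth_lincomb:
  assumes "smooth f" "smooth g"
  shows "smooth (\<lambda>x. a * f x + b * g x)"
proof -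
  have "fold partial_deriv is (\<lambda>x. a * f x + b * g x) =
      (\<lambda>x. a * fold partial_deriv is f x + b * fold partial_deriv is g x)" for "is"
    using assms
    by (induction "is" arbitrary: f g) (simp_all add: partial_deriv_lincomb smooth_partial_deriv)
  then show ?thesis
    using assms unfolding smooth_def
    by (auto simp: differentiable_on_def intro!: derivative_intros)
qed

lemma compact_closed_subset:
  assumes "compact K" "A \<subseteq> K" "closed A"
  shows "compact A"
  using compact_Int_closed[OF assms(1,3)] assms(2) by (simp add: Int_absorb1)

lemma test_functions_lincomb:
  assumes "f \<in> test_functions \<Omega>" "g \<in> test_functions \<Omega>"
  shows "(\<lambda>x. a * f x + b * g x) \<in> test_functions \<Omega>"
proof -
  have "closure {x. a * f x + b * g x \<noteq> 0} \<subseteq> closure ({x. f x \<noteq> 0} \<union> {x. g x \<noteq> 0})"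
    by (rule closure_mono) auto
  then have *: "closure {x. a * f x + b * g x \<noteq> 0} \<subseteq> closure {x. f x \<noteq> 0} \<union> closure {x. g x \<noteq> 0}"
    by simp
  have "compact (closure {x. f x \<noteq> 0} \<union> closure {x. g x \<noteq> 0})"
    using assms by (intro compact_Un) (simp_all add: test_functions_def)
  then have "compact (closure {x. a * f x + b * g x \<noteq> 0})"
    using * by (rule compact_closed_subset) simp
  with * assms show ?thesis
    by (auto simp: test_functions_def intro: smooth_lincomb)
qed

lemma test_functions_diff:
  "f \<in> test_functions \<Omega> \<Longrightarrow> g \<in> test_functions \<Omega> \<Longrightarrow> (\<lambda>x. f x - g x) \<in> test_functions \<Omega>"
  using test_functions_lincomb[of f \<Omega> g 1 "-1"] by simp

text \<open>A function that vanishes on an open set has vanishing derivatives there.\<close>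

lemma support_partial_deriv:
  assumes "smooth f"
  shows "closure {x. partial_deriv i f x \<noteq> 0} \<subseteq> closure {x. f x \<noteq> 0}"
proof -
  let ?K = "closure {x. f x \<noteq> 0}"
  have "partial_deriv i f x = 0" if "x \<notin> ?K" for x
  proof (rule has_partial_unique)
    show "has_partial i f 0 x"
      by (rule has_partial_vanish[of "- ?K"]) (use that closure_subset[of "{x. f x \<noteq> 0}"] in auto)
    show "has_partial i f (partial_deriv i f x) x"
      using assms by (rule has_partial_smooth)
  qed
  then show ?thesis by (intro closure_minimal) auto
qed

lemma test_functions_partial_deriv:
  assumes "f \<in> test_functions \<Omega>"
  shows "partial_deriv i f \<in> test_functions \<Omega>"
proof -
  have f: "smooth f" "compact (closure {x. f x \<noteq> 0})" "closure {x. f x \<noteq> 0} \<subseteq> \<Omega>"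
    using assms by (auto simp: test_functions_def)
  note * = support_partial_deriv[OF f(1), of i]
  have "compact (closure {x. partial_deriv i f x \<noteq> 0})"
    using f(2) * by (rule compact_closed_subset) simp
  with * f show ?thesis
    by (auto simp: test_functions_def intro: smooth_partial_deriv)
qed

lemma test_functions_sum:
  assumes "finite I" "\<And>i. i \<in> I \<Longrightarrow> f i \<in> test_functions \<Omega>" "g \<in> test_functions \<Omega>"
  shows "(\<lambda>x. \<Sum>i\<in>I. f i x) \<in> test_functions \<Omega>"
  using assms
proof (induction I rule: finite_induct)
  case empty
  then show ?case using test_functions_lincomb[of g \<Omega> g 0 0] by simp
next
  case (insert i I)
  then show ?case using test_functions_lincomb[of "f i" \<Omega> "\<lambda>x. \<Sum>i\<in>I. f i x" 1 1] by simp
qed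

lemma test_functions_laplacian:
  assumes "f \<in> test_functions \<Omega>"
  shows "laplacian f \<in> test_functions \<Omega>"
proof -
  have "laplacian f = (\<lambda>x. \<Sum>i\<in>UNIV. partial_deriv i (partial_deriv i f) x)"
    by (simp add: laplacian_def fun_eq_iff)
  then show ?thesis
    using assms by (auto intro!: test_functions_sum test_functions_partial_deriv)
qed

lemma laplacian_diff:
  assumes "f \<in> test_functions \<Omega>" "g \<in> test_functions \<Omega>"
  shows "laplacian (\<lambda>x. f x - g x) x = laplacian f x - laplacian g x"
proof -
  have fg: "smooth f" "smooth g" using assms by (auto simp: test_functions_def)
  show ?thesis
    using partial_deriv_lincomb[OF fg, where a=1 and b="-1"]
      partial_deriv_lincomb[OF smooth_partial_deriv smooth_partial_deriv, OF fg, where a=1 and b="-1"]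
    by (simp add: laplacian_def sum_subtractf)
qed

lemma test_functions_continuous: "f \<in> test_functions \<Omega> \<Longrightarrow> continuous_on UNIV f"
  by (auto simp: test_functions_def intro: smooth_continuous)

lemma test_functions_measurable [measurable_dest]:
  "f \<in> test_functions \<Omega> \<Longrightarrow> f \<in> borel_measurable borel"
  by (intro borel_measurable_continuous_onI test_functions_continuous)

lemma test_functions_support:
  assumes "f \<in> test_functions \<Omega>"
  obtains K where "compact K" "K \<subseteq> \<Omega>" "\<And>x. x \<notin> K \<Longrightarrow> f x = 0"
  using assms closure_subset[of "{x. f x \<noteq> 0}"] by (intro that[of "closure {x. f x \<noteq> 0}"]) (auto simp: test_functions_def)

text \<open>Here \<open>f' i\<close> and \<open>f'' i\<close> are the first and the pure second partial derivatives in direction \<open>i\<close>.  The origin is excluded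
  because powers of \<open>|x|\<close> are singular there, while test functions on \<open>B - {0}\<close> do not see it.\<close>

definition C2_punctured ::
  "(real^'n::finite \<Rightarrow> real) \<Rightarrow> ('n \<Rightarrow> real^'n \<Rightarrow> real) \<Rightarrow> ('n \<Rightarrow> real^'n \<Rightarrow> real) \<Rightarrow> bool" where
  "C2_punctured f f' f'' \<longleftrightarrow> continuous_on (- {0}) f \<and>
     (\<forall>i. continuous_on (- {0}) (f' i) \<and> continuous_on (- {0}) (f'' i) \<and>
        (\<forall>x. x \<noteq> 0 \<longrightarrow> has_partial i f (f' i x) x \<and> has_partial i (f' i) (f'' i x) x))"

lemma has_partial_norm:
  fixes x :: "real^'n::finite"
  assumes "x \<noteq> 0"
  shows "has_partial i norm (x $ i / norm x) x"
proof -
  have n: "(norm has_derivative (\<lambda>y. inner y (sgn x))) (at x)"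
    using assms by (rule has_derivative_norm)
  then have "partial_deriv i norm x = inner (axis i 1) (sgn x)"
    unfolding partial_deriv_def by (simp flip: frechet_derivative_at[OF n])
  also have "\<dots> = x $ i / norm x"
    by (simp add: sgn_div_norm inner_axis' divide_inverse mult.commute)
  finally show ?thesis
    using has_partial_differentiable[of norm x i] n by (auto simp: differentiable_def)
qed

lemma has_partial_component: "has_partial i (\<lambda>x. x $ i) 1 x"
  unfolding has_partial_def by (auto intro!: derivative_eq_intros)

text \<open>Writing \<open>\<phi>'(r) = r \<psi>(r)\<close> turns the gradient of \<open>\<phi>(|x|)\<close> into \<open>\<psi>(|x|) x\<close>, which is easier to
  differentiate once more than \<open>\<phi>'(|x|) x / |x|\<close>.\<close>

lemma C2_punctured_radial:
  fixes \<phi> \<psi> \<psi>' :: "real \<Rightarrow> real"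
  assumes \<phi>: "\<And>r. r > 0 \<Longrightarrow> (\<phi> has_real_derivative r * \<psi> r) (at r)"
    and \<psi>: "\<And>r. r > 0 \<Longrightarrow> (\<psi> has_real_derivative \<psi>' r) (at r)"
    and \<psi>': "continuous_on {0<..} \<psi>'"
  shows "C2_punctured (\<lambda>x::real^'n::finite. \<phi> (norm x)) (\<lambda>i x. \<psi> (norm x) * x $ i)
    (\<lambda>i x. \<psi>' (norm x) * (x $ i / norm x) * x $ i + 1 * \<psi> (norm x))"
proof -
  have comp: "continuous_on (- {0::real^'n}) (\<lambda>x. g (norm x))" if "continuous_on {0<..} g" for g :: "real \<Rightarrow> real"
    by (rule continuous_on_compose2[OF that]) (auto intro: continuous_intros)
  have "continuous_on {0<..} \<phi>" "continuous_on {0<..} \<psi>"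
    using \<phi> \<psi> by (auto intro!: continuous_at_imp_continuous_on DERIV_isCont)
  note [continuous_intros] = this[THEN comp] \<psi>'[THEN comp]
  show ?thesis
    unfolding C2_punctured_def
  proof (intro conjI allI impI)
    fix i and x :: "real^'n" assume x: "x \<noteq> 0"
    show "has_partial i (\<lambda>x. \<psi> (norm x) * x $ i) (\<psi>' (norm x) * (x $ i / norm x) * x $ i + 1 * \<psi> (norm x)) x"
      using x by (intro has_partial_mult has_partial_compose[OF has_partial_norm] has_partial_component \<psi>) auto
    have "has_partial i (\<lambda>x. \<phi> (norm x)) ((norm x * \<psi> (norm x)) * (x $ i / norm x)) x"
      using x by (intro has_partial_compose[OF has_partial_norm] \<phi>) auto
    then show "has_partial i (\<lambda>x. \<phi> (norm x)) (\<psi> (norm x) * x $ i) x" using x by simp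
  qed (intro continuous_intros; simp)+
qed

lemma sum_radial_second_derivatives:
  fixes x :: "real^'n::finite"
  assumes "x \<noteq> 0"
  shows "(\<Sum>i\<in>UNIV. \<psi>' (norm x) * (x $ i / norm x) * x $ i + 1 * \<psi> (norm x)) =
    norm x * \<psi>' (norm x) + real CARD('n) * \<psi> (norm x)"
proof -
  have "(\<Sum>i\<in>UNIV. x $ i * x $ i) = norm x * norm x"
    using power2_norm_eq_inner[of x] by (simp add: inner_vec_def power2_eq_square)
  moreover have "(\<Sum>i\<in>UNIV. \<psi>' (norm x) * (x $ i / norm x) * x $ i) =
      \<psi>' (norm x) / norm x * (\<Sum>i\<in>UNIV. x $ i * x $ i)"
    unfolding sum_distrib_left by (intro sum.cong) auto
  ultimately show ?thesis
    using assms by (simp add: sum.distrib)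
qed

lemma C2_punctured_norm_powr:
  obtains f' f'' where "C2_punctured (\<lambda>x::real^'n::finite. norm x powr \<alpha>) f' f''"
proof -
  have "C2_punctured (\<lambda>x::real^'n. norm x powr \<alpha>) (\<lambda>i x. \<alpha> * norm x powr (\<alpha> - 2) * x $ i)
    (\<lambda>i x. \<alpha> * (\<alpha> - 2) * norm x powr (\<alpha> - 3) * (x $ i / norm x) * x $ i + 1 * (\<alpha> * norm x powr (\<alpha> - 2)))"
    by (rule C2_punctured_radial)
      (auto intro!: derivative_eq_intros continuous_intros simp: powr_diff field_simps power2_eq_square power3_eq_cube)
  then show ?thesis by (rule that)
qed

lemma C2_punctured_test_functions:
  assumes "f \<in> test_functions \<Omega>"
  shows "C2_punctured f (\<lambda>i. partial_deriv i f) (\<lambda>i. partial_deriv i (partial_deriv i f))"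
proof -
  have "smooth f" using assms by (auto simp: test_functions_def)
  then show ?thesis unfolding C2_punctured_def
    by (auto intro!: continuous_on_subset[OF smooth_continuous] smooth_partial_deriv has_partial_smooth)
qed

lemma C2_punctured_mult:
  fixes f g :: "real^'n::finite \<Rightarrow> real"
  assumes "C2_punctured f f' f''" "C2_punctured g g' g''"
  shows "C2_punctured (\<lambda>x. f x * g x) (\<lambda>i x. f' i x * g x + g' i x * f x)
    (\<lambda>i x. f'' i x * g x + g' i x * f' i x + (g'' i x * f x + f' i x * g' i x))"
  unfolding C2_punctured_def
proof (intro conjI allI impI)
  note f = assms(1)[unfolded C2_punctured_def] and g = assms(2)[unfolded C2_punctured_def]
  fix i :: 'n
  show "continuous_on (- {0}) (\<lambda>x. f x * g x)"
    "continuous_on (- {0}) (\<lambda>x. f' i x * g x + g' i x * f x)"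
    "continuous_on (- {0}) (\<lambda>x. f'' i x * g x + g' i x * f' i x + (g'' i x * f x + f' i x * g' i x))"
    using f g by (intro continuous_intros; simp)+
  fix x :: "real^'n" assume "x \<noteq> 0"
  then show "has_partial i (\<lambda>x. f x * g x) (f' i x * g x + g' i x * f x) x"
    "has_partial i (\<lambda>x. f' i x * g x + g' i x * f x)
       (f'' i x * g x + g' i x * f' i x + (g'' i x * f x + f' i x * g' i x)) x"
    using f g by (intro has_partial_add has_partial_mult; simp)+
qed

text \<open>The product is continuous off \<open>0\<close> and vanishes near \<open>0\<close>: two open sets that cover the space.\<close>

lemma continuous_on_mult_punctured:
  fixes f g :: "real^'n::finite \<Rightarrow> real"
  assumes "continuous_on (- {0}) f" "continuous_on UNIV g"
    and K: "closed K" "0 \<notin> K" "\<And>x. x \<notin> K \<Longrightarrow> g x = 0"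
  shows "continuous_on UNIV (\<lambda>x. f x * g x)"
proof -
  have "continuous_on (- {0} \<union> - K) (\<lambda>x. f x * g x)"
  proof (rule continuous_on_open_Un)
    show "continuous_on (- {0}) (\<lambda>x. f x * g x)"
      using assms by (intro continuous_intros) (auto intro: continuous_on_subset)
    have "continuous_on (- K) (\<lambda>x. 0::real)" by simp
    then show "continuous_on (- K) (\<lambda>x. f x * g x)"
      by (rule continuous_on_eq) (use K in auto)
  qed (use K in auto)
  moreover have "- {0} \<union> - K = UNIV" using K by auto
  ultimately show ?thesis by simp
qed

lemma integrable_punctured_mult_test_function:
  assumes "continuous_on (- {0}) f" "u \<in> test_functions (B - {0})"
  shows "integrable lborel (\<lambda>x. f x * u x)" "continuous_on UNIV (\<lambda>x. f x * u x)"
proof -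
  obtain K where K: "compact K" "K \<subseteq> B - {0}" "\<And>x. x \<notin> K \<Longrightarrow> u x = 0"
    using test_functions_support[OF assms(2)] by blast
  show 1: "continuous_on UNIV (\<lambda>x. f x * u x)"
    using assms K by (intro continuous_on_mult_punctured[of _ _ K] compact_imp_closed)
      (auto intro: test_functions_continuous)
  show "integrable lborel (\<lambda>x. f x * u x)"
    by (rule integrable_continuous_compact_support[OF 1 K(1)]) (use K in auto)
qed

text \<open>For each direction, \<open>u \<partial>\<^sub>i f - f \<partial>\<^sub>i u\<close> has compact support, so its derivative
  \<open>u \<partial>\<^sub>i\<^sup>2 f - f \<partial>\<^sub>i\<^sup>2 u\<close> integrates to \<open>0\<close>.\<close>

lemma Green_identity:
  fixes u :: "real^'n::finite \<Rightarrow> real"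
  assumes u: "u \<in> test_functions (B - {0})" and f: "C2_punctured f f' f''"
  shows "(LINT x|lborel. (\<Sum>i\<in>UNIV. f'' i x) * u x) = (LINT x|lborel. f x * laplacian u x)"
proof -
  obtain K where K: "compact K" "K \<subseteq> B - {0}" "\<And>x. x \<notin> K \<Longrightarrow> u x = 0"
    using test_functions_support[OF u] by blast
  note tf = test_functions_partial_deriv[OF u] 
    test_functions_partial_deriv[OF test_functions_partial_deriv[OF u]]
  have cf: "continuous_on (- {0}) f" "continuous_on (- {0}) (f' i)" "continuous_on (- {0}) (f'' i)" for i
    using f by (auto simp: C2_punctured_def)
  note int = integrable_punctured_mult_test_function[OF _ u] integrable_punctured_mult_test_function[OF _ tf(1)]
    integrable_punctured_mult_test_function[OF _ tf(2)]
  have z: "\<exists>S. open S \<and> 0 \<in> S \<and> (\<forall>y\<in>S. v y = 0)" if v: "v \<in> test_functions (B - {0})" for v :: "real^'n \<Rightarrow> real"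
  proof -
    obtain K where K: "compact K" "K \<subseteq> B - {0}" "\<And>x. x \<notin> K \<Longrightarrow> v x = 0"
      using test_functions_support[OF v] by blast
    then show ?thesis by (intro exI[of _ "- K"]) (auto intro: compact_imp_closed)
  qed
  have "(LINT x|lborel. f'' i x * u x - f x * partial_deriv i (partial_deriv i u) x) = 0" for i
  proof -
    obtain K' where K': "compact K'" "K' \<subseteq> B - {0}" "\<And>x. x \<notin> K' \<Longrightarrow> partial_deriv i u x = 0"
      using test_functions_support[OF tf(1)] by blast
    have "bounded (K \<union> K')" using K(1) K'(1) by (simp add: compact_imp_bounded)
    then obtain M where M: "\<And>x. x \<in> K \<union> K' \<Longrightarrow> norm x \<le> M" unfolding bounded_iff by blast
    show ?thesis
    proof (rule integral_has_partial_eq_0[where i=i and M=M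
          and f="\<lambda>x. f' i x * u x - f x * partial_deriv i u x"])
      fix x
      show "has_partial i (\<lambda>x. f' i x * u x - f x * partial_deriv i u x)
          (f'' i x * u x - f x * partial_deriv i (partial_deriv i u) x) x"
      proof (cases "x = 0")
        case True
        obtain S1 where S1: "open S1" "0 \<in> S1" "\<forall>y\<in>S1. u y = 0" using z[OF u] by blast
        obtain S2 where S2: "open S2" "0 \<in> S2" "\<forall>y\<in>S2. partial_deriv i u y = 0" using z[OF tf(1)] by blast
        obtain S3 where S3: "open S3" "0 \<in> S3" "\<forall>y\<in>S3. partial_deriv i (partial_deriv i u) y = 0" using z[OF tf(2)] by blast
        have "has_partial i (\<lambda>x. f' i x * u x - f x * partial_deriv i u x) 0 x"
          by (rule has_partial_vanish[of "S1 \<inter> S2"]) (use S1 S2 True in auto)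
        with S1 S3 True show ?thesis by simp
      next
        case False
        have "has_partial i (\<lambda>x. f' i x * u x - f x * partial_deriv i u x)
         ((f'' i x * u x + partial_deriv i u x * f' i x) -
          (f' i x * partial_deriv i u x + partial_deriv i (partial_deriv i u) x * f x)) x"
          using f u False by (intro has_partial_diff has_partial_mult)
           (auto simp: C2_punctured_def test_functions_def intro: has_partial_smooth smooth_partial_deriv)
        then show ?thesis by (simp add: algebra_simps)
      qed
    next
      fix x :: "real^'n" assume "norm x > M"
      then show "f' i x * u x - f x * partial_deriv i u x = 0"
        using M[of x] K(3)[of x] K'(3)[of x] by force
    qed (intro continuous_on_diff int cf)+
  qed
  then have "(\<Sum>i\<in>UNIV. LINT x|lborel. f'' i x * u x - f x * partial_deriv i (partial_deriv i u) x) = 0"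
    by simp
  then have "(\<Sum>i\<in>UNIV. LINT x|lborel. f'' i x * u x) =
      (\<Sum>i\<in>UNIV. LINT x|lborel. f x * partial_deriv i (partial_deriv i u) x)"
    using int cf by (simp add: sum_subtractf)
  then show ?thesis
    using int cf by (simp add: laplacian_def sum_distrib_left sum_distrib_right)
qed

section \<open>The norm of the completion\<close>

definition weighted_inner :: "real \<Rightarrow> (real^'n::finite \<Rightarrow> real) \<Rightarrow> (real^'n \<Rightarrow> real) \<Rightarrow> real" where
  "weighted_inner \<alpha> f g = (LINT x|lborel. norm x powr \<alpha> * f x * g x)"

lemma continuous_on_norm_powr: "continuous_on (- {0::real^'n::finite}) (\<lambda>x. norm x powr \<alpha>)"
  by (intro continuous_intros) auto

lemma integrable_weighted_inner:
  fixes f g :: "real^'n::finite \<Rightarrow> real"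
  assumes "f \<in> test_functions (B - {0})" "g \<in> test_functions (B - {0})"
  shows "integrable lborel (\<lambda>x. norm x powr \<alpha> * f x * g x)"
  using assms by (intro integrable_punctured_mult_test_function[of _ g B] continuous_on_mult continuous_on_norm_powr)
    (auto intro: continuous_on_subset[OF test_functions_continuous])

lemma weighted_inner_diff_right:
  fixes f g :: "real^'n::finite \<Rightarrow> real"
  assumes "f \<in> test_functions (B - {0})" "g \<in> test_functions (B - {0})" "h \<in> test_functions (B - {0})"
  shows "weighted_inner \<alpha> f (\<lambda>x. g x - h x) = weighted_inner \<alpha> f g - weighted_inner \<alpha> f h"
  unfolding weighted_inner_def using assms
  by (simp add: right_diff_distrib integrable_weighted_inner)

lemma weighted_inner_Cauchy_Schwarz:
  fixes f g :: "real^'n::finite \<Rightarrow> real"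
  assumes fg: "f \<in> test_functions (B - {0})" "g \<in> test_functions (B - {0})"
  shows "\<bar>weighted_inner \<alpha> f g\<bar> \<le> sqrt (weighted_inner \<alpha> f f) * sqrt (weighted_inner \<alpha> g g)"
proof -
  let ?i = "weighted_inner \<alpha>"
  have pos: "0 \<le> ?i h h" for h :: "real^'n \<Rightarrow> real"
    unfolding weighted_inner_def by (intro integral_nonneg_AE AE_I2) (simp add: mult.assoc)
  have q: "0 \<le> a\<^sup>2 * ?i f f + 2 * a * b * ?i f g + b\<^sup>2 * ?i g g" for a b
  proof -
    have "?i (\<lambda>x. a * f x + b * g x) (\<lambda>x. a * f x + b * g x) =
      (LINT x|lborel. a\<^sup>2 * (norm x powr \<alpha> * f x * f x) + 2 * a * b * (norm x powr \<alpha> * f x * g x)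
        + b\<^sup>2 * (norm x powr \<alpha> * g x * g x))"
      unfolding weighted_inner_def
      by (intro Bochner_Integration.integral_cong) (auto simp: power2_eq_square algebra_simps)
    also have "\<dots> = a\<^sup>2 * ?i f f + 2 * a * b * ?i f g + b\<^sup>2 * ?i g g"
      using fg by (simp add: weighted_inner_def integrable_weighted_inner)
    finally show ?thesis using pos[of "\<lambda>x. a * f x + b * g x"] by simp
  qed
  have "(?i f g)\<^sup>2 \<le> ?i f f * ?i g g"
  proof (cases "?i g g = 0")
    case False
    have "0 \<le> ?i g g * (?i f f * ?i g g - (?i f g)\<^sup>2)"
      using q[of "?i g g" "- ?i f g"] by (simp add: power2_eq_square algebra_simps)
    then show ?thesis using False pos[of g] by (simp add: zero_le_mult_iff)
  next
    case True
    have "?i f g = 0"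
    proof (rule ccontr)
      assume "?i f g \<noteq> 0"
      then show False
        using q[of 1 "- (?i f f + 1) / (2 * ?i f g)"] True pos[of f] by (simp add: field_simps)
    qed
    with True show ?thesis by simp
  qed
  then show ?thesis
    by (metis real_sqrt_abs real_sqrt_le_iff real_sqrt_mult)
qed

lemma test_norm_eq:
  assumes "u \<in> test_functions (B - {0})"
  shows "test_norm \<alpha> B u = sqrt (weighted_inner \<alpha> (laplacian u) (laplacian u))"
proof -
  have L: "laplacian u \<in> test_functions (B - {0})" using assms by (rule test_functions_laplacian)
  have z: "laplacian u x = 0" if "x \<notin> B" for x
    using test_functions_support[OF L] that by (metis DiffD1 subsetD)
  have [measurable]: "laplacian u \<in> borel_measurable borel" using L by (rule test_functions_measurable)
  have "(LINT x:B|lebesgue. norm x powr \<alpha> * (laplacian u x)\<^sup>2) =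
      (LINT x|lebesgue. norm x powr \<alpha> * laplacian u x * laplacian u x)"
    unfolding set_lebesgue_integral_def
    by (intro Bochner_Integration.integral_cong) (auto simp: z power2_eq_square indicator_def)
  also have "\<dots> = weighted_inner \<alpha> (laplacian u) (laplacian u)"
    unfolding weighted_inner_def by (intro integral_completion) measurable
  finally show ?thesis by (simp add: test_norm_def)
qed

lemma weighted_inner_self_nonneg: "0 \<le> weighted_inner \<alpha> f f"
  unfolding weighted_inner_def by (intro integral_nonneg_AE AE_I2) (simp add: mult.assoc)

lemma test_norm_nonneg: "0 \<le> test_norm \<alpha> B u"
  unfolding test_norm_def set_lebesgue_integral_def by (intro real_sqrt_ge_zero integral_nonneg_AE) auto

lemma test_norm_triangle:
  assumes u: "u \<in> test_functions (B - {0})" and v: "v \<in> test_functions (B - {0})"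
  shows "test_norm \<alpha> B (\<lambda>x. u x - v x) \<le> test_norm \<alpha> B u + test_norm \<alpha> B v"
proof -
  let ?i = "weighted_inner \<alpha>" and ?u = "laplacian u" and ?v = "laplacian v"
  note L = test_functions_laplacian[OF u] test_functions_laplacian[OF v]
  have "?i (laplacian (\<lambda>x. u x - v x)) (laplacian (\<lambda>x. u x - v x)) =
    (LINT x|lborel. (norm x powr \<alpha> * ?u x * ?u x) - 2 * (norm x powr \<alpha> * ?u x * ?v x)
        + (norm x powr \<alpha> * ?v x * ?v x))"
    unfolding weighted_inner_def laplacian_diff[OF u v]
    by (intro Bochner_Integration.integral_cong) (auto simp: algebra_simps)
  also have "\<dots> = ?i ?u ?u - 2 * ?i ?u ?v + ?i ?v ?v"
    using L by (simp add: weighted_inner_def integrable_weighted_inner)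
  also have "\<dots> \<le> (sqrt (?i ?u ?u) + sqrt (?i ?v ?v))\<^sup>2"
    using weighted_inner_Cauchy_Schwarz[OF L, of \<alpha>] weighted_inner_self_nonneg[of \<alpha> ?u]
      weighted_inner_self_nonneg[of \<alpha> ?v] by (simp add: power2_sum abs_le_iff)
  finally show ?thesis
    using u v by (simp add: test_norm_eq test_functions_diff real_le_lsqrt weighted_inner_self_nonneg)
qed

lemma test_norm_minus_commute:
  assumes u: "u \<in> test_functions (B - {0})" and v: "v \<in> test_functions (B - {0})"
  shows "test_norm \<alpha> B (\<lambda>x. u x - v x) = test_norm \<alpha> B (\<lambda>x. v x - u x)"
  unfolding test_norm_def laplacian_diff[OF u v] laplacian_diff[OF v u]
  by (simp add: power2_commute)

lemma abs_test_norm_diff_le: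
  assumes u: "u \<in> test_functions (B - {0})" and v: "v \<in> test_functions (B - {0})"
  shows "\<bar>test_norm \<alpha> B u - test_norm \<alpha> B v\<bar> \<le> test_norm \<alpha> B (\<lambda>x. u x - v x)"
  using test_norm_triangle[OF u test_functions_diff[OF u v], of \<alpha>]
    test_norm_triangle[OF v test_functions_diff[OF v u], of \<alpha>] test_norm_minus_commute[OF u v, of \<alpha>]
  by simp

text \<open>Green's identity moves the Laplacian of \<open>w n\<close> onto the fixed function \<open>|x|\<^bsup>\<alpha>\<^esup> v\<close>, whose second derivatives are
  bounded and supported in a compact subset of \<open>B - {0}\<close>; convergence in \<open>L\<^sup>1\<^sub>l\<^sub>o\<^sub>c\<close> is then enough.\<close>

lemma weighted_inner_laplacian_tendsto_0:
  fixes v :: "real^'n::finite \<Rightarrow> real"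
  assumes v: "v \<in> test_functions (B - {0})"
    and w: "\<And>n. w n \<in> test_functions (B - {0})" "L1_loc_tendsto (B - {0}) w (\<lambda>_. 0)"
  shows "(\<lambda>n. weighted_inner \<alpha> v (laplacian (w n))) \<longlonglongrightarrow> 0"
proof -
  obtain p' p'' where p: "C2_punctured (\<lambda>x::real^'n. norm x powr \<alpha>) p' p''"
    using C2_punctured_norm_powr by blast
  define g where "g = (\<lambda>x. \<Sum>i\<in>UNIV. p'' i x * v x + partial_deriv i v x * p' i x +
     (partial_deriv i (partial_deriv i v) x * norm x powr \<alpha> + p' i x * partial_deriv i v x))"
  note C2 = C2_punctured_mult[OF p C2_punctured_test_functions[OF v]]
  have cont: "continuous_on (- {0}) g"
    using C2 unfolding g_def C2_punctured_def by (auto intro!: continuous_on_sum)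
  define K where "K = closure {x. v x \<noteq> 0}"
  have smooth: "smooth v" "smooth (partial_deriv i v)" for i
    using v by (auto simp: test_functions_def intro: smooth_partial_deriv)
  have K: "compact K" "K \<subseteq> B - {0}" using v by (auto simp: test_functions_def K_def)
  have "g x = 0" if "x \<notin> K" for x
  proof -
    have "v x = 0" "partial_deriv i v x = 0" "partial_deriv i (partial_deriv i v) x = 0" for i
      using that support_partial_deriv[OF smooth(1), of i] support_partial_deriv[OF smooth(2), of i i]
        closure_subset[of "{x. v x \<noteq> 0}"] closure_subset[of "{x. partial_deriv i v x \<noteq> 0}"]
        closure_subset[of "{x. partial_deriv i (partial_deriv i v) x \<noteq> 0}"]
      unfolding K_def by blast+
    then show ?thesis by (simp add: g_def)
  qed
  note gK = this
  have "compact (g ` K)"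
    using K cont by (intro compact_continuous_image) (auto intro: continuous_on_subset)
  then obtain A where A: "\<And>x. x \<in> K \<Longrightarrow> \<bar>g x\<bar> \<le> A" 
    using compact_imp_bounded[of "g ` K"] unfolding bounded_iff by auto
  have bound: "\<bar>weighted_inner \<alpha> v (laplacian (w n))\<bar> \<le> A * (LINT x:K|lebesgue. \<bar>w n x - 0\<bar>)" for n
  proof -
    have [measurable]: "w n \<in> borel_measurable borel" using w(1) by (rule test_functions_measurable)
    have [measurable]: "K \<in> sets borel" unfolding K_def by simp
    have "weighted_inner \<alpha> v (laplacian (w n)) = (LINT x|lborel. g x * w n x)"
      unfolding weighted_inner_def g_def Green_identity[OF w(1)[of n] C2] ..
    also have "\<bar>\<dots>\<bar> \<le> (LINT x|lborel. \<bar>g x * w n x\<bar>)" by (rule integral_abs_bound)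
    also have "\<dots> \<le> (LINT x|lborel. A * (indicator K x * \<bar>w n x\<bar>))"
    proof (rule integral_mono)
      show "integrable lborel (\<lambda>x. \<bar>g x * w n x\<bar>)"
        using integrable_punctured_mult_test_function(1)[OF cont w(1)] by (rule integrable_abs)
      have "integrable lborel (w n)"
        using integrable_punctured_mult_test_function(1)[of "\<lambda>_. 1", OF _ w(1)] by simp
      then show "integrable lborel (\<lambda>x. A * (indicator K x * \<bar>w n x\<bar>))"
        using integrable_mult_indicator[of K lborel "\<lambda>x. \<bar>w n x\<bar>"] by simp
    qed (use A gK in \<open>auto simp: abs_mult indicator_def intro!: mult_right_mono\<close>)
    also have "\<dots> = A * (LINT x:K|lebesgue. \<bar>w n x - 0\<bar>)"
      unfolding set_lebesgue_integral_def by (subst integral_completion) auto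
    finally show ?thesis .
  qed
  have "(\<lambda>n. LINT x:K|lebesgue. \<bar>w n x - 0\<bar>) \<longlonglongrightarrow> 0"
    using w(2) K unfolding L1_loc_tendsto_def by simp
  then have lim: "(\<lambda>n. A * (LINT x:K|lebesgue. \<bar>w n x - 0\<bar>)) \<longlonglongrightarrow> 0"
    by (rule tendsto_mult_right_zero)
  show ?thesis
    by (rule Lim_null_comparison[OF _ lim], rule always_eventually, rule allI)
      (unfold real_norm_def, rule bound)
qed

text \<open>Let \<open>w = u - v\<close>, a Cauchy sequence that tends to \<open>0\<close> in \<open>L\<^sup>1\<^sub>l\<^sub>o\<^sub>c\<close>, and write the square of the norm of \<open>w n\<close> as
  \<open>\<langle>\<Delta> w n, \<Delta> (w n - w m)\<rangle> + \<langle>\<Delta> w n, \<Delta> w m\<rangle>\<close> in the weighted inner product.  The first term is small by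
  the Cauchy property, and the second one tends to \<open>0\<close> as \<open>m\<close> grows.  Completeness of \<open>L\<^sup>2\<close> is avoided.\<close>

lemma D2_approx_unique:
  assumes u: "D2_approx \<alpha> B u f" and v: "D2_approx \<alpha> B v f"
  shows "(\<lambda>n. test_norm \<alpha> B (\<lambda>x. u n x - v n x)) \<longlonglongrightarrow> 0"
proof -
  define w where "w = (\<lambda>n x. u n x - v n x)"
  have un: "u n \<in> test_functions (B - {0})" and vn: "v n \<in> test_functions (B - {0})" for n
    using u v by (auto simp: D2_approx_def)
  have wn: "w n \<in> test_functions (B - {0})" for n
    unfolding w_def using un vn by (rule test_functions_diff)
  have L1: "L1_loc_tendsto (B - {0}) w (\<lambda>_. 0)"
    unfolding L1_loc_tendsto_def
  proof safe
    fix K assume K: "compact K" "K \<subseteq> B - {0}"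
    then have [measurable]: "K \<in> sets lebesgue" 
      by (intro sets_completionI_sets) (auto intro: borel_compact)
    show "set_integrable lebesgue K (\<lambda>_. 0)" by (simp add: set_integrable_def)
    have int: "set_integrable lebesgue K (\<lambda>x. z n x - f x)" if "D2_approx \<alpha> B z f" for z n
    proof -
      have zn: "z n \<in> test_functions (B - {0})" using that by (auto simp: D2_approx_def)
      have "integrable lebesgue (z n)"
        using integrable_punctured_mult_test_function(1)[of "\<lambda>_. 1", OF _ zn]
        by (intro integrable_completion[THEN iffD2]) (auto intro: test_functions_measurable zn)
      then have "set_integrable lebesgue K (z n)"
        unfolding set_integrable_def by (intro integrable_mult_indicator) auto
      moreover have "set_integrable lebesgue K f"
        using that K by (auto simp: D2_approx_def L1_loc_tendsto_def)
      ultimately show ?thesis by (rule set_integral_diff)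
    qed
    have le: "(LINT x:K|lebesgue. \<bar>w n x - 0\<bar>) \<le>
        (LINT x:K|lebesgue. \<bar>u n x - f x\<bar>) + (LINT x:K|lebesgue. \<bar>v n x - f x\<bar>)" for n
    proof -
      have "(LINT x:K|lebesgue. \<bar>w n x - 0\<bar>) \<le> (LINT x:K|lebesgue. \<bar>u n x - f x\<bar> + \<bar>v n x - f x\<bar>)"
      proof (rule set_integral_mono)
        show "set_integrable lebesgue K (\<lambda>x. \<bar>w n x - 0\<bar>)"
          using set_integrable_abs[OF set_integral_diff(1)[OF int[OF u] int[OF v]]] by (simp add: w_def)
        show "set_integrable lebesgue K (\<lambda>x. \<bar>u n x - f x\<bar> + \<bar>v n x - f x\<bar>)"
          using u v by (intro set_integral_add set_integrable_abs int)
      qed (auto simp: w_def)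
      also have "\<dots> = (LINT x:K|lebesgue. \<bar>u n x - f x\<bar>) + (LINT x:K|lebesgue. \<bar>v n x - f x\<bar>)"
        using u v by (intro set_integral_add set_integrable_abs int)
      finally show ?thesis .
    qed
    have lim: "(\<lambda>n. (LINT x:K|lebesgue. \<bar>u n x - f x\<bar>) + (LINT x:K|lebesgue. \<bar>v n x - f x\<bar>)) \<longlonglongrightarrow> 0"
      using u v K by (intro tendsto_add_zero) (auto simp: D2_approx_def L1_loc_tendsto_def)
    have "0 \<le> (LINT x:K|lebesgue. \<bar>w n x - 0\<bar>)" for n
      unfolding set_lebesgue_integral_def by (intro integral_nonneg_AE) auto
    then show "(\<lambda>n. LINT x:K|lebesgue. \<bar>w n x - 0\<bar>) \<longlonglongrightarrow> 0"
      by (intro Lim_null_comparison[OF always_eventually lim] allI) (use le in simp)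
  qed
  have Cauchy: "\<exists>n0. \<forall>m\<ge>n0. \<forall>n\<ge>n0. test_norm \<alpha> B (\<lambda>x. w m x - w n x) < e" if e: "e > 0" for e
  proof -
    obtain n1 where n1: "\<forall>m\<ge>n1. \<forall>n\<ge>n1. test_norm \<alpha> B (\<lambda>x. u m x - u n x) < e / 2"
      using u half_gt_zero[OF e] unfolding D2_approx_def by blast
    obtain n2 where n2: "\<forall>m\<ge>n2. \<forall>n\<ge>n2. test_norm \<alpha> B (\<lambda>x. v m x - v n x) < e / 2"
      using v half_gt_zero[OF e] unfolding D2_approx_def by blast
    have "test_norm \<alpha> B (\<lambda>x. w m x - w n x) < e" if "m \<ge> max n1 n2" "n \<ge> max n1 n2" for m n
    proof -
      have "(\<lambda>x. w m x - w n x) = (\<lambda>x. (u m x - u n x) - (v m x - v n x))"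
        by (auto simp: w_def)
      then show ?thesis
        using n1[rule_format, of m n] n2[rule_format, of m n] that
          test_norm_triangle[OF test_functions_diff[OF un[of m] un[of n]] test_functions_diff[OF vn[of m] vn[of n]], of \<alpha>]
        by simp
    qed
    then show ?thesis by blast
  qed
  have *: "\<exists>n0. \<forall>n\<ge>n0. test_norm \<alpha> B (w n) \<le> e" if e: "e > 0" for e
  proof -
    obtain n0 where n0: "\<forall>m\<ge>n0. \<forall>n\<ge>n0. test_norm \<alpha> B (\<lambda>x. w m x - w n x) < e"
      using Cauchy[OF e] by blast
    have "test_norm \<alpha> B (w n) \<le> e" if n: "n \<ge> n0" for n
    proof -
      let ?t = "test_norm \<alpha> B (w n)" and ?L = "\<lambda>n. laplacian (w n)"
      note L = test_functions_laplacian[OF wn]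
      have "?t\<^sup>2 \<le> ?t * e + weighted_inner \<alpha> (?L n) (?L m)" if "m \<ge> n0" for m
      proof -
        have "weighted_inner \<alpha> (?L n) (?L n) - weighted_inner \<alpha> (?L n) (?L m) =
            weighted_inner \<alpha> (?L n) (laplacian (\<lambda>x. w n x - w m x))"
          unfolding weighted_inner_diff_right[OF L L L, symmetric]
          by (rule arg_cong[where f="weighted_inner \<alpha> (?L n)"]) (simp add: fun_eq_iff laplacian_diff[OF wn wn])
        also have "\<dots> \<le> ?t * test_norm \<alpha> B (\<lambda>x. w n x - w m x)"
          using weighted_inner_Cauchy_Schwarz[OF L[of n] test_functions_laplacian[OF test_functions_diff[OF wn[of n] wn[of m]]], of \<alpha>]
          by (simp add: test_norm_eq[OF wn] test_norm_eq[OF test_functions_diff[OF wn wn]])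
        also have "\<dots> \<le> ?t * e"
          using n0 n that by (intro mult_left_mono test_norm_nonneg) (simp add: less_imp_le)
        finally show ?thesis
          by (simp add: test_norm_eq[OF wn] weighted_inner_self_nonneg)
      qed
      moreover have "(\<lambda>m. ?t * e + weighted_inner \<alpha> (?L n) (?L m)) \<longlonglongrightarrow> ?t * e + 0"
        by (intro tendsto_add tendsto_const weighted_inner_laplacian_tendsto_0[OF L wn L1])
      ultimately have "?t\<^sup>2 \<le> ?t * e + 0"
        by (intro tendsto_lowerbound[of _ _ sequentially]) (auto simp: eventually_sequentially)
      then show ?thesis
        using e test_norm_nonneg[of \<alpha> B "w n"] by (cases "?t = 0") (auto simp: power2_eq_square)
    qed
    then show ?thesis by blast
  qed
  have "(\<lambda>n. test_norm \<alpha> B (w n)) \<longlonglongrightarrow> 0"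
  proof (rule LIMSEQ_I)
    fix e :: real assume e: "e > 0"
    then obtain n0 where "\<And>n. n \<ge> n0 \<Longrightarrow> test_norm \<alpha> B (w n) \<le> e / 2"
      using * half_gt_zero by metis
    with e show "\<exists>n0. \<forall>n\<ge>n0. norm (test_norm \<alpha> B (w n) - 0) < e"
      using test_norm_nonneg[of \<alpha> B] by (intro exI[of _ n0]) fastforce
  qed
  then show ?thesis by (simp add: w_def)
qed

text \<open>The definite description in the norm of the completion is meaningful: the limit exists by the Cauchy
  property and is unique because two approximating sequences become close in the norm.\<close>

lemma D2_norm_limit:
  assumes u: "D2_approx \<alpha> B u f"
  shows "(\<lambda>n. test_norm \<alpha> B (u n)) \<longlonglongrightarrow> D2_norm \<alpha> B f"
proof -
  have un: "u n \<in> test_functions (B - {0})" for n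
    using u by (auto simp: D2_approx_def)
  have "Cauchy (\<lambda>n. test_norm \<alpha> B (u n))"
  proof (rule CauchyI)
    fix e :: real assume "e > 0"
    then obtain n0 where n0: "\<forall>m\<ge>n0. \<forall>n\<ge>n0. test_norm \<alpha> B (\<lambda>x. u m x - u n x) < e"
      using u unfolding D2_approx_def by blast
    have "norm (test_norm \<alpha> B (u m) - test_norm \<alpha> B (u n)) < e" if "m \<ge> n0" "n \<ge> n0" for m n
    proof -
      have "test_norm \<alpha> B (\<lambda>x. u m x - u n x) < e" using n0 that by blast
      with abs_test_norm_diff_le[OF un[of m] un[of n], of \<alpha>] show ?thesis
        unfolding real_norm_def by (rule le_less_trans)
    qed
    then show "\<exists>M. \<forall>m\<ge>M. \<forall>n\<ge>M. norm (test_norm \<alpha> B (u m) - test_norm \<alpha> B (u n)) < e"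
      by blast
  qed
  then obtain c where c: "(\<lambda>n. test_norm \<alpha> B (u n)) \<longlonglongrightarrow> c"
    using real_Cauchy_convergent convergentD by blast
  have "D2_norm \<alpha> B f = c"
    unfolding D2_norm_def
  proof (rule the_equality)
    show "\<exists>u. D2_approx \<alpha> B u f \<and> (\<lambda>n. test_norm \<alpha> B (u n)) \<longlonglongrightarrow> c" using u c by blast
    fix d assume "\<exists>v. D2_approx \<alpha> B v f \<and> (\<lambda>n. test_norm \<alpha> B (v n)) \<longlonglongrightarrow> d"
    then obtain v where v: "D2_approx \<alpha> B v f" "(\<lambda>n. test_norm \<alpha> B (v n)) \<longlonglongrightarrow> d" by blast
    have vn: "v n \<in> test_functions (B - {0})" for n
      using v by (auto simp: D2_approx_def)
    have "(\<lambda>n. test_norm \<alpha> B (u n) - test_norm \<alpha> B (v n)) \<longlonglongrightarrow> 0"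
      by (rule Lim_null_comparison[OF _ D2_approx_unique[OF u v(1)]])
        (use abs_test_norm_diff_le[OF un vn] in auto)
    moreover have "(\<lambda>n. test_norm \<alpha> B (u n) - test_norm \<alpha> B (v n)) \<longlonglongrightarrow> c - d"
      using c v(2) by (rule tendsto_diff)
    ultimately show "d = c" using LIMSEQ_unique by fastforce
  qed
  with c show ?thesis by simp
qed

section \<open>The radial potential\<close>

text \<open>By Newton's theorem the mean of \<open>|x - y|\<^bsup>2-N\<^esup>\<close> over the sphere \<open>|x| = r\<close> is
  \<open>max r |y|\<^bsup>2-N\<^esup>\<close>.  So this is the spherical mean of the Newtonian potential of \<open>g\<close>; if \<open>g\<close> is the Laplacian
  of a test function \<open>u\<close>, it is the spherical mean of \<open>u\<close>.\<close>

definition radial_potential :: "(real^'n::finite \<Rightarrow> real) \<Rightarrow> real \<Rightarrow> real" where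
  "radial_potential g r = - (LINT x|lborel. max r (norm x) powr (2 - real CARD('n)) * g x) /
     ((real CARD('n) - 2) * sphere_area TYPE(real^'n))"

lemma radial_potential_measurable [measurable]:
  fixes g :: "real^'n::finite \<Rightarrow> real"
  assumes [measurable]: "g \<in> borel_measurable borel"
  shows "radial_potential g \<in> borel_measurable borel"
  unfolding radial_potential_def by measurable

lemma integrable_max_powr_mult:
  fixes g :: "real^'n::finite \<Rightarrow> real"
  assumes g: "integrable lborel g" and r: "r > 0" and m: "m \<le> 0"
  shows "integrable lborel (\<lambda>x. max r (norm x) powr m * g x)"
proof (rule Bochner_Integration.integrable_bound[where f="\<lambda>x. r powr m * g x"])
  show "integrable lborel (\<lambda>x. r powr m * g x)" using g by simp
  show "(\<lambda>x. max r (norm x) powr m * g x) \<in> borel_measurable lborel"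
    using g by measurable
  have "max r (norm x) powr m \<le> r powr m" for x :: "real^'n"
    using r m by (intro powr_mono2') auto
  then show "AE x in lborel. norm (max r (norm x) powr m * g x) \<le> norm (r powr m * g x)"
    by (auto simp: abs_mult intro!: mult_right_mono)
qed

lemma test_functions_integrable:
  assumes "g \<in> test_functions (B - {0})"
  shows "integrable lborel g"
  using integrable_punctured_mult_test_function(1)[of "\<lambda>_. 1", OF _ assms] by simp

lemma test_functions_at_0: "g \<in> test_functions (B - {0}) \<Longrightarrow> g 0 = 0"
  using test_functions_support[of g "B - {0}"] by (metis Diff_iff insertI1 subsetD)

lemma radial_potential_diff:
  fixes f g :: "real^'n::finite \<Rightarrow> real"
  assumes "integrable lborel f" "integrable lborel g" "r > 0" "CARD('n) \<ge> 2"
  shows "radial_potential (\<lambda>x. f x - g x) r = radial_potential f r - radial_potential g r"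
  using assms by (simp add: radial_potential_def right_diff_distrib integrable_max_powr_mult
      diff_divide_distrib)

lemma nn_integral_weighted_inner:
  assumes "g \<in> test_functions (B - {0})"
  shows "(\<integral>\<^sup>+x. ennreal (norm x powr \<alpha> * (g x)\<^sup>2) \<partial>lborel) = ennreal (weighted_inner \<alpha> g g)"
  unfolding weighted_inner_def using integrable_weighted_inner[OF assms assms, of \<alpha>]
  by (subst nn_integral_eq_integral[symmetric]) (auto simp: power2_eq_square mult.assoc)

lemma power2_powr: "((s::real) powr p)\<^sup>2 = s powr (2 * p)"
  by (simp add: power2_eq_square powr_add[symmetric])

lemma power2_le_of_eq_nn_integral:
  assumes "I = (\<integral>\<^sup>+x. f x * g x \<partial>M)" "f \<in> borel_measurable M" "g \<in> borel_measurable M"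
  shows "I\<^sup>2 \<le> (\<integral>\<^sup>+x. (f x)\<^sup>2 \<partial>M) * (\<integral>\<^sup>+x. (g x)\<^sup>2 \<partial>M)"
  unfolding assms(1) by (rule Cauchy_Schwarz_nn_integral[OF assms(2,3)])

text \<open>Cauchy-Schwarz, with the weight \<open>|x|\<^bsup>\<alpha>\<^esup>\<close> given to \<open>g\<^sup>2\<close>.  The remaining integral of
  \<open>max r |x|\<^bsup>4-2N\<^esup> |x|\<^bsup>-\<alpha>\<^esup>\<close> converges at \<open>0\<close> because \<open>\<alpha> < N\<close> and at infinity because \<open>N + \<alpha> > 4\<close>.\<close>

lemma integral_max_powr_bound:
  assumes "real CARD('n::finite) > \<alpha>" "real CARD('n) + \<alpha> > 4" 
  shows "\<exists>C\<ge>0. \<forall>B. \<forall>g \<in> test_functions (B - {0::real^'n}). \<forall>r>0.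
    (LINT x|lborel. max r (norm x) powr (2 - real CARD('n)) * \<bar>g x\<bar>) \<le>
      C * r powr ((4 - (real CARD('n) + \<alpha>)) / 2) * sqrt (weighted_inner \<alpha> g g)"
proof -
  let ?n = "real CARD('n)"
  obtain C where C: "C > 0" "\<And>r. r > 0 \<Longrightarrow>
     (\<integral>\<^sup>+x. ennreal (max r (norm (x::real^'n)) powr (4 - 2 * ?n) * norm x powr (- \<alpha>)) \<partial>lborel) \<le>
     ennreal (C * r powr (?n + (4 - 2 * ?n) + (- \<alpha>)))"
    using nn_integral_max_powr[where 'a="real^'n", of "- \<alpha>" "4 - 2 * ?n"] assms by auto
  have "(LINT x|lborel. max r (norm x) powr (2 - ?n) * \<bar>g x\<bar>) \<le>
      sqrt C * r powr ((4 - (?n + \<alpha>)) / 2) * sqrt (weighted_inner \<alpha> g g)" (is "?I \<le> _")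
    if g: "g \<in> test_functions (B - {0})" and r: "r > 0" for B r and g :: "real^'n \<Rightarrow> real"
  proof -
    have [measurable]: "g \<in> borel_measurable borel" using g by (rule test_functions_measurable)
    have "ennreal ?I = (\<integral>\<^sup>+x. ennreal (max r (norm x) powr (2 - ?n) * \<bar>g x\<bar>) \<partial>lborel)"
      using assms r by (intro nn_integral_eq_integral[symmetric] integrable_max_powr_mult
          integrable_abs test_functions_integrable[OF g]) auto
    also have "\<dots> = (\<integral>\<^sup>+x. ennreal (max r (norm x) powr (2 - ?n) * norm x powr (- \<alpha> / 2)) *
        ennreal (norm x powr (\<alpha> / 2) * \<bar>g x\<bar>) \<partial>lborel)"
    proof (intro nn_integral_cong)
      fix x :: "real^'n"
      have "norm x powr (- \<alpha> / 2) * (norm x powr (\<alpha> / 2) * \<bar>g x\<bar>) = \<bar>g x\<bar>"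
        using test_functions_at_0[OF g] by (cases "x = 0") (auto simp: powr_minus)
      then show "ennreal (max r (norm x) powr (2 - ?n) * \<bar>g x\<bar>) =
          ennreal (max r (norm x) powr (2 - ?n) * norm x powr (- \<alpha> / 2)) *
          ennreal (norm x powr (\<alpha> / 2) * \<bar>g x\<bar>)"
        by (simp add: ennreal_mult[symmetric] mult.assoc)
    qed
    finally have "(ennreal ?I)\<^sup>2 \<le>
        (\<integral>\<^sup>+x. (ennreal (max r (norm (x::real^'n)) powr (2 - ?n) * norm x powr (- \<alpha> / 2)))\<^sup>2 \<partial>lborel) *
        (\<integral>\<^sup>+x. (ennreal (norm x powr (\<alpha> / 2) * \<bar>g x\<bar>))\<^sup>2 \<partial>lborel)"
      by (rule power2_le_of_eq_nn_integral) measurable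
    also have "(\<integral>\<^sup>+x. (ennreal (max r (norm (x::real^'n)) powr (2 - ?n) * norm x powr (- \<alpha> / 2)))\<^sup>2 \<partial>lborel) =
      (\<integral>\<^sup>+x. ennreal (max r (norm (x::real^'n)) powr (4 - 2 * ?n) * norm x powr (- \<alpha>)) \<partial>lborel)"
      using r by (intro nn_integral_cong)
        (simp add: ennreal_power power_mult_distrib power2_powr diff_divide_distrib)
    also have "(\<integral>\<^sup>+x. (ennreal (norm x powr (\<alpha> / 2) * \<bar>g x\<bar>))\<^sup>2 \<partial>lborel) = ennreal (weighted_inner \<alpha> g g)"
      unfolding nn_integral_weighted_inner[OF g, symmetric]
      by (intro nn_integral_cong)
        (simp add: ennreal_power power_mult_distrib power2_powr diff_divide_distrib)
    also have "(\<integral>\<^sup>+x. ennreal (max r (norm (x::real^'n)) powr (4 - 2 * ?n) * norm x powr (- \<alpha>)) \<partial>lborel) *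
        ennreal (weighted_inner \<alpha> g g) \<le>
        ennreal (C * r powr (?n + (4 - 2 * ?n) + (- \<alpha>))) * ennreal (weighted_inner \<alpha> g g)"
      by (intro mult_right_mono C r) auto
    also have "\<dots> = ennreal (C * r powr (4 - (?n + \<alpha>)) * weighted_inner \<alpha> g g)"
      using C(1) weighted_inner_self_nonneg[of \<alpha> g]
      by (simp add: ennreal_mult[symmetric] algebra_simps)
    finally have "?I\<^sup>2 \<le> C * r powr (4 - (?n + \<alpha>)) * weighted_inner \<alpha> g g"
      using C(1) weighted_inner_self_nonneg[of \<alpha> g]
      by (subst (asm) ennreal_power) (auto intro!: integral_nonneg_AE)
    then have "?I \<le> sqrt (C * r powr (4 - (?n + \<alpha>)) * weighted_inner \<alpha> g g)"
      by (rule real_le_rsqrt)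
    also have "\<dots> = sqrt C * r powr ((4 - (?n + \<alpha>)) / 2) * sqrt (weighted_inner \<alpha> g g)"
      by (simp add: real_sqrt_mult powr_half_sqrt[symmetric] powr_powr)
    finally show ?thesis .
  qed
  then show ?thesis using C(1) by (intro exI[of _ "sqrt C"]) auto
qed

lemma radial_potential_bound:
  assumes "real CARD('n::finite) > \<alpha>" "real CARD('n) + \<alpha> > 4" "CARD('n) \<ge> 3"
  shows "\<exists>C\<ge>0. \<forall>B. \<forall>g \<in> test_functions (B - {0::real^'n}). \<forall>r>0.
    \<bar>radial_potential g r\<bar> \<le> C * r powr ((4 - (real CARD('n) + \<alpha>)) / 2) * sqrt (weighted_inner \<alpha> g g)"
proof -
  define k where "k = (real CARD('n) - 2) * sphere_area TYPE(real^'n)"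
  have k: "k > 0" using assms unfolding k_def by (intro mult_pos_pos) auto
  obtain C where C: "C \<ge> 0" "\<And>B g r. g \<in> test_functions (B - {0::real^'n}) \<Longrightarrow> r > 0 \<Longrightarrow>
    (LINT x|lborel. max r (norm x) powr (2 - real CARD('n)) * \<bar>g x\<bar>) \<le>
      C * r powr ((4 - (real CARD('n) + \<alpha>)) / 2) * sqrt (weighted_inner \<alpha> g g)"
    using integral_max_powr_bound[OF assms(1,2)] by blast
  have "\<bar>radial_potential g r\<bar> \<le> C / k * r powr ((4 - (real CARD('n) + \<alpha>)) / 2) * sqrt (weighted_inner \<alpha> g g)"
    if g: "g \<in> test_functions (B - {0::real^'n})" and r: "r > 0" for B r and g :: "real^'n \<Rightarrow> real"
  proof -
    have "\<bar>LINT x|lborel. max r (norm x) powr (2 - real CARD('n)) * g x\<bar> \<le>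
      (LINT x|lborel. \<bar>max r (norm x) powr (2 - real CARD('n)) * g x\<bar>)"
      by (rule integral_abs_bound)
    also have "\<dots> = (LINT x|lborel. max r (norm x) powr (2 - real CARD('n)) * \<bar>g x\<bar>)"
      by (simp add: abs_mult)
    also note C(2)[OF g r]
    finally show ?thesis
      using k unfolding radial_potential_def k_def[symmetric] by (simp add: divide_right_mono)
  qed
  then show ?thesis using k C(1) by (intro exI[of _ "C / k"]) auto
qed

text \<open>The kernels for two radii differ by at most \<open>|r\<^bsup>2-N\<^esup> - s\<^bsup>2-N\<^esup>|\<close>, and the \<open>L\<^sup>1\<close> norm of \<open>g\<close> is bounded by
  \<open>integral_max_powr_bound\<close> at radius \<open>R\<close>, since \<open>max R |x| = R\<close> on the ball.  This provides the equicontinuity behind compactness.\<close>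

lemma radial_potential_lipschitz:
  assumes "real CARD('n::finite) > \<alpha>" "real CARD('n) + \<alpha> > 4" "CARD('n) \<ge> 3" "R > 0"
  shows "\<exists>C\<ge>0. \<forall>g \<in> test_functions (ball 0 R - {0::real^'n}). \<forall>r>0. \<forall>s>0.
    \<bar>radial_potential g r - radial_potential g s\<bar> \<le>
      C * \<bar>r powr (2 - real CARD('n)) - s powr (2 - real CARD('n))\<bar> * sqrt (weighted_inner \<alpha> g g)"
proof -
  let ?m = "2 - real CARD('n)"
  define k where "k = (real CARD('n) - 2) * sphere_area TYPE(real^'n)"
  have k: "k > 0" using assms unfolding k_def by (intro mult_pos_pos) auto
  obtain C where C: "C \<ge> 0" "\<And>B g r. g \<in> test_functions (B - {0::real^'n}) \<Longrightarrow> r > 0 \<Longrightarrow>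
    (LINT x|lborel. max r (norm x) powr ?m * \<bar>g x\<bar>) \<le>
      C * r powr ((4 - (real CARD('n) + \<alpha>)) / 2) * sqrt (weighted_inner \<alpha> g g)"
    using integral_max_powr_bound[OF assms(1,2)] by blast
  define D where "D = R powr (- ?m) * C * R powr ((4 - (real CARD('n) + \<alpha>)) / 2) / k"
  have D: "D \<ge> 0" using C k by (simp add: D_def)
  have "\<bar>radial_potential g r - radial_potential g s\<bar> \<le> D * \<bar>r powr ?m - s powr ?m\<bar> * sqrt (weighted_inner \<alpha> g g)"
    if g: "g \<in> test_functions (ball 0 R - {0::real^'n})" and r: "r > 0" "s > 0" for r s and g :: "real^'n \<Rightarrow> real"
  proof -
    let ?w = "sqrt (weighted_inner \<alpha> g g)"
    have [measurable]: "g \<in> borel_measurable borel" using g by (rule test_functions_measurable)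
    note ig = test_functions_integrable[OF g]
    have m: "?m \<le> 0" using assms by simp
    have "(LINT x|lborel. \<bar>g x\<bar>) = (LINT x|lborel. R powr (- ?m) * (max R (norm x) powr ?m * \<bar>g x\<bar>))"
    proof (intro Bochner_Integration.integral_cong refl)
      fix x
      have "norm x < R \<or> g x = 0"
        using test_functions_support[OF g] by (metis DiffD1 dist_0_norm mem_ball subsetD)
      moreover have "R powr (- ?m) * R powr ?m = 1"
        using assms by (subst powr_add[symmetric]) simp
      ultimately show "\<bar>g x\<bar> = R powr (- ?m) * (max R (norm x) powr ?m * \<bar>g x\<bar>)"
        by (auto simp: max_def mult.assoc[symmetric])
    qed
    also have "\<dots> \<le> R powr (- ?m) * (C * R powr ((4 - (real CARD('n) + \<alpha>)) / 2) * ?w)"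
      using C(2)[OF g \<open>R > 0\<close>] by (simp add: mult_left_mono)
    finally have L1: "(LINT x|lborel. \<bar>g x\<bar>) \<le> D * k * ?w" using k by (simp add: D_def mult_ac)
    have eq: "(LINT x|lborel. max r (norm x) powr ?m * g x) - (LINT x|lborel. max s (norm x) powr ?m * g x)
      = (LINT x|lborel. (max r (norm x) powr ?m - max s (norm x) powr ?m) * g x)"
      using ig r m by (simp add: left_diff_distrib integrable_max_powr_mult)
    have "\<bar>(LINT x|lborel. max r (norm x) powr ?m * g x) - (LINT x|lborel. max s (norm x) powr ?m * g x)\<bar>
      \<le> (LINT x|lborel. \<bar>(max r (norm x) powr ?m - max s (norm x) powr ?m) * g x\<bar>)"
      unfolding eq by (rule integral_abs_bound)
    also have "\<dots> \<le> (LINT x|lborel. \<bar>r powr ?m - s powr ?m\<bar> * \<bar>g x\<bar>)"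
    proof (rule integral_mono)
      show "integrable lborel (\<lambda>x. \<bar>(max r (norm x) powr ?m - max s (norm x) powr ?m) * g x\<bar>)"
        using ig r m by (intro integrable_abs) (simp add: left_diff_distrib integrable_max_powr_mult)
      have le: "\<bar>max r t powr ?m - max s t powr ?m\<bar> \<le> \<bar>r powr ?m - s powr ?m\<bar>" for t
      proof -
        have p: "b powr ?m \<le> a powr ?m" if "0 < a" "a \<le> b" for a b
          using that m by (intro powr_mono2') auto
        consider "t \<le> r" "t \<le> s" | "r \<le> t" "t \<le> s" | "t \<le> r" "s \<le> t" | "r \<le> t" "s \<le> t" by linarith
        then show ?thesis
          using r p[of r t] p[of t s] p[of s t] p[of t r] by cases (auto simp: max_def)
      qed
      show "\<bar>(max r (norm x) powr ?m - max s (norm x) powr ?m) * g x\<bar> \<le> \<bar>r powr ?m - s powr ?m\<bar> * \<bar>g x\<bar>" for x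
        unfolding abs_mult by (intro mult_right_mono le) auto
    qed (use ig in auto)
    also have "\<dots> = \<bar>r powr ?m - s powr ?m\<bar> * (LINT x|lborel. \<bar>g x\<bar>)" by simp
    also have "\<dots> \<le> \<bar>r powr ?m - s powr ?m\<bar> * (D * k * ?w)"
      by (intro mult_left_mono L1) auto
    finally have "\<bar>(LINT x|lborel. max r (norm x) powr ?m * g x) - (LINT x|lborel. max s (norm x) powr ?m * g x)\<bar> / k
      \<le> D * \<bar>r powr ?m - s powr ?m\<bar> * ?w"
      using k by (simp add: divide_le_eq mult_ac)
    moreover have "radial_potential g r - radial_potential g s =
      - ((LINT x|lborel. max r (norm x) powr ?m * g x) - (LINT x|lborel. max s (norm x) powr ?m * g x)) / k"
      unfolding radial_potential_def k_def[symmetric] by (simp add: diff_divide_distrib)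
    ultimately show ?thesis using k by (simp add: abs_minus_commute)
  qed
  then show ?thesis using D by blast
qed

text \<open>The radial case of the weighted Rellich inequality, by a Schur test: Cauchy-Schwarz with the
  auxiliary weight \<open>|x|\<^bsup>a\<^esup>\<close>, then Tonelli.\<close>

lemma radial_potential_Rellich:
  assumes "real CARD('n::finite) > \<alpha>" "real CARD('n) + \<alpha> > 4" "CARD('n) \<ge> 3"
  shows "\<exists>C\<ge>0. \<forall>B. \<forall>g \<in> test_functions (B - {0::real^'n}).
    (\<integral>\<^sup>+y. ennreal (norm (y::real^'n) powr (\<alpha> - 4) * (radial_potential g (norm y))\<^sup>2) \<partial>lborel) \<le>
      ennreal (C * weighted_inner \<alpha> g g)"
proof -
  let ?n = "real CARD('n)"
  define k where "k = (?n - 2) * sphere_area TYPE(real^'n)"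
  have k: "k > 0" using assms unfolding k_def by (intro mult_pos_pos) auto
  \<comment> \<open>The four bounds on \<open>a\<close> are the convergence conditions of the two integrals of the Schur test, at \<open>0\<close> and at infinity.\<close>
  have "max 2 \<alpha> < min ?n (?n + \<alpha> - 2)" using assms by auto
  then obtain a where "max 2 \<alpha> < a" "a < min ?n (?n + \<alpha> - 2)" using dense by blast
  then have a: "2 < a" "\<alpha> < a" "a < ?n" "a < ?n + \<alpha> - 2" by auto
  obtain C1 where C1: "C1 > 0" "\<And>r. r > 0 \<Longrightarrow>
     (\<integral>\<^sup>+x. ennreal (max r (norm (x::real^'n)) powr (2 - ?n) * norm x powr (- a)) \<partial>lborel) \<le>
     ennreal (C1 * r powr (?n + (2 - ?n) + (- a)))"
    using nn_integral_max_powr[where 'a="real^'n", of "- a" "2 - ?n"] a by auto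
  obtain C2 where C2: "C2 > 0" "\<And>r. r > 0 \<Longrightarrow>
     (\<integral>\<^sup>+x. ennreal (max r (norm (x::real^'n)) powr (2 - ?n) * norm x powr (\<alpha> - 2 - a)) \<partial>lborel) \<le>
     ennreal (C2 * r powr (?n + (2 - ?n) + (\<alpha> - 2 - a)))"
    using nn_integral_max_powr[where 'a="real^'n", of "\<alpha> - 2 - a" "2 - ?n"] a by auto
  have "(\<integral>\<^sup>+y. ennreal (norm (y::real^'n) powr (\<alpha> - 4) * (radial_potential g (norm y))\<^sup>2) \<partial>lborel) \<le>
      ennreal (C1 * C2 / k\<^sup>2 * weighted_inner \<alpha> g g)"
    if g: "g \<in> test_functions (B - {0})" for B and g :: "real^'n \<Rightarrow> real"
  proof -
    have [measurable]: "g \<in> borel_measurable borel" using g by (rule test_functions_measurable)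
    have 1: "ennreal (norm y powr (\<alpha> - 4) * (radial_potential g (norm y))\<^sup>2) \<le>
      ennreal (C1 / k\<^sup>2) * (\<integral>\<^sup>+x. ennreal (norm x powr a * (g x)\<^sup>2) *
        ennreal (max (norm x) (norm y) powr (2 - ?n) * norm y powr (\<alpha> - 2 - a)) \<partial>lborel)" for y :: "real^'n"
    proof (cases "y = 0")
      case False
      then have y: "norm y > 0" by simp
      define I where "I = (LINT x|lborel. max (norm y) (norm x) powr (2 - ?n) * \<bar>g x\<bar>)"
      define W where "W = (\<integral>\<^sup>+x. ennreal (max (norm y) (norm x) powr (2 - ?n) * norm x powr a * (g x)\<^sup>2) \<partial>lborel)"
      have I0: "0 \<le> I" unfolding I_def by (intro integral_nonneg_AE) auto
      have "ennreal I = (\<integral>\<^sup>+x. ennreal (max (norm y) (norm x) powr (2 - ?n) * \<bar>g x\<bar>) \<partial>lborel)"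
        unfolding I_def
        using assms y by (intro nn_integral_eq_integral[symmetric] integrable_max_powr_mult
            integrable_abs test_functions_integrable[OF g]) auto
      also have "\<dots> = (\<integral>\<^sup>+x. ennreal (max (norm y) (norm x) powr ((2 - ?n) / 2) * norm x powr (- a / 2)) *
        ennreal (max (norm y) (norm x) powr ((2 - ?n) / 2) * (norm x powr (a / 2) * \<bar>g x\<bar>)) \<partial>lborel)"
      proof (intro nn_integral_cong)
        fix x :: "real^'n"
        have *: "norm x powr (- a / 2) * (norm x powr (a / 2) * \<bar>g x\<bar>) = \<bar>g x\<bar>"
          using test_functions_at_0[OF g] by (cases "x = 0") (auto simp: powr_minus)
        have "max (norm y) (norm x) powr (2 - ?n) =
            max (norm y) (norm x) powr ((2 - ?n) / 2) * max (norm y) (norm x) powr ((2 - ?n) / 2)"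
          by (simp add: powr_add[symmetric])
        then have "max (norm y) (norm x) powr (2 - ?n) * \<bar>g x\<bar> =
           (max (norm y) (norm x) powr ((2 - ?n) / 2) * norm x powr (- a / 2)) *
           (max (norm y) (norm x) powr ((2 - ?n) / 2) * (norm x powr (a / 2) * \<bar>g x\<bar>))"
          by (subst *[symmetric]) (simp only: mult_ac)
        then show "ennreal (max (norm y) (norm x) powr (2 - ?n) * \<bar>g x\<bar>) =
            ennreal (max (norm y) (norm x) powr ((2 - ?n) / 2) * norm x powr (- a / 2)) *
            ennreal (max (norm y) (norm x) powr ((2 - ?n) / 2) * (norm x powr (a / 2) * \<bar>g x\<bar>))"
          by (simp add: ennreal_mult[symmetric])
      qed
      finally have "(ennreal I)\<^sup>2 \<le>
        (\<integral>\<^sup>+x. (ennreal (max (norm y) (norm (x::real^'n)) powr ((2 - ?n) / 2) * norm x powr (- a / 2)))\<^sup>2 \<partial>lborel) *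
        (\<integral>\<^sup>+x. (ennreal (max (norm y) (norm (x::real^'n)) powr ((2 - ?n) / 2) * (norm x powr (a / 2) * \<bar>g x\<bar>)))\<^sup>2 \<partial>lborel)"
        by (rule power2_le_of_eq_nn_integral) measurable
      also have "(\<integral>\<^sup>+x. (ennreal (max (norm y) (norm (x::real^'n)) powr ((2 - ?n) / 2) * norm x powr (- a / 2)))\<^sup>2 \<partial>lborel) =
        (\<integral>\<^sup>+x. ennreal (max (norm y) (norm (x::real^'n)) powr (2 - ?n) * norm x powr (- a)) \<partial>lborel)"
        by (intro nn_integral_cong)
          (simp add: ennreal_power power_mult_distrib power2_powr diff_divide_distrib)
      also have "(\<integral>\<^sup>+x. (ennreal (max (norm y) (norm (x::real^'n)) powr ((2 - ?n) / 2) * (norm x powr (a / 2) * \<bar>g x\<bar>)))\<^sup>2 \<partial>lborel) = W"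
        unfolding W_def
        by (intro nn_integral_cong)
          (simp add: ennreal_power power_mult_distrib power2_powr mult.assoc diff_divide_distrib)
      also have "(\<integral>\<^sup>+x. ennreal (max (norm y) (norm (x::real^'n)) powr (2 - ?n) * norm x powr (- a)) \<partial>lborel) * W
          \<le> ennreal (C1 * norm y powr (?n + (2 - ?n) + (- a))) * W"
        by (intro mult_right_mono C1 y) auto
      finally have IW: "ennreal (I\<^sup>2) \<le> ennreal (C1 * norm y powr (2 - a)) * W"
        using I0 by (simp add: ennreal_power)
      have "\<bar>LINT x|lborel. max (norm y) (norm x) powr (2 - ?n) * g x\<bar> \<le>
        (LINT x|lborel. \<bar>max (norm y) (norm x) powr (2 - ?n) * g x\<bar>)"
        by (rule integral_abs_bound)
      also have "\<dots> = I" unfolding I_def by (simp add: abs_mult)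
      finally have "(LINT x|lborel. max (norm y) (norm x) powr (2 - ?n) * g x)\<^sup>2 \<le> I\<^sup>2"
        using I0 by (intro power2_le_iff_abs_le[THEN iffD2]) auto
      then have "(radial_potential g (norm y))\<^sup>2 \<le> I\<^sup>2 / k\<^sup>2"
        using k unfolding radial_potential_def k_def[symmetric]
        by (simp add: power_divide divide_right_mono)
      then have "ennreal (norm y powr (\<alpha> - 4) * (radial_potential g (norm y))\<^sup>2) \<le>
          ennreal (norm y powr (\<alpha> - 4) * (I\<^sup>2 / k\<^sup>2))"
        by (intro ennreal_leI mult_left_mono) auto
      also have "\<dots> = ennreal (norm y powr (\<alpha> - 4) / k\<^sup>2) * ennreal (I\<^sup>2)"
        by (simp add: ennreal_mult[symmetric])
      also have "\<dots> \<le> ennreal (norm y powr (\<alpha> - 4) / k\<^sup>2) * (ennreal (C1 * norm y powr (2 - a)) * W)"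
        by (intro mult_left_mono IW) auto
      also have "\<dots> = ennreal (C1 / k\<^sup>2 * norm y powr (\<alpha> - 2 - a)) * W"
      proof -
        have "norm y powr (\<alpha> - 4) / k\<^sup>2 * (C1 * norm y powr (2 - a)) = C1 / k\<^sup>2 * (norm y powr (\<alpha> - 4) * norm y powr (2 - a))"
          by simp
        also have "\<dots> = C1 / k\<^sup>2 * norm y powr (\<alpha> - 2 - a)"
          by (subst powr_add[symmetric]) (simp add: algebra_simps)
        finally show ?thesis
          using C1(1) by (simp only: mult.assoc[symmetric] ennreal_mult[symmetric] zero_le_divide_iff
              powr_ge_zero zero_le_power2 zero_le_mult_iff less_imp_le simp_thms)
      qed
      also have "\<dots> = ennreal (C1 / k\<^sup>2) * (ennreal (norm y powr (\<alpha> - 2 - a)) * W)"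
        using C1(1) by (subst ennreal_mult) (auto simp: mult.assoc)
      also have "ennreal (norm y powr (\<alpha> - 2 - a)) * W = (\<integral>\<^sup>+x. ennreal (norm x powr a * (g x)\<^sup>2) *
        ennreal (max (norm x) (norm y) powr (2 - ?n) * norm y powr (\<alpha> - 2 - a)) \<partial>lborel)"
        unfolding W_def
        by (subst nn_integral_cmult[symmetric]) 
          (auto intro!: nn_integral_cong simp: ennreal_mult[symmetric] max.commute mult_ac)
      finally show ?thesis .
    qed simp
    have "(\<integral>\<^sup>+y. (\<integral>\<^sup>+x. ennreal (norm x powr a * (g x)\<^sup>2) *
        ennreal (max (norm x) (norm (y::real^'n)) powr (2 - ?n) * norm y powr (\<alpha> - 2 - a)) \<partial>lborel) \<partial>lborel)
      = (\<integral>\<^sup>+x. (\<integral>\<^sup>+y. ennreal (norm x powr a * (g x)\<^sup>2) *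
        ennreal (max (norm x) (norm (y::real^'n)) powr (2 - ?n) * norm y powr (\<alpha> - 2 - a)) \<partial>lborel) \<partial>lborel)"
      by (rule lborel_pair.Fubini') measurable
    also have "\<dots> \<le> (\<integral>\<^sup>+x. ennreal C2 * ennreal (norm x powr \<alpha> * (g x)\<^sup>2) \<partial>lborel)"
    proof (intro nn_integral_mono)
      fix x :: "real^'n"
      have "(\<integral>\<^sup>+y. ennreal (norm x powr a * (g x)\<^sup>2) *
          ennreal (max (norm x) (norm (y::real^'n)) powr (2 - ?n) * norm y powr (\<alpha> - 2 - a)) \<partial>lborel) =
        ennreal (norm x powr a * (g x)\<^sup>2) * (\<integral>\<^sup>+y.
          ennreal (max (norm x) (norm (y::real^'n)) powr (2 - ?n) * norm y powr (\<alpha> - 2 - a)) \<partial>lborel)"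
        by (intro nn_integral_cmult) measurable
      also have "\<dots> \<le> ennreal C2 * ennreal (norm x powr \<alpha> * (g x)\<^sup>2)"
      proof (cases "x = 0")
        case False
        then have "ennreal (norm x powr a * (g x)\<^sup>2) * (\<integral>\<^sup>+y.
            ennreal (max (norm x) (norm (y::real^'n)) powr (2 - ?n) * norm y powr (\<alpha> - 2 - a)) \<partial>lborel) \<le>
          ennreal (norm x powr a * (g x)\<^sup>2) * ennreal (C2 * norm x powr (?n + (2 - ?n) + (\<alpha> - 2 - a)))"
          by (intro mult_left_mono C2) auto
        also have "\<dots> = ennreal C2 * ennreal (norm x powr \<alpha> * (g x)\<^sup>2)"
          using C2(1) False
          by (simp add: ennreal_mult[symmetric] powr_diff)
        finally show ?thesis .
      qed simp
      finally show "(\<integral>\<^sup>+y. ennreal (norm x powr a * (g x)\<^sup>2) *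
          ennreal (max (norm x) (norm (y::real^'n)) powr (2 - ?n) * norm y powr (\<alpha> - 2 - a)) \<partial>lborel) \<le>
          ennreal C2 * ennreal (norm x powr \<alpha> * (g x)\<^sup>2)" .
    qed
    also have "\<dots> = ennreal C2 * ennreal (weighted_inner \<alpha> g g)"
      by (subst nn_integral_cmult) (auto simp: nn_integral_weighted_inner[OF g])
    finally have 2: "(\<integral>\<^sup>+y. (\<integral>\<^sup>+x. ennreal (norm x powr a * (g x)\<^sup>2) *
        ennreal (max (norm x) (norm (y::real^'n)) powr (2 - ?n) * norm y powr (\<alpha> - 2 - a)) \<partial>lborel) \<partial>lborel) \<le>
        ennreal C2 * ennreal (weighted_inner \<alpha> g g)" .
    have "(\<integral>\<^sup>+y. ennreal (norm (y::real^'n) powr (\<alpha> - 4) * (radial_potential g (norm y))\<^sup>2) \<partial>lborel) \<le>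
      (\<integral>\<^sup>+y. ennreal (C1 / k\<^sup>2) * (\<integral>\<^sup>+x. ennreal (norm x powr a * (g x)\<^sup>2) *
        ennreal (max (norm x) (norm (y::real^'n)) powr (2 - ?n) * norm y powr (\<alpha> - 2 - a)) \<partial>lborel) \<partial>lborel)"
      by (intro nn_integral_mono 1)
    also have "\<dots> = ennreal (C1 / k\<^sup>2) * (\<integral>\<^sup>+y. (\<integral>\<^sup>+x. ennreal (norm x powr a * (g x)\<^sup>2) *
        ennreal (max (norm x) (norm (y::real^'n)) powr (2 - ?n) * norm y powr (\<alpha> - 2 - a)) \<partial>lborel) \<partial>lborel)"
      by (intro nn_integral_cmult) measurable
    also have "\<dots> \<le> ennreal (C1 / k\<^sup>2) * (ennreal C2 * ennreal (weighted_inner \<alpha> g g))"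
      by (intro mult_left_mono 2) auto
    also have "\<dots> = ennreal (C1 * C2 / k\<^sup>2 * weighted_inner \<alpha> g g)"
      using C1(1) C2(1) weighted_inner_self_nonneg[of \<alpha> g] by (simp add: ennreal_mult[symmetric])
    finally show ?thesis .
  qed
  then show ?thesis using C1(1) C2(1) by (intro exI[of _ "C1 * C2 / k\<^sup>2"]) auto
qed

lemma integrable_lborel_pair_mult:
  fixes f g :: "'a::euclidean_space \<Rightarrow> real"
  assumes f: "integrable lborel f" and g: "integrable lborel g"
  shows "integrable (lborel \<Otimes>\<^sub>M lborel) (\<lambda>(x, y). f x * g y)"
proof -
  have [measurable]: "f \<in> borel_measurable borel" "g \<in> borel_measurable borel"
    using f g by (auto dest: borel_measurable_integrable)
  show ?thesis
    by (rule lborel_pair.Fubini_integrable) (use f g in \<open>auto simp: abs_mult split_beta\<close>)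
qed

text \<open>Polar coordinates, split at \<open>t = r\<close>.  The right-hand side shows how the potential of a radial density can be
  differentiated with respect to \<open>r\<close>.\<close>

lemma integral_max_powr_radial:
  fixes h :: "real \<Rightarrow> real"
  assumes n: "DIM('a::euclidean_space) > 2" and h: "continuous_on UNIV h" "\<And>t. t \<notin> {b..c} \<Longrightarrow> h t = 0" 
    and bc: "0 < b" and r: "r > 0"
  shows "(LINT y|lborel. max r (norm (y::'a)) powr (2 - real DIM('a)) * h (norm y)) =
    sphere_area TYPE('a) * (r powr (2 - real DIM('a)) * integral {0..r} (\<lambda>t. t ^ (DIM('a) - 1) * h t)
      + (integral {0..\<bar>c\<bar>} (\<lambda>t. t * h t) - integral {0..r} (\<lambda>t. t * h t)))"
proof -
  let ?S = "sphere_area TYPE('a)" and ?m = "2 - real DIM('a)"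
  define c' where "c' = max r \<bar>c\<bar>"
  have c': "r \<le> c'" "\<bar>c\<bar> \<le> c'" "0 \<le> c'" using r by (auto simp: c'_def)
  have cont: "continuous_on S h" for S using h(1) by (rule continuous_on_subset) simp
  have hz: "h t = 0" if "t > \<bar>c\<bar>" for t
  proof (rule h(2))
    show "t \<notin> {b..c}" using that abs_ge_self[of c] by simp
  qed
  have [measurable]: "h \<in> borel_measurable borel" using h(1) by (rule borel_measurable_continuous_onI)
  let ?f = "\<lambda>t. t ^ (DIM('a) - 1) * (max r t powr ?m * h t)"
  have contf: "continuous_on S ?f" for S
    using r by (intro continuous_intros cont continuous_on_subset[OF h(1)]) auto
  have "(LINT y|lborel. max r (norm (y::'a)) powr ?m * h (norm y)) =
    (LINT t|lborel. ?S * t ^ (DIM('a) - 1) * indicator {0..} t * (max r t powr ?m * h t))"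
    by (rule integral_radial) measurable
  also have "\<dots> = (LINT t|lborel. ?S * (indicator {0..c'} t *\<^sub>R ?f t))"
    using c' by (intro Bochner_Integration.integral_cong) (auto simp: indicator_def hz)
  also have "\<dots> = ?S * (LINT t:{0..c'}|lborel. ?f t)"
    by (simp add: set_lebesgue_integral_def)
  also have "(LINT t:{0..c'}|lborel. ?f t) = integral {0..c'} ?f"
    by (intro set_borel_integral_eq_integral, unfold set_integrable_def)
      (rule borel_integrable_compact[OF compact_Icc contf])
  also have "\<dots> = integral {0..r} ?f + integral {r..c'} ?f"
    using r c' by (intro Henstock_Kurzweil_Integration.integral_combine[symmetric] integrable_continuous_interval contf) auto
  also have "integral {0..r} ?f = integral {0..r} (\<lambda>t. r powr ?m * (t ^ (DIM('a) - 1) * h t))"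
    by (intro Henstock_Kurzweil_Integration.integral_cong) (auto simp: max_def)
  also have "\<dots> = r powr ?m * integral {0..r} (\<lambda>t. t ^ (DIM('a) - 1) * h t)" by simp
  also have "integral {r..c'} ?f = integral {r..c'} (\<lambda>t. t * h t)"
  proof (intro Henstock_Kurzweil_Integration.integral_cong)
    fix t assume "t \<in> {r..c'}"
    then have t: "t > 0" "max r t = t" using r by auto
    have "t ^ (DIM('a) - 1) * t powr ?m = t powr (real (DIM('a) - 1) + ?m)"
      unfolding powr_add powr_realpow[OF t(1)] ..
    also have "real (DIM('a) - 1) + ?m = 1" using n by linarith
    also have "t powr 1 = t" using t by simp
    finally have "(t ^ (DIM('a) - 1) * t powr ?m) * h t = t * h t" by simp
    then show "?f t = t * h t" unfolding t(2) by (simp only: mult.assoc)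
  qed
  also have "\<dots> = integral {0..c'} (\<lambda>t. t * h t) - integral {0..r} (\<lambda>t. t * h t)"
  proof -
    have "(\<lambda>t. t * h t) integrable_on {0..c'}"
      by (intro integrable_continuous_interval continuous_intros cont)
    then show ?thesis
      using Henstock_Kurzweil_Integration.integral_combine[of 0 r c' "\<lambda>t. t * h t"] r c' by simp
  qed
  also have "integral {0..c'} (\<lambda>t. t * h t) = integral {0..\<bar>c\<bar>} (\<lambda>t. t * h t) + integral {\<bar>c\<bar>..c'} (\<lambda>t. t * h t)"
    using c' by (intro Henstock_Kurzweil_Integration.integral_combine[symmetric] integrable_continuous_interval continuous_intros cont) auto
  also have "integral {\<bar>c\<bar>..c'} (\<lambda>t. t * h t) = integral {\<bar>c\<bar>..c'} (\<lambda>t. 0)"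
  proof (intro Henstock_Kurzweil_Integration.integral_cong)
    fix t assume t: "t \<in> {\<bar>c\<bar>..c'}"
    show "t * h t = 0"
    proof (cases "t = \<bar>c\<bar>")
      case True
      \<comment> \<open>The end point \<open>t = |c|\<close> lies in \<open>{b..c}\<close> if \<open>c > 0\<close>; there \<open>h\<close> vanishes by continuity.\<close>
      have "(\<lambda>n. h (t + 1 / real (Suc n))) \<longlonglongrightarrow> 0"
        using True by (intro tendsto_eventually always_eventually allI hz) auto
      moreover have "(\<lambda>n. h (t + 1 / real (Suc n))) \<longlonglongrightarrow> h (t + 0)"
        using LIMSEQ_Suc[OF lim_1_over_n]
        by (intro continuous_on_tendsto_compose[OF h(1)] tendsto_add tendsto_const) auto
      ultimately have "h (t + 0) = 0" by (rule LIMSEQ_unique[symmetric])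
      then show ?thesis by simp
    qed (use t hz in auto)
  qed
  finally show ?thesis by (simp add: algebra_simps)
qed

text \<open>Newton's theorem in weak form.  The radial function \<open>\<phi>(|x|)\<close> below is the potential of \<open>h(|y|)\<close>, so its
  Laplacian is \<open>h(|x|)\<close>.  Green's identity gives \<open>\<integral> h u = \<integral> \<phi> \<Delta>u\<close>, and since the kernel is
  symmetric, Fubini's theorem moves it from \<open>h\<close> to \<open>\<Delta>u\<close>.  Testing with radial functions replaces spherical
  means and avoids the surface measure.\<close>

lemma integral_radial_potential_laplacian:
  fixes u :: "real^'n::finite \<Rightarrow> real" and h :: "real \<Rightarrow> real"
  assumes u: "u \<in> test_functions (B - {0})" and n: "CARD('n) > 2"
    and h: "continuous_on UNIV h" "\<And>t. t \<notin> {b..c} \<Longrightarrow> h t = 0" and b: "0 < b"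
  shows "(LINT x|lborel. h (norm x) * u x) =
    (LINT x|lborel. h (norm (x::real^'n)) * radial_potential (laplacian u) (norm x))"
proof -
  let ?n = "real CARD('n)" and ?S = "sphere_area TYPE(real^'n)"
  have S: "?S > 0" by simp
  have L: "laplacian u \<in> test_functions (B - {0})" using u by (rule test_functions_laplacian)
  have [measurable]: "h \<in> borel_measurable borel" "laplacian u \<in> borel_measurable borel"
    using h(1) L by (auto intro: borel_measurable_continuous_onI test_functions_measurable)
  have cont: "continuous_on S h" for S using h(1) by (rule continuous_on_subset) simp
  define I where "I = (\<lambda>r. integral {0..r} (\<lambda>t. t ^ (CARD('n) - 1) * h t))"
  define J where "J = (\<lambda>r. integral {0..\<bar>c\<bar>} (\<lambda>t. t * h t) - integral {0..r} (\<lambda>t. t * h t))"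
  define \<phi> where "\<phi> = (\<lambda>r. - (r powr (2 - ?n) * I r + J r) / (?n - 2))"
  \<comment> \<open>\<open>\<phi>' = r \<psi>\<close>, and the Laplacian of \<open>\<phi>(|x|)\<close> is \<open>r \<psi>' + N \<psi> = h\<close>.\<close>
  define \<psi> where "\<psi> = (\<lambda>r. r powr (- ?n) * I r)"
  define \<psi>' where "\<psi>' = (\<lambda>r. - ?n * r powr (- ?n - 1) * I r + h r / r)"
  have FTC: "((\<lambda>r. integral {0..r} g) has_real_derivative g r) (at r)" if "r > 0" "continuous_on UNIV g" for g :: "real \<Rightarrow> real" and r
    using integral_has_real_derivative[of 0 "r + 1" g r] that at_within_Icc_at[of 0 r "r+1"]
    by (auto intro: continuous_on_subset)
  have I: "(I has_real_derivative r ^ (CARD('n) - 1) * h r) (at r)" if "r > 0" for r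
    unfolding I_def by (rule FTC[OF that]) (intro continuous_intros cont)
  have J: "(J has_real_derivative - (r * h r)) (at r)" if "r > 0" for r
  proof -
    have "((\<lambda>r. integral {0..r} (\<lambda>t. t * h t)) has_real_derivative r * h r) (at r)"
      by (rule FTC[OF that]) (intro continuous_intros cont)
    then show ?thesis unfolding J_def by (auto intro!: derivative_eq_intros)
  qed
  have pw: "r ^ (CARD('n) - 1) = r powr (?n - 1)" if "r > 0" for r :: real
    using that n by (subst powr_realpow[symmetric]) (auto simp: of_nat_diff)
  have \<phi>: "(\<phi> has_real_derivative r * \<psi> r) (at r)" if r: "r > 0" for r
  proof -
    have "(\<phi> has_real_derivative - (((2 - ?n) * r powr (2 - ?n - 1) * I r + r ^ (CARD('n) - 1) * h r * r powr (2 - ?n)) + - (r * h r)) / (?n - 2)) (at r)"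
      unfolding \<phi>_def using r n
      by (intro DERIV_cdivide DERIV_minus DERIV_add DERIV_mult I J has_real_derivative_powr) auto
    moreover have e1: "r ^ (CARD('n) - 1) * h r * r powr (2 - ?n) = r * h r"
    proof -
      have "r powr (?n - 1) * r powr (2 - ?n) = r" using r by (simp add: powr_add[symmetric])
      then show ?thesis unfolding pw[OF r] by (metis mult.assoc mult.commute)
    qed
    moreover have e2: "r powr (2 - ?n - 1) = r * r powr (- ?n)"
      using r powr_add[of r 1 "- ?n"] by simp
    moreover have "- (((2 - ?n) * (r * r powr (- ?n)) * I r + r * h r) + - (r * h r)) / (?n - 2) = r * \<psi> r"
      using n by (simp add: \<psi>_def field_simps)
    ultimately show ?thesis by metis
  qed
  have \<psi>: "(\<psi> has_real_derivative \<psi>' r) (at r)" if r: "r > 0" for r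
  proof -
    have "(\<psi> has_real_derivative (- ?n * r powr (- ?n - 1) * I r + r ^ (CARD('n) - 1) * h r * r powr (- ?n))) (at r)"
      unfolding \<psi>_def using r by (intro DERIV_mult I has_real_derivative_powr)
    moreover have "r ^ (CARD('n) - 1) * h r * r powr (- ?n) = h r / r"
    proof -
      have "r powr (?n - 1) * r powr (- ?n) = 1 / r" using r by (simp add: powr_diff powr_minus field_simps)
      then show ?thesis unfolding pw[OF r] by (metis mult.assoc mult.commute times_divide_eq_right mult.right_neutral)
    qed
    ultimately show ?thesis by (simp add: \<psi>'_def)
  qed
  have contI: "continuous_on {0<..} I"
    using I by (auto intro!: continuous_at_imp_continuous_on DERIV_isCont)
  have \<psi>': "continuous_on {0<..} \<psi>'"
    unfolding \<psi>'_def by (intro continuous_intros contI cont) auto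
  have "h (norm x) * u x = (\<Sum>i\<in>UNIV. \<psi>' (norm x) * (x $ i / norm x) * x $ i + 1 * \<psi> (norm x)) * u x" for x
  proof (cases "x = 0")
    case True
    then show ?thesis using test_functions_at_0[OF u] by simp
  next
    case False
    then have x: "norm x > 0" by simp
    have p: "norm x powr (- ?n) = norm x * norm x powr (- ?n - 1)"
      using x powr_add[of "norm x" 1 "- ?n - 1"] by simp
    have "norm x * \<psi>' (norm x) + ?n * \<psi> (norm x) = h (norm x)"
      unfolding \<psi>'_def \<psi>_def p using x by (simp add: field_simps)
    then show ?thesis
      using sum_radial_second_derivatives[OF False, of \<psi>' \<psi>] by simp
  qed
  then have "(LINT x|lborel. h (norm x) * u x) =
      (LINT x|lborel. (\<Sum>i\<in>UNIV. \<psi>' (norm x) * (x $ i / norm x) * x $ i + 1 * \<psi> (norm x)) * u x)"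
    by (rule Bochner_Integration.integral_cong[OF refl])
  also have "\<dots> = (LINT x|lborel. \<phi> (norm x) * laplacian u x)"
    by (rule Green_identity[OF u C2_punctured_radial[OF \<phi> \<psi> \<psi>']])
  also have "\<dots> = (LINT x|lborel. (LINT y|lborel. - (h (norm (y::real^'n)) * (max (norm y) (norm x) powr (2 - ?n) * laplacian u x)) / ((?n - 2) * ?S)))"
  proof (intro Bochner_Integration.integral_cong refl)
    fix x :: "real^'n"
    show "\<phi> (norm x) * laplacian u x = (LINT y|lborel. - (h (norm (y::real^'n)) * (max (norm y) (norm x) powr (2 - ?n) * laplacian u x)) / ((?n - 2) * ?S))"
    proof (cases "x = 0")
      case True
      then show ?thesis using test_functions_at_0[OF L] by simp
    next
      case False
      have "(LINT y|lborel. - (h (norm (y::real^'n)) * (max (norm y) (norm x) powr (2 - ?n) * laplacian u x)) / ((?n - 2) * ?S)) =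
        (LINT y|lborel. - laplacian u x / ((?n - 2) * ?S) * (max (norm x) (norm (y::real^'n)) powr (2 - ?n) * h (norm y)))"
        by (intro Bochner_Integration.integral_cong refl) (simp add: max.commute mult_ac)
      also have "\<dots> = - laplacian u x / ((?n - 2) * ?S) * (?S * (norm x powr (2 - ?n) * I (norm x) + J (norm x)))"
        using integral_max_powr_radial[where 'a="real^'n", of h b c "norm x"] n h b False
        unfolding I_def J_def by simp
      also have "\<dots> = \<phi> (norm x) * laplacian u x"
      proof -
        have "- L / (m * s) * (s * z) = - z / m * L" if "s \<noteq> 0" for L m s z :: real
          using that by (cases "m = 0") (auto simp: field_simps)
        from this[OF less_imp_neq[OF S, symmetric]] show ?thesis unfolding \<phi>_def .
      qed
      finally show ?thesis by simp
    qed
  qed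
  also have "\<dots> = (LINT y|lborel. (LINT x|lborel. - (h (norm (y::real^'n)) * (max (norm y) (norm x) powr (2 - ?n) * laplacian u x)) / ((?n - 2) * ?S)))"
  proof -
    have "integrable lborel (\<lambda>y::real^'n. h (norm y))"
      using h b by (intro integrable_continuous_compact_support[of _ "cball 0 c"] continuous_on_compose2[OF h(1)] continuous_intros)
        auto
    then have "integrable (lborel \<Otimes>\<^sub>M lborel) (\<lambda>(x::real^'n, y::real^'n). laplacian u x * h (norm y))"
      by (intro integrable_lborel_pair_mult test_functions_integrable[OF L])
    then have "integrable (lborel \<Otimes>\<^sub>M lborel) (\<lambda>z. b powr (2 - ?n) / ((?n - 2) * ?S) * (case z of (x::real^'n, y::real^'n) \<Rightarrow> laplacian u x * h (norm y)))"
      by (rule integrable_mult_right)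
    then have "integrable (lborel \<Otimes>\<^sub>M lborel) (\<lambda>(x::real^'n, y::real^'n). 
      - (h (norm y) * (max (norm y) (norm x) powr (2 - ?n) * laplacian u x)) / ((?n - 2) * ?S))"
    proof (rule Bochner_Integration.integrable_bound)
      show "AE z in lborel \<Otimes>\<^sub>M lborel. norm (case z of (x::real^'n, y::real^'n) \<Rightarrow>
          - (h (norm y) * (max (norm y) (norm x) powr (2 - ?n) * laplacian u x)) / ((?n - 2) * ?S)) \<le>
        norm (b powr (2 - ?n) / ((?n - 2) * ?S) * (case z of (x::real^'n, y::real^'n) \<Rightarrow> laplacian u x * h (norm y)))"
      proof (intro AE_I2, clarify)
        fix x y :: "real^'n"
        have *: "\<bar>h (norm y)\<bar> * max (norm y) (norm x) powr (2 - ?n) \<le> \<bar>h (norm y)\<bar> * b powr (2 - ?n)"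
        proof (cases "norm y \<ge> b")
          case True
          then show ?thesis using b n by (intro mult_left_mono powr_mono2') auto
        qed (use h(2)[of "norm y"] in auto)
        have "\<bar>laplacian u x\<bar> / ((?n - 2) * ?S) * (\<bar>h (norm y)\<bar> * max (norm y) (norm x) powr (2 - ?n)) \<le>
          \<bar>laplacian u x\<bar> / ((?n - 2) * ?S) * (\<bar>h (norm y)\<bar> * b powr (2 - ?n))"
          using n S by (intro mult_left_mono *) auto
        moreover have "\<bar>?n - 2\<bar> = ?n - 2" using n by simp
        ultimately show "norm (- (h (norm y) * (max (norm y) (norm x) powr (2 - ?n) * laplacian u x)) / ((?n - 2) * ?S)) \<le>
          norm (b powr (2 - ?n) / ((?n - 2) * ?S) * (laplacian u x * h (norm y)))"
          by (simp add: abs_mult mult_ac)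
      qed
    qed measurable
    then show ?thesis by (rule lborel_pair.Fubini_integral[symmetric])
  qed
  also have "\<dots> = (LINT y|lborel. h (norm (y::real^'n)) * radial_potential (laplacian u) (norm y))"
    unfolding radial_potential_def by simp
  finally show ?thesis .
qed

section \<open>Radial profiles\<close>

lemma AE_lborel_ex:
  assumes "AE x in (lborel :: 'a::euclidean_space measure). P x"
  shows "\<exists>x. P x"
proof (rule ccontr)
  assume "\<nexists>x. P x"
  with assms have "AE x in (lborel :: 'a measure). False" by simp
  then have "emeasure lborel (UNIV :: 'a set) = 0"
    by (simp add: AE_iff_measurable[of UNIV])
  then show False by simp
qed

lemma AE_lborel_scaleR:
  fixes Z :: "'a::euclidean_space set"
  assumes "AE x in lborel. x \<notin> Z" "Z \<in> sets borel" "c \<noteq> (0::real)"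
  shows "AE x in lborel. c *\<^sub>R x \<notin> Z"
proof -
  have "AE x in density (distr lborel borel (\<lambda>x::'a. 0 + c *\<^sub>R x)) (\<lambda>_. \<bar>c\<bar>^DIM('a)). x \<notin> Z"
    unfolding lborel_affine[OF assms(3), of "0::'a", symmetric] by (rule assms(1))
  then have "AE x in distr lborel borel (\<lambda>x::'a. 0 + c *\<^sub>R x). x \<notin> Z"
    using assms(3) by (subst (asm) AE_density) auto
  then show ?thesis
    using assms(2) by (subst (asm) AE_distr_iff) auto
qed

text \<open>The function \<open>g\<close> may fail to be measurable.  By Fubini's theorem almost every ray from the origin meets the exceptional null set in
  a null set of radii; along one such ray \<open>w\<close> itself is the desired function of the radius.\<close>

lemma radial_Borel_representative:
  fixes w :: "'a::euclidean_space \<Rightarrow> real"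
  assumes [measurable]: "w \<in> borel_measurable borel"
    and rad: "AE x in lborel. x \<in> ball 0 R \<longrightarrow> w x = g (norm x)"
  shows "\<exists>g0 \<in> borel_measurable borel. AE x in lborel. x \<in> ball 0 R \<longrightarrow> w x = g0 (norm x)"
proof -
  obtain Z where Z: "{x \<in> space lborel. \<not> (x \<in> ball 0 R \<longrightarrow> w x = g (norm x))} \<subseteq> Z"
    "emeasure lborel Z = 0" "Z \<in> sets lborel"
    using AE_E[OF rad] by blast
  then have [measurable]: "Z \<in> sets borel" by simp
  have Z0: "AE x in lborel. x \<notin> Z" using Z(2,3) by (intro AE_not_in) (auto simp: null_sets_def)
  have "AE t in (lborel :: real measure). AE y in (lborel :: 'a measure). t > 0 \<longrightarrow> t *\<^sub>R y \<notin> Z"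
  proof (rule AE_I2)
    fix t :: real
    show "AE y in (lborel :: 'a measure). t > 0 \<longrightarrow> t *\<^sub>R y \<notin> Z"
      using AE_lborel_scaleR[OF Z0, of t] by (cases "t > 0") auto
  qed
  then have "AE y in (lborel :: 'a measure). AE t in (lborel :: real measure). t > 0 \<longrightarrow> t *\<^sub>R y \<notin> Z"
    by (subst lborel_pair.AE_commute[symmetric]) measurable
  then have "AE y in (lborel :: 'a measure). y \<noteq> 0 \<and> (AE t in (lborel :: real measure). t > 0 \<longrightarrow> t *\<^sub>R y \<notin> Z)"
    using AE_lborel_singleton[of "0::'a"] by eventually_elim simp
  then obtain y :: 'a where y: "y \<noteq> 0" "AE t in (lborel :: real measure). t > 0 \<longrightarrow> t *\<^sub>R y \<notin> Z"
    using AE_lborel_ex by blast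
  define e where "e = y /\<^sub>R norm y"
  have e: "norm e = 1" using y(1) by (simp add: e_def)
  have "AE s in (lborel :: real measure). 0 + (1 / norm y) * s > 0 \<longrightarrow> (0 + (1 / norm y) * s) *\<^sub>R y \<notin> Z"
    using y by (intro AE_borel_affine) auto
  then have "AE s in (lborel :: real measure). s > 0 \<longrightarrow> s *\<^sub>R e \<notin> Z"
    by eventually_elim (use y(1) in \<open>simp add: e_def divide_inverse mult.commute\<close>)
  then have ae: "AE x in (lborel :: 'a measure). norm x > 0 \<longrightarrow> norm x *\<^sub>R e \<notin> Z"
    by (rule AE_norm) measurable
  have "AE x in lborel. x \<in> ball 0 R \<longrightarrow> w x = w (norm x *\<^sub>R e)"
    using ae Z0 AE_lborel_singleton[of "0::'a"]
  proof eventually_elim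
    case (elim x)
    have *: "z \<notin> Z \<Longrightarrow> z \<in> ball 0 R \<Longrightarrow> w z = g (norm z)" for z using Z(1) by auto
    show ?case using elim *[of x] *[of "norm x *\<^sub>R e"] e by simp
  qed
  then show ?thesis by (intro bexI[of _ "\<lambda>t. w (t *\<^sub>R e)"]) measurable
qed

text \<open>Choose continuous functions that converge almost everywhere to the sign of \<open>g\<close>, truncate them to \<open>[-1, 1]\<close> and multiply
  them by a cut-off \<open>\<eta>\<close>: in the limit \<open>\<integral> \<eta> |g| = 0\<close>.\<close>

lemma radial_fundamental_lemma:
  fixes g :: "real \<Rightarrow> real"
  assumes [measurable]: "g \<in> borel_measurable borel"
    and int: "\<And>b c. 0 < b \<Longrightarrow> b < c \<Longrightarrow> c < R \<Longrightarrow>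
        integrable lborel (\<lambda>x::'a::euclidean_space. indicator {b..c} (norm x) * g (norm x))"
    and zero: "\<And>b c h. 0 < b \<Longrightarrow> b < c \<Longrightarrow> c < R \<Longrightarrow> continuous_on UNIV h \<Longrightarrow>
        (\<And>t. t \<notin> {b..c} \<Longrightarrow> h t = 0) \<Longrightarrow> (LINT x|lborel. h (norm (x::'a)) * g (norm x)) = 0"
  shows "AE x in lborel. (x::'a) \<in> ball 0 R \<longrightarrow> g (norm x) = 0"
proof -
  define \<sigma> where "\<sigma> = (\<lambda>t. sgn (g t))"
  have "\<sigma> \<in> borel_measurable borel" unfolding \<sigma>_def by measurable
  then have "\<sigma> measurable_on UNIV"
    by (intro lebesgue_measurable_imp_measurable_on) (auto simp: measurable_completion)
  then obtain Z q where Z: "negligible Z" and q: "\<And>n. continuous_on UNIV (q n)"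
    "\<And>t. t \<notin> Z \<Longrightarrow> (\<lambda>n. q n t) \<longlonglongrightarrow> \<sigma> t"
    unfolding measurable_on_def by auto
  define q' where "q' = (\<lambda>n t. max (-1) (min 1 (q n t :: real)))"
  have q'_cont: "continuous_on UNIV (q' n)" for n
    unfolding q'_def using q(1) by (intro continuous_intros)
  have [measurable]: "q' n \<in> borel_measurable borel" for n
    using q'_cont by (rule borel_measurable_continuous_onI)
  have "AE t in lebesgue. t \<notin> Z"
    using Z by (intro AE_not_in) (auto simp: negligible_iff_null_sets)
  then have "AE t in (lborel :: real measure). t \<notin> Z" by (simp add: AE_completion_iff)
  then have "AE t in (lborel :: real measure). (\<lambda>n. q' n t) \<longlonglongrightarrow> \<sigma> t"
  proof eventually_elim
    case (elim t)
    then have "(\<lambda>n. q' n t) \<longlonglongrightarrow> max (-1) (min 1 (\<sigma> t))"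
      unfolding q'_def using q(2) by (intro tendsto_intros) auto
    moreover have "max (-1) (min 1 (\<sigma> t)) = \<sigma> t" by (simp add: \<sigma>_def sgn_real_def)
    ultimately show ?case by simp
  qed
  then have q'_lim: "AE x in (lborel :: 'a measure). (\<lambda>n. q' n (norm x)) \<longlonglongrightarrow> \<sigma> (norm x)"
    unfolding \<sigma>_def by (rule AE_norm) measurable
  have ae: "AE x in (lborel :: 'a measure). b < norm x \<and> norm x < c \<longrightarrow> g (norm x) = 0"
    if bc: "0 < b" "b < c" "c < R" for b c
  proof -
    define \<eta> where "\<eta> = (\<lambda>t::real. max 0 (t - b) * max 0 (c - t))"
    have \<eta>_cont: "continuous_on UNIV \<eta>" unfolding \<eta>_def by (intro continuous_intros)
    then have [measurable]: "\<eta> \<in> borel_measurable borel" by (rule borel_measurable_continuous_onI)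
    have \<eta>: "\<eta> t \<ge> 0" "t \<notin> {b..c} \<Longrightarrow> \<eta> t = 0" "t \<in> {b<..<c} \<Longrightarrow> \<eta> t > 0" for t
      using bc by (auto simp: \<eta>_def max_def)
    have \<eta>_le: "\<eta> t \<le> (c - b)\<^sup>2 * indicator {b..c} t" for t
    proof (cases "t \<in> {b..c}")
      case True
      then have "(t - b) * (c - t) \<le> (c - b) * (c - b)" by (intro mult_mono) auto
      with True show ?thesis by (simp add: \<eta>_def power2_eq_square)
    qed (use \<eta> in auto)
    note I = int[OF bc]
    have I': "integrable lborel (\<lambda>x::'a. (c - b)\<^sup>2 * (indicator {b..c} (norm x) * \<bar>g (norm x)\<bar>))"
      using integrable_abs[OF I] by (intro integrable_mult_right) (simp add: abs_mult)
    have bound: "\<bar>q' n (norm x) * \<eta> (norm x) * g (norm x)\<bar> \<le> (c - b)\<^sup>2 * (indicator {b..c} (norm x) * \<bar>g (norm x)\<bar>)"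
      for n and x :: 'a
    proof -
      have "\<bar>q' n (norm x)\<bar> \<le> 1" by (auto simp: q'_def)
      then have "\<bar>q' n (norm x)\<bar> * \<eta> (norm x) \<le> 1 * \<eta> (norm x)" by (intro mult_right_mono \<eta>)
      also have "\<dots> \<le> (c - b)\<^sup>2 * indicator {b..c} (norm x)" using \<eta>_le by simp
      finally have "\<bar>q' n (norm x)\<bar> * \<eta> (norm x) * \<bar>g (norm x)\<bar> \<le> (c - b)\<^sup>2 * indicator {b..c} (norm x) * \<bar>g (norm x)\<bar>"
        by (rule mult_right_mono) simp
      then show ?thesis using \<eta>(1)[of "norm x"] by (simp add: abs_mult mult.assoc)
    qed
    have lim: "(\<lambda>n. LINT x|lborel. q' n (norm (x::'a)) * \<eta> (norm x) * g (norm x)) \<longlonglongrightarrow>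
      (LINT x|lborel. \<sigma> (norm (x::'a)) * \<eta> (norm x) * g (norm x))"
    proof (rule integral_dominated_convergence[OF _ _ I'])
      show "AE x in (lborel :: 'a measure). (\<lambda>n. q' n (norm x) * \<eta> (norm x) * g (norm x))
          \<longlonglongrightarrow> \<sigma> (norm x) * \<eta> (norm x) * g (norm x)"
        using q'_lim by eventually_elim (intro tendsto_intros)
    qed (use bound in \<open>auto simp: \<sigma>_def\<close>)
    have "(LINT x|lborel. q' n (norm (x::'a)) * \<eta> (norm x) * g (norm x)) = 0" for n
      by (rule zero[OF bc]) (auto intro!: continuous_on_mult q'_cont \<eta>_cont \<eta>)
    with lim have "(\<lambda>n::nat. 0) \<longlonglongrightarrow> (LINT x|lborel. \<sigma> (norm (x::'a)) * \<eta> (norm x) * g (norm x))" by simp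
    then have 0: "(LINT x|lborel. \<eta> (norm (x::'a)) * \<bar>g (norm x)\<bar>) = 0"
      unfolding \<sigma>_def by (simp add: LIMSEQ_const_iff abs_sgn mult_ac)
    have "integrable lborel (\<lambda>x::'a. \<eta> (norm x) * \<bar>g (norm x)\<bar>)"
    proof (rule Bochner_Integration.integrable_bound[OF I'])
      show "AE x in lborel. norm (\<eta> (norm (x::'a)) * \<bar>g (norm x)\<bar>) \<le>
        norm ((c - b)\<^sup>2 * (indicator {b..c} (norm x) * \<bar>g (norm x)\<bar>))"
        using \<eta>(1) mult_right_mono[OF \<eta>_le] by (auto simp: abs_mult mult.assoc[symmetric])
    qed measurable
    with 0 have "AE x in lborel. \<eta> (norm (x::'a)) * \<bar>g (norm x)\<bar> = 0"
      using \<eta>(1) by (subst (asm) integral_nonneg_eq_0_iff_AE) auto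
    then show ?thesis
    proof eventually_elim
      case (elim x)
      then show ?case using \<eta>(3)[of "norm x"] by auto
    qed
  qed
  have "AE x in (lborel :: 'a measure). \<forall>n::nat. 1 / real (Suc n) < norm x \<and> norm x < R - 1 / real (Suc n) \<longrightarrow> g (norm x) = 0"
    unfolding AE_all_countable
  proof (rule allI)
    fix n :: nat
    show "AE x in (lborel :: 'a measure). 1 / real (Suc n) < norm x \<and> norm x < R - 1 / real (Suc n) \<longrightarrow> g (norm x) = 0"
    proof (cases "1 / real (Suc n) < R - 1 / real (Suc n)")
      case True
      then show ?thesis using ae[of "1 / real (Suc n)" "R - 1 / real (Suc n)"] by simp
    next
      case False
      then show ?thesis by (intro AE_I2) auto
    qed
  qed
  then show ?thesis using AE_lborel_singleton[of "0::'a"]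
  proof eventually_elim
    case (elim x)
    show ?case
    proof
      assume "x \<in> ball 0 R"
      then have "0 < min (norm x) (R - norm x)" using elim(2) by simp
      then obtain n :: nat where "inverse (of_nat (Suc n)) < min (norm x) (R - norm x)"
        using reals_Archimedean by blast
      then show "g (norm x) = 0" using elim(1)[rule_format, of n] by (simp add: divide_inverse)
    qed
  qed
qed

lemma radial_potential_estimates:
  assumes "real CARD('n::finite) > \<alpha>" "real CARD('n) + \<alpha> > 4" "CARD('n) \<ge> 3" "R > 0"
  obtains C where "C \<ge> 0"
    "\<And>u r. u \<in> test_functions (ball 0 R - {0::real^'n}) \<Longrightarrow> r > 0 \<Longrightarrow>
      \<bar>radial_potential (laplacian u) r\<bar> \<le>
        C * r powr ((4 - (real CARD('n) + \<alpha>)) / 2) * test_norm \<alpha> (ball 0 R) u"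
    "\<And>u r s. u \<in> test_functions (ball 0 R - {0::real^'n}) \<Longrightarrow> r > 0 \<Longrightarrow> s > 0 \<Longrightarrow>
      \<bar>radial_potential (laplacian u) r - radial_potential (laplacian u) s\<bar> \<le>
        C * \<bar>r powr (2 - real CARD('n)) - s powr (2 - real CARD('n))\<bar> * test_norm \<alpha> (ball 0 R) u"
    "\<And>u. u \<in> test_functions (ball 0 R - {0::real^'n}) \<Longrightarrow>
      (\<integral>\<^sup>+y. ennreal (norm (y::real^'n) powr (\<alpha> - 4) * (radial_potential (laplacian u) (norm y))\<^sup>2) \<partial>lborel) \<le>
      ennreal (C * (test_norm \<alpha> (ball 0 R) u)\<^sup>2)"
proof -
  obtain C1 where C1: "C1 \<ge> 0" "\<And>B g r. g \<in> test_functions (B - {0::real^'n}) \<Longrightarrow> r > 0 \<Longrightarrow>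
    \<bar>radial_potential g r\<bar> \<le> C1 * r powr ((4 - (real CARD('n) + \<alpha>)) / 2) * sqrt (weighted_inner \<alpha> g g)"
    using radial_potential_bound[OF assms(1-3)] by blast
  obtain C2 where C2: "C2 \<ge> 0" "\<And>g r s. g \<in> test_functions (ball 0 R - {0::real^'n}) \<Longrightarrow> r > 0 \<Longrightarrow> s > 0 \<Longrightarrow>
    \<bar>radial_potential g r - radial_potential g s\<bar> \<le>
      C2 * \<bar>r powr (2 - real CARD('n)) - s powr (2 - real CARD('n))\<bar> * sqrt (weighted_inner \<alpha> g g)"
    using radial_potential_lipschitz[OF assms] by blast
  obtain C3 where C3: "C3 \<ge> 0" "\<And>B g. g \<in> test_functions (B - {0::real^'n}) \<Longrightarrow>
    (\<integral>\<^sup>+y. ennreal (norm (y::real^'n) powr (\<alpha> - 4) * (radial_potential g (norm y))\<^sup>2) \<partial>lborel) \<le>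
      ennreal (C3 * weighted_inner \<alpha> g g)"
    using radial_potential_Rellich[OF assms(1-3)] by blast
  show ?thesis
  proof (rule that[of "C1 + C2 + C3"])
    show "C1 + C2 + C3 \<ge> 0" using C1 C2 C3 by simp
  next
    fix u :: "real^'n \<Rightarrow> real" and r :: real
    assume u: "u \<in> test_functions (ball 0 R - {0})" and r: "r > 0"
    have "\<bar>radial_potential (laplacian u) r\<bar> \<le>
        C1 * r powr ((4 - (real CARD('n) + \<alpha>)) / 2) * test_norm \<alpha> (ball 0 R) u"
      using C1(2)[OF test_functions_laplacian[OF u] r] by (simp add: test_norm_eq[OF u])
    also have "\<dots> \<le> (C1 + C2 + C3) * r powr ((4 - (real CARD('n) + \<alpha>)) / 2) * test_norm \<alpha> (ball 0 R) u"
      using C2(1) C3(1) by (intro mult_right_mono test_norm_nonneg) auto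
    finally show "\<bar>radial_potential (laplacian u) r\<bar> \<le>
        (C1 + C2 + C3) * r powr ((4 - (real CARD('n) + \<alpha>)) / 2) * test_norm \<alpha> (ball 0 R) u" .
  next
    fix u :: "real^'n \<Rightarrow> real" and r s :: real
    assume u: "u \<in> test_functions (ball 0 R - {0})" and r: "r > 0" "s > 0"
    have "\<bar>radial_potential (laplacian u) r - radial_potential (laplacian u) s\<bar> \<le>
        C2 * \<bar>r powr (2 - real CARD('n)) - s powr (2 - real CARD('n))\<bar> * test_norm \<alpha> (ball 0 R) u"
      using C2(2)[OF test_functions_laplacian[OF u] r] by (simp add: test_norm_eq[OF u])
    also have "\<dots> \<le> (C1 + C2 + C3) * \<bar>r powr (2 - real CARD('n)) - s powr (2 - real CARD('n))\<bar> * test_norm \<alpha> (ball 0 R) u"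
      using C1(1) C3(1) by (intro mult_right_mono test_norm_nonneg) auto
    finally show "\<bar>radial_potential (laplacian u) r - radial_potential (laplacian u) s\<bar> \<le>
        (C1 + C2 + C3) * \<bar>r powr (2 - real CARD('n)) - s powr (2 - real CARD('n))\<bar> * test_norm \<alpha> (ball 0 R) u" .
  next
    fix u :: "real^'n \<Rightarrow> real"
    assume u: "u \<in> test_functions (ball 0 R - {0})"
    have "(\<integral>\<^sup>+y. ennreal (norm (y::real^'n) powr (\<alpha> - 4) * (radial_potential (laplacian u) (norm y))\<^sup>2) \<partial>lborel) \<le>
      ennreal (C3 * (test_norm \<alpha> (ball 0 R) u)\<^sup>2)"
      using C3(2)[OF test_functions_laplacian[OF u]] by (simp add: test_norm_eq[OF u] weighted_inner_self_nonneg)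
    also have "\<dots> \<le> ennreal ((C1 + C2 + C3) * (test_norm \<alpha> (ball 0 R) u)\<^sup>2)"
      using C1(1) C2(1) by (intro ennreal_leI mult_right_mono) auto
    finally show "(\<integral>\<^sup>+y. ennreal (norm (y::real^'n) powr (\<alpha> - 4) * (radial_potential (laplacian u) (norm y))\<^sup>2) \<partial>lborel) \<le>
      ennreal ((C1 + C2 + C3) * (test_norm \<alpha> (ball 0 R) u)\<^sup>2)" .
  qed
qed

lemma tendsto_integral_L1_loc:
  fixes u :: "nat \<Rightarrow> real^'n::finite \<Rightarrow> real"
  assumes K: "compact K" "K \<subseteq> \<Omega>" and L1: "L1_loc_tendsto \<Omega> u f"
    and u: "\<And>n. integrable lborel (u n)"
    and h: "h \<in> borel_measurable borel" "\<And>x. \<bar>h x\<bar> \<le> A" "\<And>x. x \<notin> K \<Longrightarrow> h x = 0"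
  shows "(\<lambda>n. LINT x|lborel. h x * u n x) \<longlonglongrightarrow> (LINT x|lebesgue. h x * f x)"
proof -
  have [measurable]: "K \<in> sets lebesgue" using K(1) by (intro sets_completionI_sets) (auto intro: borel_compact)
  have [measurable]: "h \<in> borel_measurable lebesgue" using h(1) by (simp add: measurable_completion)
  have f: "set_integrable lebesgue K f" using L1 K by (simp add: L1_loc_tendsto_def)
  have u': "integrable lebesgue (u n)" for n
    using u[of n] borel_measurable_integrable[OF u[of n]] by (simp add: integrable_completion)
  then have uK: "set_integrable lebesgue K (u n)" for n
    unfolding set_integrable_def by (intro integrable_mult_indicator) auto
  have A: "A \<ge> 0" using h(2)[of undefined] by linarith
  have int: "integrable lebesgue (\<lambda>x. h x * v x)" if "set_integrable lebesgue K v" for v :: "real^'n \<Rightarrow> real"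
  proof (rule Bochner_Integration.integrable_bound)
    show "integrable lebesgue (\<lambda>x. A * (indicator K x *\<^sub>R v x))"
      using that unfolding set_integrable_def by (rule integrable_mult_right)
    have "(\<lambda>x. h x * (indicator K x *\<^sub>R v x)) \<in> borel_measurable lebesgue"
      using that unfolding set_integrable_def by measurable
    moreover have "(\<lambda>x. h x * (indicator K x *\<^sub>R v x)) = (\<lambda>x. h x * v x)"
      using h(3) by (auto simp: indicator_def fun_eq_iff)
    ultimately show "(\<lambda>x. h x * v x) \<in> borel_measurable lebesgue" by simp
    show "AE x in lebesgue. norm (h x * v x) \<le> norm (A * (indicator K x *\<^sub>R v x))"
      using h(2,3) A by (intro AE_I2) (auto simp: indicator_def abs_mult intro!: mult_right_mono)
  qed
  have bound: "\<bar>(LINT x|lborel. h x * u n x) - (LINT x|lebesgue. h x * f x)\<bar> \<le> A * (LINT x:K|lebesgue. \<bar>u n x - f x\<bar>)" for n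
  proof -
    have "(LINT x|lborel. h x * u n x) = (LINT x|lebesgue. h x * u n x)"
      using h(1) borel_measurable_integrable[OF u[of n]]
      by (intro integral_completion[symmetric] borel_measurable_times) simp_all
    then have "(LINT x|lborel. h x * u n x) - (LINT x|lebesgue. h x * f x) = (LINT x|lebesgue. h x * u n x - h x * f x)"
      using int[OF uK] int[OF f] by simp
    then have "\<bar>(LINT x|lborel. h x * u n x) - (LINT x|lebesgue. h x * f x)\<bar> \<le> (LINT x|lebesgue. \<bar>h x * u n x - h x * f x\<bar>)"
      by (simp only: integral_abs_bound)
    also have "\<dots> \<le> (LINT x|lebesgue. A * (indicator K x *\<^sub>R \<bar>u n x - f x\<bar>))"
    proof (rule integral_mono)
      show "integrable lebesgue (\<lambda>x. \<bar>h x * u n x - h x * f x\<bar>)"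
        by (intro integrable_abs Bochner_Integration.integrable_diff int uK f)
      show "integrable lebesgue (\<lambda>x. A * (indicator K x *\<^sub>R \<bar>u n x - f x\<bar>))"
        using set_integrable_abs[OF set_integral_diff(1)[OF uK f]] unfolding set_integrable_def
        by (rule integrable_mult_right)
      show "\<bar>h x * u n x - h x * f x\<bar> \<le> A * (indicator K x *\<^sub>R \<bar>u n x - f x\<bar>)" for x
        unfolding right_diff_distrib[symmetric] abs_mult
        using h(2,3) A by (auto simp: indicator_def intro!: mult_right_mono)
    qed
    also have "\<dots> = A * (LINT x:K|lebesgue. \<bar>u n x - f x\<bar>)"
      by (simp add: set_lebesgue_integral_def)
    finally show ?thesis .
  qed
  have "(\<lambda>n. LINT x:K|lebesgue. \<bar>u n x - f x\<bar>) \<longlonglongrightarrow> 0"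
    using L1 K by (simp add: L1_loc_tendsto_def)
  then have lim: "(\<lambda>n. A * (LINT x:K|lebesgue. \<bar>u n x - f x\<bar>)) \<longlonglongrightarrow> 0"
    by (rule tendsto_mult_right_zero)
  have "(\<lambda>n. (LINT x|lborel. h x * u n x) - (LINT x|lebesgue. h x * f x)) \<longlonglongrightarrow> 0"
    by (rule Lim_null_comparison[OF _ lim], rule always_eventually, rule allI)
      (unfold real_norm_def, rule bound)
  then show ?thesis by (rule LIM_zero_cancel)
qed

lemma radial_lebesgue_representative:
  fixes f :: "real^'n::finite \<Rightarrow> real"
  assumes f: "f \<in> borel_measurable (lebesgue_on (ball 0 R))"
    and g: "AE x in lebesgue_on (ball 0 R). f x = g (norm x)"
  shows "\<exists>g0 \<in> borel_measurable borel. AE x in lebesgue. x \<in> ball 0 R \<longrightarrow> f x = g0 (norm x)"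
proof -
  have B: "ball 0 R \<inter> space lebesgue \<in> sets (lebesgue :: (real^'n) measure)"
    by (auto intro: sets_completionI_sets)
  have "(\<lambda>x. if x \<in> ball 0 R then f x else 0) \<in> borel_measurable lebesgue"
    using f by (intro borel_measurable_if_I) (auto intro: sets_completionI_sets)
  then obtain f' where f': "f' \<in> borel_measurable lborel" "AE x in lborel. (if x \<in> ball 0 R then f x else 0) = f' x"
    using completion_ex_borel_measurable_real by blast
  have f'_eq: "AE x in lebesgue. x \<in> ball 0 R \<longrightarrow> f x = f' x"
    using AE_completion[OF f'(2)] by eventually_elim auto
  moreover have "AE x in lebesgue. x \<in> ball 0 R \<longrightarrow> f x = g (norm x)"
    using g by (simp add: AE_restrict_space_iff[OF B])
  ultimately have "AE x in lebesgue. x \<in> ball 0 R \<longrightarrow> f' x = g (norm x)"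
    by eventually_elim auto
  then have "AE x in lborel. x \<in> ball 0 R \<longrightarrow> f' x = g (norm x)"
    by (simp add: AE_completion_iff)
  then obtain g0 where g0: "g0 \<in> borel_measurable borel" "AE x in lborel. x \<in> ball 0 R \<longrightarrow> f' x = g0 (norm x)"
    using radial_Borel_representative[of f' R g] f'(1) by auto
  show ?thesis
  proof (intro bexI[OF _ g0(1)])
    show "AE x in lebesgue. x \<in> ball 0 R \<longrightarrow> f x = g0 (norm x)"
      using f'_eq AE_completion[OF g0(2)] by eventually_elim auto
  qed
qed

lemma D2_norm_nonneg: "D2_approx \<alpha> B u f \<Longrightarrow> 0 \<le> D2_norm \<alpha> B f"
  by (rule LIMSEQ_le_const[OF D2_norm_limit]) (auto simp: test_norm_nonneg)

text \<open>The potentials of the Laplacians of an approximating sequence form a Cauchy sequence at every radius, by the pointwise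
  estimate; their limit \<open>F\<close> inherits all estimates, the last one by Fatou's lemma.  The test functions themselves need not be
  radial, but tested against radial functions they agree with their potentials, so \<open>f\<close> and \<open>F(|x|)\<close> have the same
  integrals against radial functions.  As both are radial, they are equal almost everywhere.\<close>

lemma D2_rad_profile:
  assumes n: "real CARD('n::finite) > \<alpha>" "real CARD('n) + \<alpha> > 4" "CARD('n) \<ge> 3" and R: "R > 0"
  obtains C where "C \<ge> 0" "\<And>f. f \<in> D2_rad \<alpha> (ball 0 R :: (real^'n) set) \<Longrightarrow>
    \<exists>F \<in> borel_measurable borel.
      (AE x in lebesgue. x \<in> ball 0 R \<longrightarrow> f x = F (norm x)) \<and>
      (\<forall>r>0. \<bar>F r\<bar> \<le> C * r powr ((4 - (real CARD('n) + \<alpha>)) / 2) * D2_norm \<alpha> (ball 0 R) f) \<and>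
      (\<forall>r>0. \<forall>s>0. \<bar>F r - F s\<bar> \<le>
         C * \<bar>r powr (2 - real CARD('n)) - s powr (2 - real CARD('n))\<bar> * D2_norm \<alpha> (ball 0 R) f) \<and>
      (\<integral>\<^sup>+y. ennreal (norm (y::real^'n) powr (\<alpha> - 4) * (F (norm y))\<^sup>2) \<partial>lborel) \<le>
        ennreal (C * (D2_norm \<alpha> (ball 0 R) f)\<^sup>2)"
proof -
  let ?B = "ball 0 R :: (real^'n) set"
  let ?p = "(4 - (real CARD('n) + \<alpha>)) / 2" and ?m = "2 - real CARD('n)"
  obtain C where C0: "C \<ge> 0"
    and C1: "\<And>u r. u \<in> test_functions (?B - {0}) \<Longrightarrow> r > 0 \<Longrightarrow>
      \<bar>radial_potential (laplacian u) r\<bar> \<le> C * r powr ?p * test_norm \<alpha> ?B u"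
    and C2: "\<And>u r s. u \<in> test_functions (?B - {0}) \<Longrightarrow> r > 0 \<Longrightarrow> s > 0 \<Longrightarrow>
      \<bar>radial_potential (laplacian u) r - radial_potential (laplacian u) s\<bar> \<le>
        C * \<bar>r powr ?m - s powr ?m\<bar> * test_norm \<alpha> ?B u"
    and C3: "\<And>u. u \<in> test_functions (?B - {0}) \<Longrightarrow>
      (\<integral>\<^sup>+y. ennreal (norm (y::real^'n) powr (\<alpha> - 4) * (radial_potential (laplacian u) (norm y))\<^sup>2) \<partial>lborel) \<le>
      ennreal (C * (test_norm \<alpha> ?B u)\<^sup>2)"
    using radial_potential_estimates[OF assms] by blast
  show ?thesis
  proof (rule that[OF C0])
    fix f assume "f \<in> D2_rad \<alpha> ?B"
    then obtain u g where u: "D2_approx \<alpha> ?B u f" and g: "AE x in lebesgue_on ?B. f x = g (norm x)"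
      by (auto simp: D2_rad_def D2_def)
    define c where "c = D2_norm \<alpha> ?B f"
    have c: "(\<lambda>n. test_norm \<alpha> ?B (u n)) \<longlonglongrightarrow> c"
      unfolding c_def using u by (rule D2_norm_limit)
    have un: "u n \<in> test_functions (?B - {0})" for n using u by (simp add: D2_approx_def)
    have L1: "L1_loc_tendsto (?B - {0}) u f" using u by (simp add: D2_approx_def)
    have [measurable]: "laplacian (u n) \<in> borel_measurable borel" for n
      by (rule test_functions_measurable[OF test_functions_laplacian[OF un]])
    define P where "P = (\<lambda>n r. if r > 0 then radial_potential (laplacian (u n)) r else 0)"
    have [measurable]: "P n \<in> borel_measurable borel" for n unfolding P_def by measurable
    have "Cauchy (\<lambda>n. P n r)" for r
    proof (cases "r > 0")
      case r: True
      have le: "\<bar>P m r - P n r\<bar> \<le> C * r powr ?p * test_norm \<alpha> ?B (\<lambda>x. u m x - u n x)" for m n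
      proof -
        have "laplacian (\<lambda>x. u m x - u n x) = (\<lambda>x. laplacian (u m) x - laplacian (u n) x)"
          using laplacian_diff[OF un un] by blast
        then show ?thesis
          using C1[OF test_functions_diff[OF un[of m] un[of n]] r] r n
            radial_potential_diff[OF test_functions_integrable[OF test_functions_laplacian[OF un[of m]]]
              test_functions_integrable[OF test_functions_laplacian[OF un[of n]]] r]
          by (simp add: P_def)
      qed
      show ?thesis
      proof (rule CauchyI)
        fix e :: real assume e: "e > 0"
        define d where "d = e / (C * r powr ?p + 1)"
        have pos: "C * r powr ?p + 1 > 0" using C0 by (intro add_nonneg_pos) auto
        then have d: "d > 0" using e by (simp add: d_def)
        then obtain n0 where n0: "\<forall>m\<ge>n0. \<forall>n\<ge>n0. test_norm \<alpha> ?B (\<lambda>x. u m x - u n x) < d"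
          using u unfolding D2_approx_def by blast
        have "norm (P m r - P n r) < e" if "m \<ge> n0" "n \<ge> n0" for m n
        proof -
          have "\<bar>P m r - P n r\<bar> \<le> C * r powr ?p * d"
            using n0 that le[of m n] C0 mult_left_mono[of "test_norm \<alpha> ?B (\<lambda>x. u m x - u n x)" d "C * r powr ?p"]
            by (meson less_imp_le mult_nonneg_nonneg order_trans powr_ge_zero)
          also have "\<dots> < (C * r powr ?p + 1) * d" using d by simp
          also have "\<dots> = e" using pos by (simp add: d_def)
          finally show ?thesis by simp
        qed
        then show "\<exists>M. \<forall>m\<ge>M. \<forall>n\<ge>M. norm (P m r - P n r) < e" by blast
      qed
    qed (simp add: P_def Cauchy_def)
    then have "\<exists>l. (\<lambda>n. P n r) \<longlonglongrightarrow> l" for r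
      using real_Cauchy_convergent convergentD by blast
    then obtain F where F: "\<And>r. (\<lambda>n. P n r) \<longlonglongrightarrow> F r" by metis
    have [measurable]: "F \<in> borel_measurable borel"
      by (rule borel_measurable_LIMSEQ_metric[of P]) (use F in auto)
    have F1: "\<bar>F r\<bar> \<le> C * r powr ?p * c" if "r > 0" for r
    proof (rule LIMSEQ_le[of "\<lambda>n. \<bar>P n r\<bar>" _ "\<lambda>n. C * r powr ?p * test_norm \<alpha> ?B (u n)"])
      show "\<exists>N. \<forall>n\<ge>N. \<bar>P n r\<bar> \<le> C * r powr ?p * test_norm \<alpha> ?B (u n)"
        using C1[OF un that] that by (simp add: P_def)
    qed (intro tendsto_intros F c)+
    have F2: "\<bar>F r - F s\<bar> \<le> C * \<bar>r powr ?m - s powr ?m\<bar> * c" if "r > 0" "s > 0" for r s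
    proof (rule LIMSEQ_le[of "\<lambda>n. \<bar>P n r - P n s\<bar>" _ "\<lambda>n. C * \<bar>r powr ?m - s powr ?m\<bar> * test_norm \<alpha> ?B (u n)"])
      show "\<exists>N. \<forall>n\<ge>N. \<bar>P n r - P n s\<bar> \<le> C * \<bar>r powr ?m - s powr ?m\<bar> * test_norm \<alpha> ?B (u n)"
        using C2[OF un that] that by (simp add: P_def)
    qed (intro tendsto_intros F c)+
    have F3: "(\<integral>\<^sup>+y. ennreal (norm (y::real^'n) powr (\<alpha> - 4) * (F (norm y))\<^sup>2) \<partial>lborel) \<le> ennreal (C * c\<^sup>2)"
    proof -
      have "(\<integral>\<^sup>+y. ennreal (norm (y::real^'n) powr (\<alpha> - 4) * (F (norm y))\<^sup>2) \<partial>lborel) =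
        (\<integral>\<^sup>+y. liminf (\<lambda>n. ennreal (norm (y::real^'n) powr (\<alpha> - 4) * (P n (norm y))\<^sup>2)) \<partial>lborel)"
        by (intro nn_integral_cong lim_imp_Liminf[symmetric] tendsto_ennrealI tendsto_intros F) auto
      also have "\<dots> \<le> liminf (\<lambda>n. \<integral>\<^sup>+y. ennreal (norm (y::real^'n) powr (\<alpha> - 4) * (P n (norm y))\<^sup>2) \<partial>lborel)"
        by (rule nn_integral_liminf) measurable
      also have "\<dots> \<le> liminf (\<lambda>n. ennreal (C * (test_norm \<alpha> ?B (u n))\<^sup>2))"
      proof (intro Liminf_mono always_eventually allI)
        fix n
        have "(\<integral>\<^sup>+y. ennreal (norm (y::real^'n) powr (\<alpha> - 4) * (P n (norm y))\<^sup>2) \<partial>lborel) \<le>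
          (\<integral>\<^sup>+y. ennreal (norm (y::real^'n) powr (\<alpha> - 4) * (radial_potential (laplacian (u n)) (norm y))\<^sup>2) \<partial>lborel)"
          by (intro nn_integral_mono ennreal_leI mult_left_mono) (auto simp: P_def)
        also note C3[OF un]
        finally show "(\<integral>\<^sup>+y. ennreal (norm (y::real^'n) powr (\<alpha> - 4) * (P n (norm y))\<^sup>2) \<partial>lborel) \<le>
          ennreal (C * (test_norm \<alpha> ?B (u n))\<^sup>2)" .
      qed
      also have "\<dots> = ennreal (C * c\<^sup>2)"
        by (intro lim_imp_Liminf tendsto_ennrealI tendsto_intros c) auto
      finally show ?thesis .
    qed
    obtain g0 where g0[measurable]: "g0 \<in> borel_measurable borel"
      and fg0: "AE x in lebesgue. x \<in> ?B \<longrightarrow> f x = g0 (norm x)"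
      using radial_lebesgue_representative[of f R g] u g by (auto simp: D2_approx_def)
    have "AE x in lborel. (x::real^'n) \<in> ?B \<longrightarrow> g0 (norm x) - F (norm x) = 0"
    proof (rule radial_fundamental_lemma[of "\<lambda>r. g0 r - F r"])
      fix b d :: real assume bd: "0 < b" "b < d" "d < R"
      define K where "K = {x::real^'n. norm x \<in> {b..d}}"
      have K: "compact K" "K \<subseteq> ?B - {0}"
      proof -
        have "K = cball 0 d - ball 0 b" by (auto simp: K_def)
        then show "compact K" by (simp add: compact_diff)
        show "K \<subseteq> ?B - {0}" using bd by (auto simp: K_def)
      qed
      have ind: "indicator {b..d} (norm x) = indicator K x" for x :: "real^'n"
        by (simp add: K_def indicator_def)
      have Kfin: "emeasure lborel K < \<infinity>" using K(1) by (intro emeasure_bounded_finite compact_imp_bounded)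
      have [measurable]: "K \<in> sets borel" using K(1) by (simp add: borel_compact)
      have intf: "integrable lebesgue (\<lambda>x. indicator K x * f x)"
        using L1 K by (simp add: L1_loc_tendsto_def set_integrable_def)
      have m_g0: "(\<lambda>x. indicator K x * g0 (norm x)) \<in> borel_measurable lebesgue"
        by (intro measurable_completion) measurable
      have eqK: "AE x in lebesgue. indicator K x * f x = indicator K x * g0 (norm x)"
        using fg0 by eventually_elim (use K(2) in \<open>auto simp: indicator_def\<close>)
      have "integrable lebesgue (\<lambda>x. indicator K x * g0 (norm x))"
        by (rule integrable_cong_AE_imp[OF intf m_g0 eqK])
      then have int_g0: "integrable lborel (\<lambda>x::real^'n. indicator K x * g0 (norm x))"
        by (subst (asm) integrable_completion) measurable
      have Fb: "\<bar>F r\<bar> \<le> C * b powr ?p * c" "\<bar>P n r\<bar> \<le> C * b powr ?p * test_norm \<alpha> ?B (u n)" if "r \<in> {b..d}" for r n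
      proof -
        have p: "r powr ?p \<le> b powr ?p" using that bd n by (intro powr_mono2') auto
        have c0: "c \<ge> 0" unfolding c_def using u by (rule D2_norm_nonneg)
        have "\<bar>F r\<bar> \<le> C * r powr ?p * c" using F1 that bd by auto
        also have "\<dots> \<le> C * b powr ?p * c" using p C0 c0 by (intro mult_right_mono mult_left_mono)
        finally show "\<bar>F r\<bar> \<le> C * b powr ?p * c" .
        have "\<bar>P n r\<bar> \<le> C * r powr ?p * test_norm \<alpha> ?B (u n)" using C1[OF un] that bd by (auto simp: P_def)
        also have "\<dots> \<le> C * b powr ?p * test_norm \<alpha> ?B (u n)"
          using p C0 by (intro mult_right_mono mult_left_mono test_norm_nonneg)
        finally show "\<bar>P n r\<bar> \<le> C * b powr ?p * test_norm \<alpha> ?B (u n)" .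
      qed
      have int_F: "integrable lborel (\<lambda>x::real^'n. indicator K x * F (norm x))"
      proof (rule Bochner_Integration.integrable_bound[where f="\<lambda>x. C * b powr ?p * c * indicator K x"])
        show "integrable lborel (\<lambda>x. C * b powr ?p * c * indicator K x)"
          using Kfin by (intro integrable_mult_right integrable_real_indicator) auto
        show "AE x in lborel. norm (indicator K (x::real^'n) * F (norm x)) \<le> norm (C * b powr ?p * c * indicator K x)"
          using Fb(1) by (intro AE_I2) (auto simp: indicator_def K_def intro: order_trans[OF _ abs_ge_self])
      qed measurable
      show "integrable lborel (\<lambda>x::real^'n. indicator {b..d} (norm x) * (g0 (norm x) - F (norm x)))"
        unfolding ind using Bochner_Integration.integrable_diff[OF int_g0 int_F] by (simp add: right_diff_distrib)
      fix h :: "real \<Rightarrow> real" assume h: "continuous_on UNIV h" "\<And>t. t \<notin> {b..d} \<Longrightarrow> h t = 0"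
      have hm[measurable]: "h \<in> borel_measurable borel" using h(1) by (rule borel_measurable_continuous_onI)
      have "bounded (h ` {b..d})"
        by (intro compact_imp_bounded compact_continuous_image) (auto intro: continuous_on_subset[OF h(1)])
      then obtain A where "A > 0" "\<And>t. t \<in> {b..d} \<Longrightarrow> \<bar>h t\<bar> \<le> A" unfolding bounded_pos by auto
      then have A: "A > 0" "\<bar>h t\<bar> \<le> A" for t using h(2)[of t] by (cases "t \<in> {b..d}"; simp)+
      have hK: "h (norm x) = 0" if "x \<notin> K" for x :: "real^'n" using that h(2) by (simp add: K_def)
      have int_h: "integrable lborel (\<lambda>x::real^'n. h (norm x) * G x)"
        if "integrable lborel (\<lambda>x. indicator K x * G x)" "G \<in> borel_measurable borel" for G
      proof (rule Bochner_Integration.integrable_bound[OF integrable_mult_right[OF that(1), of A]])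
        show "AE x in lborel. norm (h (norm x) * G x) \<le> norm (A * (indicator K x * G x))"
          using A hK by (intro AE_I2) (auto simp: indicator_def abs_mult intro!: mult_right_mono)
        show "(\<lambda>x. h (norm x) * G x) \<in> borel_measurable lborel" using that(2) by measurable
      qed
      have "(\<lambda>n. LINT x|lborel. h (norm x) * u n x) \<longlonglongrightarrow> (LINT x|lebesgue. h (norm x) * f x)"
        by (rule tendsto_integral_L1_loc[OF K L1 test_functions_integrable[OF un] _ A(2) hK]) measurable
      also have "(LINT x|lebesgue. h (norm x) * f x) = (LINT x|lebesgue. h (norm (x::real^'n)) * g0 (norm x))"
      proof -
        have ae: "AE x in lebesgue. h (norm x) * f x = h (norm x) * g0 (norm x)"
          using fg0
        proof eventually_elim
          case (elim x)
          then show ?case using K(2) hK[of x] by (cases "x \<in> K") auto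
        qed
        have m: "(\<lambda>x::real^'n. h (norm x) * g0 (norm x)) \<in> borel_measurable lebesgue"
          by (intro measurable_completion) measurable
        have "(\<lambda>x::real^'n. h (norm x) * f x) \<in> borel_measurable lebesgue"
          by (rule borel_measurable_AE[OF m], use ae in eventually_elim) (rule sym)
        then show ?thesis using m ae by (rule integral_cong_AE)
      qed
      also have "\<dots> = (LINT x|lborel. h (norm (x::real^'n)) * g0 (norm x))"
        by (intro integral_completion) measurable
      finally have lim1: "(\<lambda>n. LINT x|lborel. h (norm x) * u n x) \<longlonglongrightarrow> (LINT x|lborel. h (norm (x::real^'n)) * g0 (norm x))" .
      have "(LINT x|lborel. h (norm x) * u n x) = (LINT x|lborel. h (norm (x::real^'n)) * P n (norm x))" for n
      proof -
        have "(LINT x|lborel. h (norm x) * u n x) = (LINT x|lborel. h (norm (x::real^'n)) * radial_potential (laplacian (u n)) (norm x))"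
          using n by (intro integral_radial_potential_laplacian[OF un _ h bd(1)]) auto
        also have "\<dots> = (LINT x|lborel. h (norm (x::real^'n)) * P n (norm x))"
          using h(2)[of 0] bd by (intro Bochner_Integration.integral_cong refl) (auto simp: P_def)
        finally show ?thesis .
      qed
      moreover have "(\<lambda>n. LINT x|lborel. h (norm (x::real^'n)) * P n (norm x)) \<longlonglongrightarrow> (LINT x|lborel. h (norm (x::real^'n)) * F (norm x))"
      proof -
        obtain M where M: "\<And>n. \<bar>test_norm \<alpha> ?B (u n)\<bar> \<le> M"
          using convergent_imp_Bseq[OF convergentI[OF c]] unfolding Bseq_def by auto
        show ?thesis
        proof (rule integral_dominated_convergence[where w="\<lambda>x::real^'n. A * (C * b powr ?p * M) * indicator K x"])
          show "integrable lborel (\<lambda>x. A * (C * b powr ?p * M) * indicator K x)"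
            using Kfin by (intro integrable_mult_right integrable_real_indicator) auto
          show "AE x in lborel. (\<lambda>n. h (norm (x::real^'n)) * P n (norm x)) \<longlonglongrightarrow> h (norm x) * F (norm x)"
            by (intro AE_I2 tendsto_intros F)
          show "AE x in lborel. norm (h (norm (x::real^'n)) * P n (norm x)) \<le> A * (C * b powr ?p * M) * indicator K x" for n
          proof (rule AE_I2)
            fix x :: "real^'n"
            show "norm (h (norm x) * P n (norm x)) \<le> A * (C * b powr ?p * M) * indicator K x"
            proof (cases "x \<in> K")
              case True
              then have "\<bar>P n (norm x)\<bar> \<le> C * b powr ?p * test_norm \<alpha> ?B (u n)"
                by (intro Fb) (simp add: K_def)
              also have "\<dots> \<le> C * b powr ?p * M"
                using M[of n] C0 by (intro mult_left_mono) auto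
              finally have "\<bar>h (norm x)\<bar> * \<bar>P n (norm x)\<bar> \<le> A * (C * b powr ?p * M)"
                using A by (intro mult_mono) auto
              with True show ?thesis by (simp add: abs_mult)
            qed (simp add: hK)
          qed
        qed measurable
      qed
      ultimately have "(LINT x|lborel. h (norm (x::real^'n)) * g0 (norm x)) = (LINT x|lborel. h (norm (x::real^'n)) * F (norm x))"
        using lim1 LIMSEQ_unique by simp
      then show "(LINT x|lborel. h (norm (x::real^'n)) * (g0 (norm x) - F (norm x))) = 0"
        using int_h[OF int_g0] int_h[OF int_F] by (simp add: right_diff_distrib)
    qed measurable
    then have "AE x in lebesgue. (x::real^'n) \<in> ?B \<longrightarrow> g0 (norm x) - F (norm x) = 0"
      by (rule AE_completion)
    with fg0 have "AE x in lebesgue. x \<in> ?B \<longrightarrow> f x = F (norm x)"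
      by eventually_elim auto
    then show "\<exists>F \<in> borel_measurable borel.
      (AE x in lebesgue. x \<in> ?B \<longrightarrow> f x = F (norm x)) \<and>
      (\<forall>r>0. \<bar>F r\<bar> \<le> C * r powr ?p * D2_norm \<alpha> ?B f) \<and>
      (\<forall>r>0. \<forall>s>0. \<bar>F r - F s\<bar> \<le> C * \<bar>r powr ?m - s powr ?m\<bar> * D2_norm \<alpha> ?B f) \<and>
      (\<integral>\<^sup>+y. ennreal (norm (y::real^'n) powr (\<alpha> - 4) * (F (norm y))\<^sup>2) \<partial>lborel) \<le>
        ennreal (C * (D2_norm \<alpha> ?B f)\<^sup>2)"
      using F1 F2 F3 unfolding c_def by (intro bexI[of _ F]) auto
  qed
qed

section \<open>The embeddings\<close>

text \<open>Passes from the completed measure on the ball to Borel functions of the norm, where all estimates are made.\<close>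

lemma Lq_weighted_radial:
  fixes f :: "real^'n::finite \<Rightarrow> real"
  assumes f: "f \<in> borel_measurable (lebesgue_on (ball 0 R))"
    and F[measurable]: "F \<in> borel_measurable borel"
    and fF: "AE x in lebesgue. x \<in> ball 0 R \<longrightarrow> f x = F (norm x)"
    and q: "q \<ge> 1" and A: "A \<ge> 0"
    and nn: "(\<integral>\<^sup>+x. ennreal (indicator (ball 0 R) (x::real^'n) * (norm x powr l * \<bar>F (norm x)\<bar> powr q)) \<partial>lborel) \<le> ennreal A"
  shows "f \<in> Lq_weighted q l (ball 0 R)"
    and "Lq_weighted_norm q l (ball 0 R) f \<le> A powr (1 / q)"
    and "Lq_weighted_norm q l (ball 0 R) f =
      (LINT x|lborel. indicator (ball 0 R) (x::real^'n) * (norm x powr l * \<bar>F (norm x)\<bar> powr q)) powr (1 / q)"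
proof -
  let ?B = "ball 0 R :: (real^'n) set"
  let ?f = "\<lambda>x. norm x powr l * \<bar>f x\<bar> powr q"
  let ?G = "\<lambda>x::real^'n. indicator ?B x * (norm x powr l * \<bar>F (norm x)\<bar> powr q)"
  have [measurable]: "(ball 0 R :: (real^'n) set) \<in> sets borel" by simp
  have B: "?B \<in> sets lebesgue" by (auto intro: sets_completionI_sets)
  have B': "?B \<inter> space lebesgue \<in> sets lebesgue" using B by simp
  have mG: "?G \<in> borel_measurable borel" by measurable
  have intG: "integrable lborel ?G"
    using mG nn by (intro integrableI_bounded) (auto simp: abs_mult top_unique less_top[symmetric])
  have intG': "integrable lebesgue ?G" using intG mG by (simp add: integrable_completion)
  have ae: "AE x in lebesgue. ?G x = indicator ?B x *\<^sub>R ?f x"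
    using fF by eventually_elim (auto simp: indicator_def)
  have int: "integrable lebesgue (\<lambda>x. indicator ?B x *\<^sub>R ?f x)"
    using intG' borel_measurable_AE[OF borel_measurable_integrable[OF intG'] ae] ae
    by (rule integrable_cong_AE_imp)
  have "(LINT x|lebesgue_on ?B. ?f x) = (LINT x|lebesgue. indicator ?B x *\<^sub>R ?f x)"
    by (rule integral_restrict_space[OF B'])
  also have "\<dots> = (LINT x|lebesgue. ?G x)"
    using ae int intG' by (intro integral_cong_AE) (auto elim: eventually_mono)
  also have "\<dots> = (LINT x|lborel. ?G x)" using mG by (intro integral_completion) simp
  finally have eq: "(LINT x|lebesgue_on ?B. ?f x) = (LINT x|lborel. ?G x)" .
  then show norm_eq: "Lq_weighted_norm q l ?B f = (LINT x|lborel. ?G x) powr (1 / q)"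
    by (simp add: Lq_weighted_norm_def)
  have "ennreal (LINT x|lborel. ?G x) \<le> ennreal A"
    using nn_integral_eq_integral[OF intG] nn by simp
  then have "(LINT x|lborel. ?G x) \<le> A" using A by simp
  then show "Lq_weighted_norm q l ?B f \<le> A powr (1 / q)"
    unfolding norm_eq using q by (intro powr_mono2 integral_nonneg_AE) auto
  have "(norm x powr (l / q) * \<bar>f x\<bar>) powr q = ?f x" for x
    using q by (simp add: powr_mult powr_powr)
  then show "f \<in> Lq_weighted q l ?B"
    using f int by (simp add: Lq_weighted_def integrable_restrict_space[OF B'])
qed

text \<open>On the ball \<open>max R |x| = R\<close>, so any exponent \<open>m\<close> that ensures convergence at infinity will do.\<close>

lemma nn_integral_ball_powr:
  assumes s: "s > - real CARD('n::finite)" and R: "R > 0"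
  obtains A where "A \<ge> 0"
    "(\<integral>\<^sup>+x. ennreal (indicator (ball 0 R) (x::real^'n) * norm x powr s) \<partial>lborel) \<le> ennreal A"
proof -
  define m where "m = - s - real CARD('n) - 1"
  obtain C where C: "C > 0" "\<And>r. r > 0 \<Longrightarrow>
      (\<integral>\<^sup>+x. ennreal (max r (norm (x::real^'n)) powr m * norm x powr s) \<partial>lborel) \<le>
        ennreal (C * r powr (real CARD('n) + m + s))"
    using nn_integral_max_powr[where 'a="real^'n", of s m] s by (auto simp: m_def)
  have "(\<integral>\<^sup>+x. ennreal (indicator (ball 0 R) (x::real^'n) * norm x powr s) \<partial>lborel) \<le>
    (\<integral>\<^sup>+x. ennreal (R powr (- m)) * ennreal (max R (norm (x::real^'n)) powr m * norm x powr s) \<partial>lborel)"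
  proof (rule nn_integral_mono)
    fix x :: "real^'n"
    have "R powr (- m) * R powr m = 1" using R by (simp add: powr_add[symmetric])
    then show "ennreal (indicator (ball 0 R) x * norm x powr s) \<le>
        ennreal (R powr (- m)) * ennreal (max R (norm x) powr m * norm x powr s)"
      by (auto simp: indicator_def max_def ennreal_mult[symmetric] mult.assoc[symmetric])
  qed
  also have "\<dots> = ennreal (R powr (- m)) * (\<integral>\<^sup>+x. ennreal (max R (norm (x::real^'n)) powr m * norm x powr s) \<partial>lborel)"
    by (intro nn_integral_cmult) measurable
  also have "\<dots> \<le> ennreal (R powr (- m)) * ennreal (C * R powr (real CARD('n) + m + s))"
    by (intro mult_left_mono C R) auto
  also have "\<dots> = ennreal (R powr (- m) * (C * R powr (real CARD('n) + m + s)))"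
    using C(1) by (simp add: ennreal_mult[symmetric])
  finally show ?thesis using C(1) by (intro that[of "R powr (- m) * (C * R powr (real CARD('n) + m + s))"]) auto
qed

text \<open>The assumption on the exponents makes \<open>|x|\<^bsup>l\<^esup> |F|\<^bsup>q\<^esup>\<close> integrable near the origin, by the pointwise bound alone.\<close>

lemma nn_integral_profile_subcritical:
  assumes s: "l + p * q > - real CARD('n::finite)" and R: "R > 0" and q: "q \<ge> 1" and C: "C \<ge> 0"
  obtains D where "D \<ge> 0" "\<And>F c. c \<ge> 0 \<Longrightarrow> (\<forall>r>0. \<bar>F r\<bar> \<le> C * r powr p * c) \<Longrightarrow>
    (\<integral>\<^sup>+x. ennreal (indicator (ball 0 R) (x::real^'n) * (norm x powr l * \<bar>F (norm x)\<bar> powr q)) \<partial>lborel) \<le>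
      ennreal (D * c powr q)"
proof -
  have [measurable]: "(ball 0 R :: (real^'n) set) \<in> sets borel" by simp
  obtain A where A: "A \<ge> 0"
    "(\<integral>\<^sup>+x. ennreal (indicator (ball 0 R) (x::real^'n) * norm x powr (l + p * q)) \<partial>lborel) \<le> ennreal A"
    using nn_integral_ball_powr[OF s R] by blast
  have "(\<integral>\<^sup>+x. ennreal (indicator (ball 0 R) (x::real^'n) * (norm x powr l * \<bar>F (norm x)\<bar> powr q)) \<partial>lborel) \<le>
      ennreal (C powr q * A * c powr q)" if c: "c \<ge> 0" and F: "\<forall>r>0. \<bar>F r\<bar> \<le> C * r powr p * c" for F c
  proof -
    have "(\<integral>\<^sup>+x. ennreal (indicator (ball 0 R) (x::real^'n) * (norm x powr l * \<bar>F (norm x)\<bar> powr q)) \<partial>lborel) \<le>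
      (\<integral>\<^sup>+x. ennreal (C powr q * c powr q) * ennreal (indicator (ball 0 R) (x::real^'n) * norm x powr (l + p * q)) \<partial>lborel)"
    proof (rule nn_integral_mono)
      fix x :: "real^'n"
      show "ennreal (indicator (ball 0 R) x * (norm x powr l * \<bar>F (norm x)\<bar> powr q)) \<le>
        ennreal (C powr q * c powr q) * ennreal (indicator (ball 0 R) x * norm x powr (l + p * q))"
      proof (cases "x = 0")
        case False
        then have "\<bar>F (norm x)\<bar> powr q \<le> (C * norm x powr p * c) powr q"
          using F q by (intro powr_mono2) auto
        also have "\<dots> = C powr q * c powr q * norm x powr (p * q)"
          using C c by (simp add: powr_mult powr_powr)
        finally have "norm x powr l * \<bar>F (norm x)\<bar> powr q \<le> norm x powr l * (C powr q * c powr q * norm x powr (p * q))"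
          by (intro mult_left_mono) auto
        also have "\<dots> = C powr q * c powr q * norm x powr (l + p * q)"
          by (simp add: powr_add)
        finally have "indicator (ball 0 R) x * (norm x powr l * \<bar>F (norm x)\<bar> powr q) \<le>
            (C powr q * c powr q) * (indicator (ball 0 R) x * norm x powr (l + p * q))"
          by (simp add: indicator_def)
        then show ?thesis by (subst ennreal_mult[symmetric]) (auto intro: ennreal_leI)
      qed simp
    qed
    also have "\<dots> = ennreal (C powr q * c powr q) *
        (\<integral>\<^sup>+x. ennreal (indicator (ball 0 R) (x::real^'n) * norm x powr (l + p * q)) \<partial>lborel)"
      by (intro nn_integral_cmult) measurable
    also have "\<dots> \<le> ennreal (C powr q * c powr q) * ennreal A"
      by (intro mult_left_mono A) auto
    also have "\<dots> = ennreal (C powr q * A * c powr q)"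
      using A(1) by (subst ennreal_mult[symmetric]) (auto simp: mult_ac)
    finally show ?thesis .
  qed
  then show ?thesis using A(1) by (intro that[of "C powr q * A"]) auto
qed

text \<open>At the critical exponent the integral of the pointwise bound diverges logarithmically.  The bound is used for the factor \<open>|F|\<^bsup>q-2\<^esup>\<close> only,
  and the remaining weighted integral of \<open>F\<^sup>2\<close> is the one in the Rellich inequality.\<close>

lemma nn_integral_profile_critical:
  fixes F :: "real \<Rightarrow> real"
  assumes e: "l + p * (q - 2) = \<beta>" and q: "q \<ge> 2" and C: "C \<ge> 0" and c: "c \<ge> 0"
    and F: "\<forall>r>0. \<bar>F r\<bar> \<le> C * r powr p * c" and Fm[measurable]: "F \<in> borel_measurable borel"
    and H: "(\<integral>\<^sup>+x. ennreal (norm (x::real^'n::finite) powr \<beta> * (F (norm x))\<^sup>2) \<partial>lborel) \<le> ennreal (C * c\<^sup>2)"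
  shows "(\<integral>\<^sup>+x. ennreal (indicator (ball 0 R) (x::real^'n) * (norm x powr l * \<bar>F (norm x)\<bar> powr q)) \<partial>lborel) \<le>
      ennreal (C powr (q - 2) * C * c powr q)"
proof -
  have "(\<integral>\<^sup>+x. ennreal (indicator (ball 0 R) (x::real^'n) * (norm x powr l * \<bar>F (norm x)\<bar> powr q)) \<partial>lborel) \<le>
    (\<integral>\<^sup>+x. ennreal (C powr (q - 2) * c powr (q - 2)) * ennreal (norm (x::real^'n) powr \<beta> * (F (norm x))\<^sup>2) \<partial>lborel)"
  proof (rule nn_integral_mono)
    fix x :: "real^'n"
    show "ennreal (indicator (ball 0 R) x * (norm x powr l * \<bar>F (norm x)\<bar> powr q)) \<le>
      ennreal (C powr (q - 2) * c powr (q - 2)) * ennreal (norm x powr \<beta> * (F (norm x))\<^sup>2)"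
    proof (cases "x = 0 \<or> F (norm x) = 0")
      case False
      then have x: "norm x > 0" "\<bar>F (norm x)\<bar> > 0" by auto
      have "\<bar>F (norm x)\<bar> powr q = \<bar>F (norm x)\<bar> powr (q - 2) * \<bar>F (norm x)\<bar> powr 2"
        unfolding powr_add[symmetric] by simp
      also have "\<bar>F (norm x)\<bar> powr 2 = (F (norm x))\<^sup>2"
        using x(2) by (simp add: powr_numeral)
      also have "\<bar>F (norm x)\<bar> powr (q - 2) \<le> (C * norm x powr p * c) powr (q - 2)"
        using F q x by (intro powr_mono2) auto
      also have "(C * norm x powr p * c) powr (q - 2) = C powr (q - 2) * c powr (q - 2) * norm x powr (p * (q - 2))"
        using C c by (simp add: powr_mult powr_powr)
      finally have "\<bar>F (norm x)\<bar> powr q \<le> C powr (q - 2) * c powr (q - 2) * norm x powr (p * (q - 2)) * (F (norm x))\<^sup>2"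
        by (simp add: mult_right_mono)
      then have "norm x powr l * \<bar>F (norm x)\<bar> powr q \<le>
          norm x powr l * (C powr (q - 2) * c powr (q - 2) * norm x powr (p * (q - 2)) * (F (norm x))\<^sup>2)"
        by (intro mult_left_mono) auto
      also have "\<dots> = C powr (q - 2) * c powr (q - 2) * (norm x powr \<beta> * (F (norm x))\<^sup>2)"
        unfolding e[symmetric] by (simp add: powr_add)
      finally have "indicator (ball 0 R) x * (norm x powr l * \<bar>F (norm x)\<bar> powr q) \<le>
          C powr (q - 2) * c powr (q - 2) * (norm x powr \<beta> * (F (norm x))\<^sup>2)"
        by (auto simp: indicator_def)
      then show ?thesis by (subst ennreal_mult[symmetric]) (auto intro: ennreal_leI)
    qed auto
  qed
  also have "\<dots> = ennreal (C powr (q - 2) * c powr (q - 2)) *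
      (\<integral>\<^sup>+x. ennreal (norm (x::real^'n) powr \<beta> * (F (norm x))\<^sup>2) \<partial>lborel)"
    by (intro nn_integral_cmult) measurable
  also have "\<dots> \<le> ennreal (C powr (q - 2) * c powr (q - 2)) * ennreal (C * c\<^sup>2)"
    by (intro mult_left_mono H) auto
  also have "\<dots> = ennreal (C powr (q - 2) * C * c powr q)"
  proof (cases "c = 0")
    case False
    then have "c powr (q - 2) * c\<^sup>2 = c powr q"
      using c powr_add[of c "q - 2" 2] by (simp add: powr_numeral)
    then have "C powr (q - 2) * c powr (q - 2) * (C * c\<^sup>2) = C powr (q - 2) * C * c powr q"
      by (metis mult.assoc mult.left_commute)
    then show ?thesis using C by (subst ennreal_mult[symmetric]) auto
  qed simp
  finally show ?thesis .
qed

text \<open>A diagonal subsequence converges at all rational radii, and equicontinuity extends this to all radii.  The values are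
  rescaled by \<open>r\<^bsup>-p\<^esup>\<close> to make them uniformly bounded.\<close>

lemma Lipschitz_powr_convergent_subsequence:
  fixes F :: "nat \<Rightarrow> real \<Rightarrow> real"
  assumes F1: "\<And>n r. r > 0 \<Longrightarrow> \<bar>F n r\<bar> \<le> K * r powr p"
    and F2: "\<And>n r s. r > 0 \<Longrightarrow> s > 0 \<Longrightarrow> \<bar>F n r - F n s\<bar> \<le> K * \<bar>r powr m - s powr m\<bar>"
  obtains k G where "strict_mono (k :: nat \<Rightarrow> nat)" "\<And>r. r > 0 \<Longrightarrow> (\<lambda>n. F (k n) r) \<longlonglongrightarrow> G r"
proof -
  define S where "S = {r \<in> \<rat>. (r::real) > 0}"
  have "countable S" unfolding S_def by (rule countable_subset[OF _ countable_rat]) auto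
  moreover have "norm (F n r * r powr (- p)) \<le> K" if "r \<in> S" for n r
  proof -
    have r: "r > 0" using that by (simp add: S_def)
    have "\<bar>F n r\<bar> * r powr (- p) \<le> K * r powr p * r powr (- p)"
      using F1[OF r] by (intro mult_right_mono) auto
    also have "\<dots> = K" using r by (simp add: mult.assoc powr_add[symmetric])
    finally show ?thesis by (simp add: abs_mult)
  qed
  ultimately obtain k where k: "strict_mono (k :: nat \<Rightarrow> nat)"
    "\<And>r. r \<in> S \<Longrightarrow> \<exists>l. (\<lambda>n. F (k n) r * r powr (- p)) \<longlonglongrightarrow> l"
    using function_convergent_subsequence[of S "\<lambda>n r. F n r * r powr (- p)" K] by blast
  have convS: "Cauchy (\<lambda>n. F (k n) r)" if r: "r \<in> S" for r
  proof -
    obtain l where "(\<lambda>n. F (k n) r * r powr (- p)) \<longlonglongrightarrow> l" using k(2)[OF r] by blast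
    then have "(\<lambda>n. F (k n) r * r powr (- p) * r powr p) \<longlonglongrightarrow> l * r powr p"
      by (intro tendsto_intros)
    moreover have "F (k n) r * r powr (- p) * r powr p = F (k n) r" for n
      using r by (simp add: S_def mult.assoc powr_add[symmetric])
    ultimately show ?thesis using LIMSEQ_imp_Cauchy by simp
  qed
  have K: "K \<ge> 0" using F1[of 1 0] by simp
  have "Cauchy (\<lambda>n. F (k n) r)" if r: "r > 0" for r
  proof (rule CauchyI)
    fix e :: real assume e: "e > 0"
    define d where "d = e / (3 * (K + 1))"
    have d: "d > 0" using e K by (simp add: d_def)
    have "isCont (\<lambda>s. s powr m) r" using r by (intro continuous_intros) auto
    then obtain \<delta> where \<delta>: "\<delta> > 0" "\<And>s. \<bar>s - r\<bar> < \<delta> \<Longrightarrow> \<bar>s powr m - r powr m\<bar> < d"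
      using d unfolding continuous_at_eps_delta dist_real_def by metis
    obtain s where s: "s \<in> \<rat>" "r < s" "s < r + \<delta>"
      using Rats_dense_in_real[of r "r + \<delta>"] \<delta>(1) by auto
    then have sS: "s \<in> S" "s > 0" using r by (auto simp: S_def)
    have "K * \<bar>r powr m - s powr m\<bar> \<le> (K + 1) * \<bar>r powr m - s powr m\<bar>"
      by (intro mult_right_mono) auto
    also have "\<dots> < (K + 1) * d"
      using \<delta>(2)[of s] s K by (intro mult_strict_left_mono) (auto simp: abs_minus_commute)
    also have "\<dots> = e / 3" using K by (simp add: d_def field_simps)
    finally have close: "\<bar>F n r - F n s\<bar> < e / 3" for n
      using F2[OF r sS(2), of n] by linarith
    obtain n0 where n0: "\<forall>i\<ge>n0. \<forall>j\<ge>n0. norm (F (k i) s - F (k j) s) < e / 3"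
      using CauchyD[OF convS[OF sS(1)], of "e / 3"] e by auto
    have "norm (F (k i) r - F (k j) r) < e" if "i \<ge> n0" "j \<ge> n0" for i j
    proof -
      have "\<bar>F (k i) s - F (k j) s\<bar> < e / 3" using n0 that by simp
      with close[of "k i"] close[of "k j"] show ?thesis unfolding real_norm_def by linarith
    qed
    then show "\<exists>M. \<forall>i\<ge>M. \<forall>j\<ge>M. norm (F (k i) r - F (k j) r) < e" by blast
  qed
  then have "\<exists>l. (\<lambda>n. F (k n) r) \<longlonglongrightarrow> l" if "r > 0" for r
    using that real_Cauchy_convergent convergentD by blast
  then show ?thesis using that[OF k(1)] by metis
qed

theorem proposition1p7:
  fixes B :: "(real^'n::finite) set"
    and N :: nat
    and \<alpha> l N' \<tau> p\<^sub>s R :: real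
  assumes "N = CARD('n)" and "N \<ge> 5"
    and "N' = real N + \<alpha>" and "\<tau> = l - \<alpha>"
    and "2 * real N > N'" and "N' > 4" and "\<tau> > -4"
    and "p\<^sub>s = (N' + 4 + 2 * \<tau>) / (N' - 4)"
    and "R > 0" and "B = ball 0 R"
  shows "(\<forall>q\<in>{1..p\<^sub>s + 1}. continuous_embedding
            (D2_rad \<alpha> B) (D2_norm \<alpha> B) (Lq_weighted q l B) (Lq_weighted_norm q l B)) \<and>
         (\<forall>q\<in>{1..<p\<^sub>s + 1}. compact_embedding
            (D2_rad \<alpha> B) (D2_norm \<alpha> B) (Lq_weighted q l B) (Lq_weighted_norm q l B))"
proof -
  define p where "p = (4 - (real CARD('n) + \<alpha>)) / 2"
  define m where "m = 2 - real CARD('n)"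
  have n: "real CARD('n) > \<alpha>" "real CARD('n) + \<alpha> > 4" "CARD('n) \<ge> 3" using assms by auto
  have p: "p < 0" and pN: "N' - 4 = - 2 * p" using n assms by (auto simp: p_def)
  \<comment> \<open>At \<open>q = p\<^sub>s + 1\<close> the pointwise bound yields exactly the borderline exponent \<open>-N\<close>.\<close>
  have crit: "l + p * (p\<^sub>s + 1) = - real CARD('n)"
  proof -
    have "p\<^sub>s + 1 = (2 * N' + 2 * \<tau>) / (N' - 4)" using assms(6,8) by (simp add: field_simps)
    then have "(p\<^sub>s + 1) * (N' - 4) = 2 * N' + 2 * \<tau>" using assms(6) by simp
    then have "p * (p\<^sub>s + 1) = - N' - \<tau>" unfolding pN by (simp add: algebra_simps)
    then show ?thesis using assms by simp
  qed
  \<comment> \<open>This is where \<open>\<tau> > -4\<close> enters.\<close>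
  have ps: "p\<^sub>s + 1 \<ge> 2"
    using assms(6,7) by (simp add: assms(8) field_simps)
  have [measurable]: "(ball 0 R :: (real^'n) set) \<in> sets borel" by simp
  note R = \<open>R > 0\<close> and B = \<open>B = ball 0 R\<close>
  obtain C where C0: "C \<ge> 0" and profile': "\<And>f. f \<in> D2_rad \<alpha> (ball 0 R :: (real^'n) set) \<Longrightarrow>
    \<exists>F \<in> borel_measurable borel.
      (AE x in lebesgue. x \<in> ball 0 R \<longrightarrow> f x = F (norm x)) \<and>
      (\<forall>r>0. \<bar>F r\<bar> \<le> C * r powr p * D2_norm \<alpha> (ball 0 R) f) \<and>
      (\<forall>r>0. \<forall>s>0. \<bar>F r - F s\<bar> \<le> C * \<bar>r powr m - s powr m\<bar> * D2_norm \<alpha> (ball 0 R) f) \<and>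
      (\<integral>\<^sup>+y. ennreal (norm (y::real^'n) powr (\<alpha> - 4) * (F (norm y))\<^sup>2) \<partial>lborel) \<le>
        ennreal (C * (D2_norm \<alpha> (ball 0 R) f)\<^sup>2)"
    using that by (rule D2_rad_profile[OF n R, folded p_def m_def])
  have profile: "\<exists>F \<in> borel_measurable borel.
      (AE x in lebesgue. x \<in> ball 0 R \<longrightarrow> f x = F (norm x)) \<and>
      (\<forall>r>0. \<bar>F r\<bar> \<le> C * r powr p * D2_norm \<alpha> B f) \<and>
      (\<forall>r>0. \<forall>s>0. \<bar>F r - F s\<bar> \<le> C * \<bar>r powr m - s powr m\<bar> * D2_norm \<alpha> B f) \<and>
      (\<integral>\<^sup>+y. ennreal (norm (y::real^'n) powr (\<alpha> - 4) * (F (norm y))\<^sup>2) \<partial>lborel) \<le>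
        ennreal (C * (D2_norm \<alpha> B f)\<^sup>2)" if "f \<in> D2_rad \<alpha> B" for f
    using profile'[of f] that unfolding B by blast
  have meas: "f \<in> borel_measurable (lebesgue_on (ball 0 R))" and c0: "D2_norm \<alpha> B f \<ge> 0"
    if "f \<in> D2_rad \<alpha> B" for f
    using that B D2_norm_nonneg by (auto simp: D2_rad_def D2_def D2_approx_def)
  have sub: "l + p * q > - real CARD('n)" if "q < p\<^sub>s + 1" for q
    using mult_strict_left_mono_neg[OF that p] crit by simp
  have bound: "\<exists>D\<ge>0. \<forall>F c. F \<in> borel_measurable borel \<longrightarrow> c \<ge> 0 \<longrightarrow>
      (\<forall>r>0. \<bar>F r\<bar> \<le> C * r powr p * c) \<longrightarrow>
      (\<integral>\<^sup>+y. ennreal (norm (y::real^'n) powr (\<alpha> - 4) * (F (norm y))\<^sup>2) \<partial>lborel) \<le> ennreal (C * c\<^sup>2) \<longrightarrow>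
      (\<integral>\<^sup>+x. ennreal (indicator (ball 0 R) (x::real^'n) * (norm x powr l * \<bar>F (norm x)\<bar> powr q)) \<partial>lborel) \<le>
        ennreal (D * c powr q)" if q: "q \<in> {1..p\<^sub>s + 1}" for q
  proof (cases "q = p\<^sub>s + 1")
    case False
    then obtain D where "D \<ge> 0" "\<And>F c. c \<ge> 0 \<Longrightarrow> (\<forall>r>0. \<bar>F r\<bar> \<le> C * r powr p * c) \<Longrightarrow>
      (\<integral>\<^sup>+x. ennreal (indicator (ball 0 R) (x::real^'n) * (norm x powr l * \<bar>F (norm x)\<bar> powr q)) \<partial>lborel) \<le>
        ennreal (D * c powr q)"
      using nn_integral_profile_subcritical[OF sub R _ C0, of q] q by auto
    then show ?thesis by blast
  next
    case True
    have "p * (q - 2) = p * (p\<^sub>s + 1) - 2 * p" unfolding True by (simp add: algebra_simps)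
    moreover have "2 * p = 4 - (real CARD('n) + \<alpha>)" by (simp add: p_def)
    ultimately have "l + p * (q - 2) = \<alpha> - 4" using crit by linarith
    then show ?thesis
      using nn_integral_profile_critical[of l p q "\<alpha> - 4" C _ _ R, where 'n='n] C0 ps True
      by (intro exI[of _ "C powr (q - 2) * C"]) auto
  qed
  have cont: "continuous_embedding (D2_rad \<alpha> B) (D2_norm \<alpha> B) (Lq_weighted q l B) (Lq_weighted_norm q l B)"
    if q: "q \<in> {1..p\<^sub>s + 1}" for q
  proof -
    obtain D where D: "D \<ge> 0" "\<And>F c. F \<in> borel_measurable borel \<Longrightarrow> c \<ge> 0 \<Longrightarrow>
      (\<forall>r>0. \<bar>F r\<bar> \<le> C * r powr p * c) \<Longrightarrow>
      (\<integral>\<^sup>+y. ennreal (norm (y::real^'n) powr (\<alpha> - 4) * (F (norm y))\<^sup>2) \<partial>lborel) \<le> ennreal (C * c\<^sup>2) \<Longrightarrow>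
      (\<integral>\<^sup>+x. ennreal (indicator (ball 0 R) (x::real^'n) * (norm x powr l * \<bar>F (norm x)\<bar> powr q)) \<partial>lborel) \<le>
        ennreal (D * c powr q)"
      using bound[OF q] by blast
    have "f \<in> Lq_weighted q l B \<and> Lq_weighted_norm q l B f \<le> D powr (1 / q) * D2_norm \<alpha> B f"
      if f: "f \<in> D2_rad \<alpha> B" for f
    proof -
      obtain F where F: "F \<in> borel_measurable borel" "AE x in lebesgue. x \<in> ball 0 R \<longrightarrow> f x = F (norm x)"
        "\<forall>r>0. \<bar>F r\<bar> \<le> C * r powr p * D2_norm \<alpha> B f"
        "(\<integral>\<^sup>+y. ennreal (norm (y::real^'n) powr (\<alpha> - 4) * (F (norm y))\<^sup>2) \<partial>lborel) \<le>
          ennreal (C * (D2_norm \<alpha> B f)\<^sup>2)"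
        using profile[OF f] by blast
      have "(D * D2_norm \<alpha> B f powr q) powr (1 / q) = D powr (1 / q) * D2_norm \<alpha> B f"
        using D(1) c0[OF f] q by (simp add: powr_mult powr_powr)
      then show ?thesis
        using Lq_weighted_radial(1,2)[OF meas[OF f] F(1,2) _ _ D(2)[OF F(1) c0[OF f] F(3,4)]] q D(1) B by simp
    qed
    then show ?thesis unfolding continuous_embedding_def by blast
  qed
  have "compact_embedding (D2_rad \<alpha> B) (D2_norm \<alpha> B) (Lq_weighted q l B) (Lq_weighted_norm q l B)"
    if q: "q \<in> {1..<p\<^sub>s + 1}" for q
    unfolding compact_embedding_def
  proof (intro conjI allI impI)
    show "continuous_embedding (D2_rad \<alpha> B) (D2_norm \<alpha> B) (Lq_weighted q l B) (Lq_weighted_norm q l B)"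
      using q by (intro cont) auto
    fix u :: "nat \<Rightarrow> real^'n \<Rightarrow> real" and M
    assume "\<forall>n. u n \<in> D2_rad \<alpha> B \<and> D2_norm \<alpha> B (u n) \<le> M"
    then have u: "u n \<in> D2_rad \<alpha> B" and uM: "D2_norm \<alpha> B (u n) \<le> M" for n by auto
    have M: "M \<ge> 0" using c0[OF u] uM by (rule order_trans)
    have "\<forall>n. \<exists>F. F \<in> borel_measurable borel \<and>
      (AE x in lebesgue. x \<in> ball 0 R \<longrightarrow> u n x = F (norm x)) \<and>
      (\<forall>r>0. \<bar>F r\<bar> \<le> C * r powr p * D2_norm \<alpha> B (u n)) \<and>
      (\<forall>r>0. \<forall>s>0. \<bar>F r - F s\<bar> \<le> C * \<bar>r powr m - s powr m\<bar> * D2_norm \<alpha> B (u n))"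
      using profile[OF u] by blast
    from choice[OF this] obtain F where F: "\<And>n. F n \<in> borel_measurable borel \<and>
      (AE x in lebesgue. x \<in> ball 0 R \<longrightarrow> u n x = F n (norm x)) \<and>
      (\<forall>r>0. \<bar>F n r\<bar> \<le> C * r powr p * D2_norm \<alpha> B (u n)) \<and>
      (\<forall>r>0. \<forall>s>0. \<bar>F n r - F n s\<bar> \<le> C * \<bar>r powr m - s powr m\<bar> * D2_norm \<alpha> B (u n))"
      by blast
    have Fm[measurable]: "F n \<in> borel_measurable borel"
      and uF: "AE x in lebesgue. x \<in> ball 0 R \<longrightarrow> u n x = F n (norm x)"
      and F1: "r > 0 \<Longrightarrow> \<bar>F n r\<bar> \<le> C * r powr p * D2_norm \<alpha> B (u n)"
      and F2: "r > 0 \<Longrightarrow> s > 0 \<Longrightarrow> \<bar>F n r - F n s\<bar> \<le> C * \<bar>r powr m - s powr m\<bar> * D2_norm \<alpha> B (u n)"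
      for n r s using F[of n] by auto
    have F1': "\<bar>F n r\<bar> \<le> C * r powr p * M" if "r > 0" for n r
      using F1[OF that, of n] mult_left_mono[OF uM, of "C * r powr p" n] C0 by simp
    have F2': "\<bar>F n r - F n s\<bar> \<le> C * M * \<bar>r powr m - s powr m\<bar>" if "r > 0" "s > 0" for n r s
      using F2[OF that, of n] mult_left_mono[OF uM, of "C * \<bar>r powr m - s powr m\<bar>" n] C0 by (simp add: mult_ac)
    have F1'': "\<bar>F n r\<bar> \<le> C * M * r powr p" if "r > 0" for n r
      using F1'[OF that, of n] by (simp add: mult_ac)
    have "\<exists>k G. strict_mono (k :: nat \<Rightarrow> nat) \<and> (\<forall>r>0. (\<lambda>n. F (k n) r) \<longlonglongrightarrow> G r)"
      by (rule Lipschitz_powr_convergent_subsequence[of F "C * M" p m]) (use F1'' F2' in blast)+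
    then obtain k G where k: "strict_mono (k :: nat \<Rightarrow> nat)" and G: "\<And>r. r > 0 \<Longrightarrow> (\<lambda>n. F (k n) r) \<longlonglongrightarrow> G r"
      by blast
    \<comment> \<open>\<open>G\<close> is arbitrary on the nonpositive reals, where the sequence need not converge.\<close>
    define H where "H = (\<lambda>r. if r > 0 then G r else 0)"
    have H: "(\<lambda>n. if r > 0 then F (k n) r else 0) \<longlonglongrightarrow> H r" for r
      using G by (auto simp: H_def)
    have Hm[measurable]: "H \<in> borel_measurable borel"
      by (rule borel_measurable_LIMSEQ_metric[OF _ H]) measurable
    have H1: "\<bar>H r\<bar> \<le> C * r powr p * M" if "r > 0" for r
      using G[OF that] F1'[OF that] that
      by (intro LIMSEQ_le_const2[OF tendsto_rabs]) (auto simp: H_def)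
    have FH: "\<bar>F n r - H r\<bar> \<le> C * r powr p * (2 * M)" if "r > 0" for n r
      using F1'[OF that, of n] H1[OF that] by linarith
    obtain D where D: "D \<ge> 0" "\<And>F c. c \<ge> 0 \<Longrightarrow> (\<forall>r>0. \<bar>F r\<bar> \<le> C * r powr p * c) \<Longrightarrow>
      (\<integral>\<^sup>+x. ennreal (indicator (ball 0 R) (x::real^'n) * (norm x powr l * \<bar>F (norm x)\<bar> powr q)) \<partial>lborel) \<le>
        ennreal (D * c powr q)"
      using nn_integral_profile_subcritical[OF sub R _ C0, of q] q by auto
    have f_meas: "(\<lambda>x::real^'n. H (norm x)) \<in> borel_measurable (lebesgue_on (ball 0 R))"
      by (intro measurable_restrict_space1 measurable_completion) measurable
    show "\<exists>f\<in>Lq_weighted q l B. \<exists>r. strict_mono r \<and> (\<lambda>k. Lq_weighted_norm q l B (\<lambda>x. u (r k) x - f x)) \<longlonglongrightarrow> 0"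
    proof (intro bexI[of _ "\<lambda>x. H (norm x)"] exI[of _ k] conjI k)
      show "(\<lambda>x. H (norm x)) \<in> Lq_weighted q l B"
        unfolding B by (rule Lq_weighted_radial(1)[OF f_meas Hm _ _ _ D(2)[OF M]]) (use q D(1) H1 in auto)
      let ?J = "\<lambda>n. LINT x|lborel. indicator (ball 0 R) (x::real^'n) * (norm x powr l * \<bar>F (k n) (norm x) - H (norm x)\<bar> powr q)"
      have J: "Lq_weighted_norm q l B (\<lambda>x. u (k n) x - H (norm x)) = ?J n powr (1 / q)" for n
        unfolding B
      proof (rule Lq_weighted_radial(3)[OF _ _ _ _ _ D(2)[of "2 * M" "\<lambda>r. F (k n) r - H r"]])
        show "(\<lambda>x. u (k n) x - H (norm x)) \<in> borel_measurable (lebesgue_on (ball 0 R))"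
          using meas[OF u] f_meas by (rule borel_measurable_diff)
        show "AE x in lebesgue. x \<in> ball 0 R \<longrightarrow> u (k n) x - H (norm x) = F (k n) (norm x) - H (norm x)"
          using uF[of "k n"] by eventually_elim auto
      qed (use q D(1) M FH in auto)
      have "?J \<longlonglongrightarrow> (LINT x|(lborel :: (real^'n) measure). (0::real))"
      proof (rule integral_dominated_convergence[where
            w="\<lambda>x::real^'n. (C * (2 * M)) powr q * (indicator (ball 0 R) x * norm x powr (l + p * q))"])
        obtain A where "(\<integral>\<^sup>+x. ennreal (indicator (ball 0 R) (x::real^'n) * norm x powr (l + p * q)) \<partial>lborel) \<le> ennreal A"
          using nn_integral_ball_powr[OF sub R, of q] q by auto
        then show "integrable lborel (\<lambda>x::real^'n. (C * (2 * M)) powr q * (indicator (ball 0 R) x * norm x powr (l + p * q)))"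
          by (intro integrable_mult_right integrableI_bounded) (auto simp: abs_mult top_unique less_top[symmetric])
        show "AE x in lborel. (\<lambda>n. indicator (ball 0 R) (x::real^'n) * (norm x powr l * \<bar>F (k n) (norm x) - H (norm x)\<bar> powr q)) \<longlonglongrightarrow> 0"
        proof (rule AE_I2)
          fix x :: "real^'n"
          show "(\<lambda>n. indicator (ball 0 R) x * (norm x powr l * \<bar>F (k n) (norm x) - H (norm x)\<bar> powr q)) \<longlonglongrightarrow> 0"
          proof (cases "x = 0")
            case False
            then have "(\<lambda>n. F (k n) (norm x) - H (norm x)) \<longlonglongrightarrow> 0"
              using G[of "norm x"] by (intro LIM_zero) (simp add: H_def)
            then have "(\<lambda>n. \<bar>F (k n) (norm x) - H (norm x)\<bar> powr q) \<longlonglongrightarrow> 0"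
              using q by (intro tendsto_zero_powrI[OF tendsto_rabs_zero tendsto_const]) auto
            then show ?thesis by (intro tendsto_mult_right_zero)
          qed simp
        qed
        show "AE x in lborel. norm (indicator (ball 0 R) (x::real^'n) * (norm x powr l * \<bar>F (k n) (norm x) - H (norm x)\<bar> powr q)) \<le>
            (C * (2 * M)) powr q * (indicator (ball 0 R) x * norm x powr (l + p * q))" for n
        proof (rule AE_I2)
          fix x :: "real^'n"
          show "norm (indicator (ball 0 R) x * (norm x powr l * \<bar>F (k n) (norm x) - H (norm x)\<bar> powr q)) \<le>
            (C * (2 * M)) powr q * (indicator (ball 0 R) x * norm x powr (l + p * q))"
          proof (cases "x = 0")
            case False
            then have "\<bar>F (k n) (norm x) - H (norm x)\<bar> powr q \<le> (C * norm x powr p * (2 * M)) powr q"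
              using FH q by (intro powr_mono2) auto
            also have "\<dots> = (C * (2 * M)) powr q * norm x powr (p * q)"
              using C0 M by (simp add: powr_mult powr_powr)
            finally have "norm x powr l * \<bar>F (k n) (norm x) - H (norm x)\<bar> powr q \<le>
                norm x powr l * ((C * (2 * M)) powr q * norm x powr (p * q))"
              by (intro mult_left_mono) auto
            then show ?thesis by (auto simp: indicator_def powr_add abs_mult mult_ac)
          qed simp
        qed
      qed measurable
      then have "(\<lambda>n. ?J n powr (1 / q)) \<longlonglongrightarrow> 0"
        using q by (intro tendsto_zero_powrI[OF _ tendsto_const]) (auto intro!: integral_nonneg_AE always_eventually)
      then show "(\<lambda>n. Lq_weighted_norm q l B (\<lambda>x. u (k n) x - H (norm x))) \<longlonglongrightarrow> 0"
        by (simp add: J)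
    qed
  qed
  with cont show ?thesis by blast
qed

end
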